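(* Let $k\geq 4$ be an integer, let $B_k$ be the bipyramid over a $k$-gon, let $\sigma(B_k)$ be its Springborn degree, and let $\phi$ be Euler's totient function. If $k$ is odd, then $\sigma(B_k)$ is either $\frac{1}{2}\phi(k)$ or $\phi(k)$. If $k$ is even, then $\sigma(B_k)=\phi(k)$. In particular, the Springborn degree of a $3$-polytope is not bounded by any constant.
   Context: A $3$-polytope is a $3$-dimensional convex polytope. Two polytopes are combinatorially equivalent if their face lattices are isomorphic; a realization of $P$ is a polytope in $\mathbb{R}^3$ combinatorially equivalent to $P$. A Koebe realization of a $3$-polytope $P$ is a realization $Q\subset\mathbb{R}^3$ of $P$ such that every edge (line segment) of $Q$ is tangent to the unit sphere $\mathbb{S}^2\subset\mathbb{R}^3$; the points of tangency are the contact points, one per edge. The edge barycenter of $Q$ is the arithmetic mean of its contact points. A Springborn realization of $P$ is a Koebe realization whose edge barycenter is the origin. For a realization $R$, $\mathbb{Q}[R]$ denotes the extension field of $\mathbb{Q}$ generated by all vertex coordinates of $R$. The Springborn degree $\sigma(P)$ is the minimum of $|\mathbb{Q}[Q]:\mathbb{Q}|$, where $Q$ ranges over all Springborn realizations of $P$ (this minimum is finite). *)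

theory Defs
  imports
    "HOL-Analysis.Analysis"
    "HOL-Algebra.Algebraic_Closure_Type"
    "HOL-Algebra.Generated_Fields"
    "HOL-Number_Theory.Totient"
    "HOL-Library.Extended_Nat"
begin

definition three_polytope :: "(real^3) set \<Rightarrow> bool" where
  "three_polytope P \<longleftrightarrow> polytope P \<and> aff_dim P = 3"

(* face_of admits the improper faces {} and P, so this is the whole face lattice. *)
definition faces :: "(real^3) set \<Rightarrow> (real^3) set set" where
  "faces P = {F. F face_of P}"

definition comb_equiv :: "(real^3) set \<Rightarrow> (real^3) set \<Rightarrow> bool" where
  "comb_equiv P Q \<longleftrightarrow>
     (\<exists>f. bij_betw f (faces P) (faces Q) \<and>
          (\<forall>F\<in>faces P. \<forall>G\<in>faces P. F \<subseteq> G \<longleftrightarrow> f F \<subseteq> f G))"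

definition realization :: "(real^3) set \<Rightarrow> (real^3) set \<Rightarrow> bool" where
  "realization P Q \<longleftrightarrow> polytope Q \<and> comb_equiv P Q"

(* The line spanned by e touches the sphere in a single point, and that point
   lies on the segment e itself. *)
definition tangent_at :: "(real^3) set \<Rightarrow> real^3 \<Rightarrow> bool" where
  "tangent_at e x \<longleftrightarrow> x \<in> e \<and> affine hull e \<inter> sphere 0 1 = {x}"

definition koebe_realization :: "(real^3) set \<Rightarrow> (real^3) set \<Rightarrow> bool" where
  "koebe_realization P Q \<longleftrightarrow>
     realization P Q \<and> (\<forall>e. e edge_of Q \<longrightarrow> (\<exists>x. tangent_at e x))"

definition contact_point :: "(real^3) set \<Rightarrow> real^3" where
  "contact_point e = (THE x. tangent_at e x)"

definition edge_barycenter :: "(real^3) set \<Rightarrow> real^3" where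
  "edge_barycenter Q =
     (\<Sum>e\<in>{e. e edge_of Q}. contact_point e) /\<^sub>R real (card {e. e edge_of Q})"

definition springborn_realization :: "(real^3) set \<Rightarrow> (real^3) set \<Rightarrow> bool" where
  "springborn_realization P Q \<longleftrightarrow> koebe_realization P Q \<and> edge_barycenter Q = 0"

(* A subfield of the reals automatically contains the rationals, so the subfield
   generated by the coordinates is the extension of the rationals they generate. *)
definition coordinate_field :: "(real^3) set \<Rightarrow> real set" where
  "coordinate_field R =
     generate_field (ring_of_type_algebra :: real ring) {v $ i | v i. v extreme_point_of R}"

definition degree_over_rat :: "real set \<Rightarrow> enat" where
  "degree_over_rat K =
     (if \<exists>n. ring.dimension (ring_of_type_algebra :: real ring) n \<rat> K
      then enat (THE n. ring.dimension (ring_of_type_algebra :: real ring) n \<rat> K)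
      else \<infinity>)"

(* Every nonempty set of extended naturals contains its infimum, so Inf is the minimum
   whenever P has a Springborn realization (and is \<infinity> otherwise). *)
definition springborn_degree :: "(real^3) set \<Rightarrow> enat" where
  "springborn_degree P =
     Inf {degree_over_rat (coordinate_field Q) | Q. springborn_realization P Q}"

definition standard_bipyramid :: "nat \<Rightarrow> (real^3) set" where
  "standard_bipyramid k =
     convex hull ({vector [cos (2 * pi * real j / real k), sin (2 * pi * real j / real k), 0] | j. j < k}
                  \<union> {vector [0, 0, 1], vector [0, 0, -1]})"

(* The bipyramid over a k-gon as a combinatorial type; the one over the
   regular k-gon serves as a representative. *)
definition bipyramid_over_ngon :: "nat \<Rightarrow> (real^3) set \<Rightarrow> bool" where
  "bipyramid_over_ngon k B \<longleftrightarrow> three_polytope B \<and> comb_equiv (standard_bipyramid k) B"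

end

theory Submission
  imports Defs
begin

text \<open>
  A vertex v of a Koebe realization lies outside the unit sphere; with t the length of its tangent
  segments, (v, 1) / t is a unit space-like vector of Lorentz space, and adjacent vertices have Lorentz
  product -1. For a bipyramid with apices N, S and equator V(i) a dimension count gives
  V(i+2) + V(i) = a V(i+1) + b (N + S), which determines the configuration up to a Lorentz transformation
  and up to the winding number m of the equator. The contact points are always
  balanced about the centre N + S of the configuration, and the barycenter condition says that they are
  balanced about the origin; a pointwise inequality shows that such a centre is unique, so that N + S
  points in the time direction. Hence the vertices form a regular (possibly star-shaped) bipyramid, and the determinant of two consecutive equator
  vertices and an apex is, up to sign, 2 / cos(pi m / k) with m coprime to k. So every Springborn
  realization has cos(pi m / k) in its coordinate field, and the tower law restricts the degree to
  multiples of [Q(cos(pi m / k)) : Q]. The convex regular bipyramid shows that totient k is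
  attained as an upper bound. The winding number need not be excluded, because the cosines for all m coprime to k
  have the same degree.
\<close>

text \<open>The lower bound concerns every Springborn realization, and a rotation changes the
  coordinates. So a polynomial in the coordinates is needed that no rotation can alter; the
  determinant of three vertices is one. The numbers arise as follows. For odd \<open>m\<close> the
  angle pi m / k is 2 pi m / (2 k), and its cosine has degree totient (2 k) / 2; for even
  \<open>m\<close> (then \<open>k\<close> is odd) the degree is totient k / 2. This is totient k for
  even \<open>k\<close> and totient k / 2 for odd \<open>k\<close>. The explicit realization
  involves sin (pi / k) as well as cos (pi / k); both lie in the field of cos (2 pi / N) with N the
  least common multiple of 2 k and 4, whose degree totient N / 2 equals totient k. For even
  \<open>k\<close> the two bounds meet, for odd \<open>k\<close> they differ by a factor of 2, which
  leaves the two alternatives. The degrees of the cosines rest on the irreducibility of cyclotomic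
  polynomials, in the form that a root of unity and its coprime powers are roots of the same minimal
  integer polynomial.\<close>

hide_const (open) Divisibility.prime module.smult Polynomials.degree Polynomials.lead_coeff
  UnivPoly.monom up_ring.coeff up_ring.monom

section \<open>Degrees of roots of unity\<close>

abbreviation of_int_poly :: "int poly \<Rightarrow> 'a :: {comm_ring_1, ring_char_0} poly" where
  "of_int_poly \<equiv> map_poly of_int"

lemma of_int_poly_add: "of_int_poly (p + q) = of_int_poly p + of_int_poly q"
  by (intro poly_eqI) (simp add: coeff_map_poly)

lemma of_int_poly_diff: "of_int_poly (p - q) = of_int_poly p - of_int_poly q"
  by (intro poly_eqI) (simp add: coeff_map_poly)

lemma of_int_poly_mult: "of_int_poly (p * q) = of_int_poly p * of_int_poly q"
  by (intro poly_eqI) (simp add: coeff_map_poly coeff_mult)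

text \<open>Pseudo-division multiplies the dividend by a power of the leading coefficient of the
  divisor; that coefficient is 1, so this is genuine division with remainder over the
  integers.\<close>

lemma monic_int_division:
  fixes f g :: "int poly"
  assumes "Polynomial.lead_coeff f = 1"
  obtains q r where "g = f * q + r" "r = 0 \<or> Polynomial.degree r < Polynomial.degree f"
proof -
  have f0: "f \<noteq> 0" using assms by auto
  obtain q r where qr: "pseudo_divmod g f = (q, r)" by fastforce
  show thesis using pseudo_divmod[OF f0 qr] assms that by auto
qed

text \<open>The binomial coefficients \<open>p choose k\<close> with 0 < k < p are divisible by
  \<open>p\<close>. The ring is general because the fact serves both integers and integer
  polynomials.\<close>

lemma freshmans_dream_mod_prime:
  fixes x y :: "'a :: comm_ring_1"
  assumes "prime p"
  shows "of_nat p dvd (x + y) ^ p - (x ^ p + y ^ p)"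
proof -
  have p: "p > 1" using assms prime_gt_1_nat by blast
  have *: "{..p} = insert 0 (insert p {0<..<p})" using p by auto
  have "(x + y) ^ p = (\<Sum>k\<le>p. of_nat (p choose k) * x ^ k * y ^ (p - k))"
    by (rule binomial_ring)
  also have "\<dots> = x ^ p + y ^ p + (\<Sum>k\<in>{0<..<p}. of_nat (p choose k) * x ^ k * y ^ (p - k))"
    unfolding * using p by simp
  finally have "(x + y) ^ p - (x ^ p + y ^ p) = (\<Sum>k\<in>{0<..<p}. of_nat (p choose k) * x ^ k * y ^ (p - k))"
    by simp
  also have "of_nat p dvd \<dots>"
  proof (intro dvd_sum)
    fix k assume k: "k \<in> {0<..<p}"
    then have "p dvd (p choose k)" using assms by (intro dvd_choose_prime) auto
    then have "(of_nat p :: 'a) dvd of_nat (p choose k)" by (metis dvd_def of_nat_mult)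
    then show "of_nat p dvd of_nat (p choose k) * x ^ k * y ^ (p - k)" by (simp add: dvd_mult2)
  qed
  finally show ?thesis .
qed

text \<open>Fermat's little theorem: induction over the naturals by the freshman's dream, then
  reduction of \<open>a\<close> modulo \<open>p\<close>.\<close>

lemma prime_dvd_power_minus_self:
  fixes a :: int
  assumes "prime p"
  shows "int p dvd a ^ p - a"
proof -
  have p: "p > 1" using assms prime_gt_1_nat by blast
  have *: "int p dvd int b ^ p - int b" for b
  proof (induction b)
    case 0
    then show ?case using p by (simp add: power_0_left)
  next
    case (Suc b)
    have "int p dvd (int b + 1) ^ p - (int b ^ p + 1 ^ p)"
      using freshmans_dream_mod_prime[OF assms, of "int b" 1] by simp
    from dvd_add[OF this Suc] show ?case by (simp add: algebra_simps)
  qed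
  define b where "b = nat (a mod int p)"
  have ab: "[a = int b] (mod int p)" using p by (simp add: b_def cong_def)
  have "[int b ^ p = int b] (mod int p)" using * by (simp add: cong_iff_dvd_diff)
  then have "[a ^ p = a] (mod int p)"
    using ab by (meson cong_pow cong_sym cong_trans)
  then show ?thesis by (simp add: cong_iff_dvd_diff)
qed

text \<open>The Frobenius map: modulo \<open>p\<close>, f(X^p) is the p-th power of f(X), because
  Frobenius is additive and fixes the integer coefficients.\<close>

lemma poly_frobenius_mod_prime:
  fixes f :: "int poly"
  assumes "prime p"
  shows "of_nat p dvd pcompose f (monom 1 p) - f ^ p"
proof (induction f)
  case 0
  then show ?case using prime_gt_0_nat[OF assms] by (simp add: power_0_left)
next
  case (pCons a f)
  have 1: "(of_nat p :: int poly) dvd [:a:] - [:a:] ^ p"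
  proof -
    obtain k where "a ^ p - a = int p * k" using prime_dvd_power_minus_self[OF assms] by blast
    then have "[:a:] - [:a:] ^ p = of_nat p * [:-k:]"
      by (simp add: poly_const_pow of_nat_poly algebra_simps)
    then show ?thesis by (metis dvd_triv_left)
  qed
  have m: "monom 1 p = [:0,1::int:] ^ p" by (simp add: monom_altdef)
  have X: "[:0,1:] * f = pCons 0 f" by simp
  have 2: "(of_nat p :: int poly) dvd ([:a:] + [:0,1:] * f) ^ p - ([:a:] ^ p + ([:0,1:] * f) ^ p)"
    by (rule freshmans_dream_mod_prime[OF assms])
  have e: "pCons a f = [:a:] + [:0,1:] * f" by simp
  have "pcompose (pCons a f) (monom 1 p) = [:a:] + [:0,1:] ^ p * pcompose f (monom 1 p)"
    by (simp add: pcompose_pCons m)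
  \<comment> \<open>Three multiples of \<open>p\<close>: Fermat for the constant term, X^p times the
    induction hypothesis, and the error of the freshman's dream.\<close>
  then have "pcompose (pCons a f) (monom 1 p) - (pCons a f) ^ p
     = ([:a:] - [:a:] ^ p) + [:0,1:] ^ p * (pcompose f (monom 1 p) - f ^ p)
       - (([:a:] + [:0,1:] * f) ^ p - ([:a:] ^ p + ([:0,1:] * f) ^ p))"
    unfolding e by (simp add: power_mult_distrib right_diff_distrib del: mult_pCons_left)
  then show ?case using 1 2 pCons.IH by (metis dvd_add dvd_diff dvd_mult)
qed

text \<open>The monic generator of the ideal of integer polynomials vanishing at \<open>z\<close>.
  Stating it through divisibility over the integers keeps rational polynomials out of the
  argument.\<close>

definition min_int_poly :: "complex \<Rightarrow> int poly \<Rightarrow> bool" where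
  "min_int_poly z f \<longleftrightarrow> Polynomial.lead_coeff f = 1 \<and> (\<forall>g. poly (of_int_poly g) z = 0 \<longleftrightarrow> f dvd g)"

lemma min_int_polyD:
  assumes "min_int_poly z f"
  shows "Polynomial.lead_coeff f = 1" "poly (of_int_poly g) z = 0 \<longleftrightarrow> f dvd g" "f \<noteq> 0"
  using assms by (auto simp: min_int_poly_def)

text \<open>The generator is the primitive part of a nonzero vanishing polynomial of least degree.
  By Gauss's lemma it divides every vanishing polynomial over the integers; since it divides the
  monic \<open>h\<close>, its leading coefficient is a unit.\<close>

lemma ex_min_int_poly:
  fixes z :: complex
  assumes "Polynomial.lead_coeff h = 1" "poly (of_int_poly h) z = 0"
  shows "\<exists>f. min_int_poly z f"
proof -
  have h0: "h \<noteq> 0" using assms by auto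
  define P where "P g \<longleftrightarrow> g \<noteq> 0 \<and> poly (of_int_poly g) z = 0" for g :: "int poly"
  obtain g where g: "P g" and gmin: "\<And>g'. P g' \<Longrightarrow> Polynomial.degree g \<le> Polynomial.degree g'"
    using exists_least_iff[of "\<lambda>n. \<exists>g. P g \<and> Polynomial.degree g = n"] h0 assms(2)
    by (metis P_def not_less)
  \<comment> \<open>The pseudo-remainder vanishes at \<open>z\<close> and has smaller degree than
    \<open>g\<close>, so it is 0: a nonzero integer multiple of \<open>u\<close> is a multiple of
    \<open>g\<close>.\<close>
  have pd: "\<exists>a q. a \<noteq> 0 \<and> smult a u = g * q" if u: "poly (of_int_poly u) z = 0" for u
  proof -
    have "g \<noteq> 0" using g by (simp add: P_def)
    from pseudo_mod[OF this, of u] obtain a q where aq: "a \<noteq> 0" "smult a u = g * q + pseudo_mod u g"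
      and d: "pseudo_mod u g = 0 \<or> Polynomial.degree (pseudo_mod u g) < Polynomial.degree g" by blast
    have "of_int_poly (pseudo_mod u g) = of_int_poly (smult a u) - of_int_poly g * (of_int_poly q :: complex poly)"
      using aq by (simp add: of_int_poly_mult of_int_poly_add of_int_poly_diff)
    then have "poly (of_int_poly (pseudo_mod u g)) z = 0"
      using u g by (simp add: P_def map_poly_smult)
    then have "pseudo_mod u g = 0" using d gmin[of "pseudo_mod u g"] by (force simp: P_def)
    then show ?thesis using aq by auto
  qed
  have g0: "g \<noteq> 0" using g by (simp add: P_def)
  define g' where "g' = primitive_part g"
  have ggs: "g = smult (content g) g'" by (simp add: g'_def)
  \<comment> \<open>Passing to primitive parts, which are multiplicative, removes the integer
    factor.\<close>
  have pp: "g' dvd u" if u: "poly (of_int_poly u) z = 0" for u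
  proof -
    obtain b w where b: "b \<noteq> 0" "smult b u = g * w" using pd[OF u] by blast
    then have "primitive_part (smult b u) = g' * primitive_part w"
      by (simp add: primitive_part_mult g'_def)
    then have "g' dvd primitive_part (smult b u)" by simp
    moreover have "primitive_part (smult b u) dvd u"
    proof -
      have "primitive_part (smult b u) = smult (sgn b) (primitive_part u)"
        by (simp add: primitive_part_smult)
      moreover have "u = smult (sgn b) (primitive_part u) * [:sgn b * content u:]"
        using b by (simp add: sgn_if)
      ultimately show ?thesis by (metis dvd_triv_left)
    qed
    ultimately show ?thesis by (rule dvd_trans)
  qed
  have "of_int_poly g = Polynomial.smult (of_int (content g)) (of_int_poly g' :: complex poly)"
    by (subst ggs) (simp add: map_poly_smult)
  then have g'z: "poly (of_int_poly g') z = 0"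
    using g g0 by (simp add: P_def)
  have "g' dvd h" by (rule pp[OF assms(2)])
  then obtain w where "h = g' * w" by (elim dvdE)
  then have "Polynomial.lead_coeff g' * Polynomial.lead_coeff w = 1"
    using assms(1) by (simp add: lead_coeff_mult)
  then have unit: "Polynomial.lead_coeff g' * Polynomial.lead_coeff g' = 1" 
    by (metis dvd_triv_left zdvd1_eq abs_mult_self_eq mult_1)
  \<comment> \<open>The leading coefficient is 1 or -1, its own inverse, so multiplying by it makes
    the polynomial monic.\<close>
  define f where "f = Polynomial.smult (Polynomial.lead_coeff g') g'"
  have "g' \<noteq> 0" using g0 ggs by (metis smult_0_right)
  then have "Polynomial.lead_coeff f = 1" using unit by (simp add: f_def)
  moreover have "poly (of_int_poly u) z = 0" if "f dvd u" for u
  proof -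
    from that obtain w where "u = f * w" by (elim dvdE)
    then have "of_int_poly u = (of_int_poly f * of_int_poly w :: complex poly)"
       by (simp add: of_int_poly_mult)
    moreover have "poly (of_int_poly f) z = 0" using g'z by (simp add: f_def map_poly_smult)
    ultimately show ?thesis by simp
  qed
  moreover have "f dvd u" if "poly (of_int_poly u) z = 0" for u
  proof -
    have "f * [:Polynomial.lead_coeff g':] = Polynomial.smult (Polynomial.lead_coeff g' * Polynomial.lead_coeff g') g'"
      by (simp add: f_def)
    then have "g' = f * [:Polynomial.lead_coeff g':]" by (simp only: unit smult_1_left)
    then have "f dvd g'" by (metis dvd_triv_left)
    then show ?thesis using pp[OF that] dvd_trans by blast
  qed
  ultimately show ?thesis unfolding min_int_poly_def by blast
qed

lemma poly_of_int_pcompose_monom: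
  "poly (of_int_poly (pcompose f (monom 1 a))) (z :: complex) = poly (of_int_poly f) (z ^ a)"
proof (induction f)
  case (pCons c f)
  have "of_int_poly (pcompose (pCons c f) (monom 1 a)) = 
     [:of_int c:] + monom 1 a * (of_int_poly (pcompose f (monom 1 a)) :: complex poly)"
    by (simp add: pcompose_pCons of_int_poly_add of_int_poly_mult map_poly_monom map_poly_pCons)
  then show ?case using pCons by (simp add: poly_monom map_poly_pCons)
qed simp

text \<open>Landau's argument: reducing f(X^a) modulo f leaves only finitely many remainders, while for prime
  exponents p the remainder is divisible by p; so it vanishes for large p.\<close>

lemma min_int_poly_dvd_compose_large_prime:
  assumes f: "min_int_poly z f" and z: "z ^ n = 1" and n: "n > 0"
  shows "\<exists>A. \<forall>p. prime p \<longrightarrow> p > A \<longrightarrow> f dvd pcompose f (monom 1 p)"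
proof -
  have lc: "Polynomial.lead_coeff f = 1" and f0: "f \<noteq> 0" using f by (auto dest: min_int_polyD)
  have small: "r = 0" if "f dvd r" "r = 0 \<or> Polynomial.degree r < Polynomial.degree f" for r
    using that by (metis dvd_imp_degree_le not_less)
  have "\<exists>r. \<forall>a. f dvd pcompose f (monom 1 a) - r a \<and> (r a = 0 \<or> Polynomial.degree (r a) < Polynomial.degree f)"
  proof (rule choice, rule allI)
    fix a
    from monic_int_division[OF lc, of "pcompose f (monom 1 a)"]
    obtain q r where "pcompose f (monom 1 a) = f * q + r" "r = 0 \<or> Polynomial.degree r < Polynomial.degree f" .
    then show "\<exists>r. f dvd pcompose f (monom 1 a) - r \<and> (r = 0 \<or> Polynomial.degree r < Polynomial.degree f)"
      by (metis add_diff_cancel_right' dvd_triv_left)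
  qed
  then obtain r where r: "\<And>a. f dvd pcompose f (monom 1 a) - r a"
    "\<And>a. r a = 0 \<or> Polynomial.degree (r a) < Polynomial.degree f" by blast
  have sub: "u - v = 0 \<or> Polynomial.degree (u - v) < Polynomial.degree f"
    if "u = 0 \<or> Polynomial.degree u < Polynomial.degree f" "v = 0 \<or> Polynomial.degree v < Polynomial.degree f" for u v :: "int poly"
    using that degree_diff_le_max[of u v] by (cases "u = 0"; cases "v = 0") auto
  have uniq: "u = v" if "f dvd u - v"
    "u = 0 \<or> Polynomial.degree u < Polynomial.degree f" "v = 0 \<or> Polynomial.degree v < Polynomial.degree f" for u v
    using small[OF that(1) sub[OF that(2,3)]] by simp
  \<comment> \<open>The remainder is determined by the value f(z^a), and z^a depends only on
    \<open>a\<close> modulo \<open>n\<close>.\<close>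
  have per: "r a = r (a mod n)" for a
  proof -
    have "z ^ a = z ^ (n * (a div n) + a mod n)" by simp
    also have "\<dots> = z ^ (a mod n)" using z by (simp only: power_add power_mult) simp
    finally have "poly (of_int_poly (pcompose f (monom 1 a) - pcompose f (monom 1 (a mod n)))) z = 0"
      by (simp add: of_int_poly_diff poly_of_int_pcompose_monom)
    then have "f dvd pcompose f (monom 1 a) - pcompose f (monom 1 (a mod n))"
      using min_int_polyD(2)[OF f] by blast
    then have "f dvd (pcompose f (monom 1 a) - pcompose f (monom 1 (a mod n)))
       - (pcompose f (monom 1 a) - r a) + (pcompose f (monom 1 (a mod n)) - r (a mod n))"
      using r(1) by (meson dvd_add dvd_diff)
    then have "f dvd r a - r (a mod n)" by simp
    then show ?thesis using uniq r(2) by blast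
  qed
  \<comment> \<open>Only \<open>n\<close> different remainders occur, so one constant bounds all
    their coefficients.\<close>
  define A where "A = Max ((\<lambda>(a, i). nat \<bar>coeff (r a) i\<bar>) ` ({..<n} \<times> {..Polynomial.degree f}))"
  have bound: "nat \<bar>coeff (r a) i\<bar> \<le> A" for a i
  proof (cases "i \<le> Polynomial.degree f")
    case True
    then have "nat \<bar>coeff (r (a mod n)) i\<bar> \<le> A" unfolding A_def using n
      by (intro Max_ge) (auto intro!: image_eqI[where x = "(a mod n, i)"])
    then show ?thesis using per[of a] by simp
  next
    case False
    then have "coeff (r a) i = 0" using r(2)[of a] by (metis coeff_0 coeff_eq_0 order.strict_trans not_le)
    then show ?thesis by simp
  qed
  have "f dvd pcompose f (monom 1 p)" if p: "prime p" "p > A" for p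
  proof -
    obtain g where g: "pcompose f (monom 1 p) - f ^ p = of_nat p * g"
      using poly_frobenius_mod_prime[OF p(1), of f] by (elim dvdE)
    obtain q r' where r': "g = f * q + r'" "r' = 0 \<or> Polynomial.degree r' < Polynomial.degree f"
      using monic_int_division[OF lc, of g] .
    have fp: "f dvd f ^ p" using prime_gt_0_nat[OF p(1)] by (simp add: dvd_power)
    \<comment> \<open>Modulo \<open>f\<close>, f(X^p) is \<open>p\<close> times \<open>g\<close>;
      uniqueness of remainders turns this into \<open>r p = of_nat p * r'\<close>.\<close>
    have "r p - of_nat p * r' = f ^ p + of_nat p * (f * q) - (pcompose f (monom 1 p) - r p)"
      using g unfolding r'(1) by (simp add: algebra_simps)
    moreover have "f dvd f ^ p + of_nat p * (f * q) - (pcompose f (monom 1 p) - r p)"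
      by (rule dvd_diff[OF dvd_add[OF fp] r(1)]) simp
    ultimately have "f dvd r p - of_nat p * r'" by metis
    moreover have "of_nat p * r' = 0 \<or> Polynomial.degree (of_nat p * r') < Polynomial.degree f"
      using r'(2) by (metis mult_zero_right of_nat_poly mult_smult_left smult_conv_map_poly degree_smult_le le_less_trans mult_1 pCons_one smult_one)
    ultimately have rp: "r p = of_nat p * r'" using uniq r(2) by blast
    have "r p = 0"
    proof (rule poly_eqI)
      fix i
      have c: "coeff (r p) i = int p * coeff r' i" by (simp add: rp of_nat_poly)
      \<comment> \<open>A multiple of \<open>p\<close> with absolute value below \<open>p\<close> is
        0.\<close>
      have "\<bar>coeff (r p) i\<bar> < int p" using bound[of p i] p(2) by linarith
      then have "coeff (r p) i = 0" using c by (metis dvd_triv_left dvd_imp_le_int not_le abs_of_nat)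
      then show "coeff (r p) i = coeff 0 i" by simp
    qed
    then show ?thesis using r(1)[of p] by simp
  qed
  then show ?thesis by blast
qed

text \<open>The shift is \<open>n\<close> times the product of the primes up to \<open>A\<close>
  that do not divide \<open>m\<close>. Every prime up to \<open>A\<close> then divides exactly one
  of the two summands, hence not their sum.\<close>

lemma coprime_shift_large_prime_factors:
  fixes m n A :: nat
  assumes "coprime m n" "n > 0"
  shows "\<exists>m' > 0. [m' = m] (mod n) \<and> (\<forall>p. prime p \<longrightarrow> p dvd m' \<longrightarrow> p > A)"
proof -
  define S where "S = {p. prime p \<and> p \<le> A \<and> \<not> p dvd m}"
  have fin: "finite S" by (rule finite_subset[of _ "{..A}"]) (auto simp: S_def)
  define m' where "m' = m + n * \<Prod>S"
  have "\<Prod>S > 0" by (intro prod_pos) (auto simp: S_def prime_gt_0_nat)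
  then have "m' > 0" using assms(2) by (simp add: m'_def)
  moreover have "[m' = m] (mod n)" by (simp add: m'_def cong_def)
  moreover have "p > A" if p: "prime p" "p dvd m'" for p
  proof (rule ccontr)
    assume le: "\<not> p > A"
    show False
    proof (cases "p dvd m")
      case True
      then have "p dvd n * \<Prod>S" using p(2) by (metis m'_def dvd_add_right_iff)
      moreover have "\<not> p dvd n" using True assms(1) p(1)
        by (meson coprime_common_divisor not_prime_unit)
      ultimately have "p dvd \<Prod>S" using p(1) prime_dvd_mult_iff by blast
      then obtain q where q: "q \<in> S" "p dvd q" 
        using prime_dvd_prod_iff[OF fin p(1), of "\<lambda>x. x"] by auto
      then have "p = q" using p(1) by (simp add: S_def primes_dvd_imp_eq)
      then show False using q True by (simp add: S_def)
    next
      case False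
      then have "p \<in> S" using le p by (simp add: S_def)
      then have "p dvd \<Prod>S" using dvd_prodI[OF fin, of p "\<lambda>x. x"] by simp
      then have "p dvd m" using p(2) by (metis m'_def dvd_add_left_iff dvd_mult)
      then show False using False by simp
    qed
  qed
  ultimately show ?thesis by blast
qed

text \<open>The exponent may be replaced by a congruent one with only large prime factors; the power
  is then taken one prime at a time, and each such prime power maps roots of \<open>f\<close> to
  roots of \<open>f\<close>.\<close>

lemma min_int_poly_coprime_power_root:
  assumes f: "min_int_poly z f" and z: "z ^ n = 1" and n: "n > 0" and m: "coprime m n"
  shows "poly (of_int_poly f) (z ^ m) = 0"
proof -
  obtain A where A: "\<And>p. prime p \<Longrightarrow> p > A \<Longrightarrow> f dvd pcompose f (monom 1 p)"
    using min_int_poly_dvd_compose_large_prime[OF f z n] by blast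
  obtain m' where m': "m' > 0" "[m' = m] (mod n)" "\<And>p. prime p \<Longrightarrow> p dvd m' \<Longrightarrow> p > A"
    using coprime_shift_large_prime_factors[OF m n] by blast
  have "poly (of_int_poly f) (w ^ a) = 0"
    if "a > 0" "\<forall>p. prime p \<longrightarrow> p dvd a \<longrightarrow> p > A" "poly (of_int_poly f) w = 0" for a :: nat and w :: complex
    using that
  proof (induction a arbitrary: w rule: less_induct)
    case (less a)
    show ?case
    proof (cases "a = 1")
      case False
      then obtain p where p: "prime p" "p dvd a" using prime_factor_nat by blast
      then obtain b where b: "a = p * b" by (elim dvdE)
      obtain h where "pcompose f (monom 1 p) = f * h" using A[OF p(1)] p less.prems(2) by (meson dvdE)
      then have "poly (of_int_poly (pcompose f (monom 1 p))) w = 0"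
        using less.prems(3) by (simp add: of_int_poly_mult)
      then have "poly (of_int_poly f) (w ^ p) = 0" by (simp add: poly_of_int_pcompose_monom)
      moreover have "b < a" "b > 0" using b less.prems(1) prime_gt_1_nat[OF p(1)] by auto
      ultimately have "poly (of_int_poly f) ((w ^ p) ^ b) = 0"
        using less.IH less.prems(2) b by (metis dvd_mult)
      then show ?thesis by (simp add: b power_mult)
    qed (use less.prems in simp)
  qed
  moreover have "poly (of_int_poly f) z = 0" using min_int_polyD(2)[OF f, of f] by simp
  ultimately have "poly (of_int_poly f) (z ^ m') = 0" using m' by blast
  moreover have "z ^ a = z ^ (a mod n)" for a
  proof -
    have "z ^ a = z ^ (n * (a div n) + a mod n)" by simp
    also have "\<dots> = z ^ (a mod n)" using z by (simp only: power_add power_mult) simp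
    finally show ?thesis .
  qed
  ultimately show ?thesis using m'(2) by (metis cong_def)
qed

lemma root_of_unity_has_min_int_poly:
  assumes "z ^ n = 1" "n > 0"
  shows "\<exists>f. min_int_poly z f"
proof (rule ex_min_int_poly)
  have "Polynomial.degree (monom 1 n + [:-1::int:]) = n"
    using assms(2) by (subst degree_add_eq_left) (auto simp: degree_monom_eq)
  then show "Polynomial.lead_coeff (monom 1 n + [:-1::int:]) = 1"
    using assms(2) by (cases n) auto
  show "poly (of_int_poly (monom 1 n + [:-1:])) z = 0"
    using assms by (simp add: of_int_poly_add map_poly_monom poly_monom map_poly_pCons)
qed

text \<open>Hypothesis \<open>z\<close> says that the order of \<open>z\<close> is exactly
  \<open>n\<close>. The roots of \<open>f\<close> are shown to be the coprime powers of
  \<open>z\<close>, and comparison with the \<open>n\<close> distinct roots of X^n - 1 turns the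
  number of roots into the degree.\<close>

lemma min_int_poly_degree_root_of_unity:
  fixes z :: complex
  assumes f: "min_int_poly z f" and n: "n > 0" and z: "\<And>a. z ^ a = 1 \<longleftrightarrow> n dvd a"
  shows "Polynomial.degree f = totient n"
proof -
  have lc: "Polynomial.lead_coeff f = 1" and f0: "f \<noteq> 0" using f by (auto dest: min_int_polyD)
  have z1: "z ^ n = 1" using z by simp
  have z0: "z \<noteq> 0" using z1 n by (auto simp: power_0_left)
  let ?F = "of_int_poly f :: complex poly"
  have degF: "Polynomial.degree ?F = Polynomial.degree f"
    by (intro degree_map_poly) auto
  have F0: "?F \<noteq> 0" using f0 by (simp add: map_poly_eq_0_iff)
  have inj0: "z ^ a = z ^ b \<longleftrightarrow> n dvd (b - a)" if "a \<le> b" for a b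
  proof -
    have "z ^ b = z ^ a * z ^ (b - a)" using that by (simp flip: power_add)
    then show ?thesis using z0 z by auto
  qed
  define P where "P = (\<lambda>a. z ^ a) ` totatives n"
  have injP: "inj_on (\<lambda>a. z ^ a) (totatives n)"
  proof -
    have "a = b" if "z ^ a = z ^ b" "a \<in> totatives n" "b \<in> totatives n" "a \<le> b" for a b
    proof (rule ccontr)
      assume "a \<noteq> b"
      then have "b - a > 0" "b - a < n" using that by (auto simp: in_totatives_iff)
      moreover have "n dvd b - a" using inj0 that by blast
      ultimately show False by (simp add: nat_dvd_not_less)
    qed
    then show ?thesis unfolding inj_on_def by (metis nat_le_linear)
  qed
  have cardP: "card P = totient n" by (simp add: P_def card_image injP totient_def)
  obtain h where h: "monom 1 n + [:-1:] = f * h"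
  proof -
    have "poly (of_int_poly (monom 1 n + [:-1:])) z = 0"
      using z1 by (simp add: of_int_poly_add map_poly_monom poly_monom map_poly_pCons)
    then have "f dvd monom 1 n + [:-1:]" using min_int_polyD(2)[OF f] by blast
    then show thesis using that by (elim dvdE)
  qed
  have Fh: "of_int_poly (monom 1 n + [:-1:]) = ?F * of_int_poly h" by (simp add: h of_int_poly_mult)
  have unity: "poly ?F w * poly (of_int_poly h) w = w ^ n - 1" for w
    using arg_cong[OF Fh, of "\<lambda>p. poly p w"] 
    by (simp add: of_int_poly_add map_poly_monom poly_monom map_poly_pCons)
  \<comment> \<open>The minimal polynomial \<open>g\<close> of the root \<open>w\<close> divides
    \<open>f\<close>. By degrees \<open>f\<close> does not divide the cofactor, so it divides
    \<open>g\<close>; hence \<open>w ^ d = 1\<close> carries over to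
    \<open>z ^ d = 1\<close>.\<close>
  have minroot: "n dvd d" if w: "poly ?F w = 0" "w ^ d = 1" "d > 0" for w d
  proof -
    obtain g where g: "min_int_poly w g" using root_of_unity_has_min_int_poly[OF w(2,3)] by blast
    then obtain u where u: "f = g * u" using min_int_polyD(2) w(1) by (meson dvdE)
    have dg: "Polynomial.degree g > 0"
    proof (rule ccontr)
      assume "\<not> Polynomial.degree g > 0"
      then have "g = 1" using min_int_polyD(1)[OF g] by (metis degree_0_id gr0I monom_0 one_pCons degree_eq_zeroE coeff_pCons_0)
      then show False using min_int_polyD(2)[OF g, of 1] by simp
    qed
    have "poly (of_int_poly f) z = 0" using min_int_polyD(2)[OF f, of f] by simp
    then have "poly (of_int_poly g) z = 0 \<or> poly (of_int_poly u) z = 0"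
      by (simp add: u of_int_poly_mult)
    moreover have "\<not> f dvd u"
      using u dg f0 dvd_imp_degree_le[of f u] by (auto simp: degree_mult_eq)
    ultimately have "f dvd g" using min_int_polyD(2)[OF f] by blast
    moreover have "poly (of_int_poly (monom 1 d + [:-1:])) w = 0"
      using w by (simp add: of_int_poly_add map_poly_monom poly_monom map_poly_pCons)
    ultimately have "f dvd monom 1 d + [:-1:]" using min_int_polyD(2)[OF g] dvd_trans by blast
    then have "poly (of_int_poly (monom 1 d + [:-1:])) z = 0" using min_int_polyD(2)[OF f] by blast
    then have "z ^ d = 1" by (simp add: of_int_poly_add map_poly_monom poly_monom map_poly_pCons)
    then show ?thesis using z by simp
  qed
  have unity_pow: "\<exists>a\<in>{1..n}. w = z ^ a" if "w ^ n = 1" for w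
  proof -
    have "inj_on (\<lambda>a. z ^ a) {1..n}"
    proof -
      have "a = b" if "z ^ a = z ^ b" "a \<in> {1..n}" "b \<in> {1..n}" "a \<le> b" for a b
      proof (rule ccontr)
        assume "a \<noteq> b"
        then have "b - a > 0" "b - a < n" using that by auto
        moreover have "n dvd b - a" using inj0 that by blast
        ultimately show False by (simp add: nat_dvd_not_less)
      qed
      then show ?thesis unfolding inj_on_def by (metis nat_le_linear)
    qed
    then have "card ((\<lambda>a. z ^ a) ` {1..n}) = n" by (simp add: card_image)
    moreover have "(\<lambda>a. z ^ a) ` {1..n} \<subseteq> {w. w ^ n = 1}"
      using z1 by (auto simp flip: power_mult simp: mult.commute[of _ n]) (simp add: power_mult)
    moreover have "finite {w::complex. w ^ n = 1}" using n by (intro finite_roots_unity) auto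
    ultimately have "(\<lambda>a. z ^ a) ` {1..n} = {w. w ^ n = 1}"
      using n by (intro card_subset_eq) (auto simp: card_roots_unity_eq)
    then show ?thesis using that by blast
  qed
  have "{w. poly ?F w = 0} = P"
  proof (intro equalityI subsetI)
    fix w assume "w \<in> {w. poly ?F w = 0}"
    then have w: "poly ?F w = 0" by simp
    then have "w ^ n = 1" using unity[of w] by simp
    then obtain a where a: "a \<in> {1..n}" "w = z ^ a" using unity_pow by blast
    \<comment> \<open>Otherwise \<open>w\<close> satisfies \<open>w ^ d = 1\<close> for the proper
      divisor \<open>d = n div gcd a n\<close>, against \<open>minroot\<close>.\<close>
    have "coprime a n"
    proof (rule ccontr)
      assume "\<not> coprime a n"
      then have g: "gcd a n > 1" using n by (metis coprime_iff_gcd_eq_1 gcd_pos_nat less_one linorder_neqE_nat not_less_iff_gr_or_eq)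
      define d where "d = n div gcd a n"
      have d: "d > 0" "d < n" using g n by (auto simp: d_def div_greater_zero_iff)
      have "w ^ d = z ^ (n * (a div gcd a n))" unfolding a(2) power_mult[symmetric] d_def
        by (metis div_mult_swap gcd_dvd1 gcd_dvd2 mult.commute)
      then have "w ^ d = 1" using z1 by (simp add: power_mult)
      then have "n dvd d" using minroot w d by blast
      then show False using d by (simp add: nat_dvd_not_less)
    qed
    then show "w \<in> P" using a by (auto simp: P_def in_totatives_iff)
  next
    fix w assume "w \<in> P"
    then show "w \<in> {w. poly ?F w = 0}"
      using min_int_poly_coprime_power_root[OF f z1 n] by (auto simp: P_def in_totatives_iff)
  qed
  then have roots: "card {w. poly ?F w = 0} = totient n" using cardP by simp
  have "totient n \<le> Polynomial.degree f"
    using card_poly_roots_bound[OF F0] roots degF by simp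
  \<comment> \<open>Each of the \<open>n\<close> roots of unity is a root of \<open>f\<close> or of
    \<open>h\<close>, so \<open>n\<close> is at most \<open>totient n\<close> plus the degree of
    \<open>h\<close>, while it equals the sum of the degrees of \<open>f\<close> and
    \<open>h\<close>.\<close>
  moreover have "Polynomial.degree f \<le> totient n"
  proof -
    let ?H = "of_int_poly h :: complex poly"
    have hn0: "h \<noteq> 0" using h n
      by (metis mult_zero_right degree_0 degree_add_eq_left degree_monom_eq degree_pCons_0 less_irrefl zero_neq_one)
    have H0: "?H \<noteq> 0" using hn0 by (simp add: map_poly_eq_0_iff)
    have "{w. w ^ n = 1} = {w. poly ?F w = 0} \<union> {w. poly ?H w = 0}"
      using unity by (auto simp: ) (metis mult_eq_0_iff diff_self eq_iff_diff_eq_0)+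
    then have "n \<le> card {w. poly ?F w = 0} + card {w. poly ?H w = 0}"
      using card_Un_le card_roots_unity_eq[OF n] by metis
    also have "\<dots> \<le> totient n + Polynomial.degree h"
      using card_poly_roots_bound[OF H0] roots degree_map_poly[of "of_int :: int \<Rightarrow> complex" h] by simp
    finally have "n \<le> totient n + Polynomial.degree h" .
    moreover have "n = Polynomial.degree f + Polynomial.degree h"
    proof -
      have "Polynomial.degree (monom 1 n + [:-1::int:]) = n"
        using n by (subst degree_add_eq_left) (auto simp: degree_monom_eq)
      then show ?thesis using degree_mult_eq[OF f0 hn0] h by simp
    qed
    ultimately show ?thesis by simp
  qed
  ultimately show ?thesis by simp
qed

section \<open>Degrees of cosines of rational angles\<close>

lemma clear_denominators:
  fixes q :: "real poly"
  assumes "\<And>i. coeff q i \<in> \<rat>"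
  shows "\<exists>c q'. c \<noteq> 0 \<and> Polynomial.smult (of_int c) q = of_int_poly q'"
  using assms
proof (induction q)
  case 0
  show ?case by (rule exI[of _ 1], rule exI[of _ 0]) simp
next
  case (pCons a q)
  have "coeff q i \<in> \<rat>" for i using pCons.prems[of "Suc i"] by simp
  then obtain c q' where c: "c \<noteq> 0" "Polynomial.smult (of_int c) q = of_int_poly q'" 
    using pCons.IH by blast
  have "a \<in> \<rat>" using pCons.prems[of 0] by simp
  then obtain u v :: int where uv: "v > 0" "a = of_int u / of_int v" by (elim Rats_cases')
  have "Polynomial.smult (of_int (v * c)) (pCons a q) = of_int_poly (pCons (c * u) (Polynomial.smult v q'))"
  proof -
    have "Polynomial.smult (of_int (v * c)) q = Polynomial.smult (of_int v) (of_int_poly q')"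
      by (simp flip: c(2))
    then show ?thesis using uv by (simp add: map_poly_pCons map_poly_smult)
  qed
  then show ?case using c(1) uv(1) by (metis less_irrefl mult_eq_0_iff)
qed

section \<open>Chebyshev polynomials of the first kind\<close>

fun chebyshev_poly :: "nat \<Rightarrow> int poly" where
  "chebyshev_poly 0 = 1"
| "chebyshev_poly (Suc 0) = [:0, 1:]"
| "chebyshev_poly (Suc (Suc n)) = [:0, 2:] * chebyshev_poly (Suc n) - chebyshev_poly n"

lemma degree_chebyshev_poly: "Polynomial.degree (chebyshev_poly n) \<le> n"
proof (induction n rule: chebyshev_poly.induct)
  case (3 n)
  have "Polynomial.degree ([:0, 2:] * chebyshev_poly (Suc n)) \<le> Suc (Suc n)"
    using 3(1) degree_mult_le[of "[:0, 2::int:]" "chebyshev_poly (Suc n)"] by simp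
  then show ?case using 3(2) by (simp add: degree_diff_le)
qed auto

lemma coeff_chebyshev_poly: "coeff (chebyshev_poly n) n > 0"
proof (induction n rule: chebyshev_poly.induct)
  case (3 n)
  have "coeff (chebyshev_poly n) (Suc (Suc n)) = 0"
    using degree_chebyshev_poly[of n] by (intro coeff_eq_0) simp
  then show ?case using 3(1) by simp
qed auto

lemma poly_chebyshev_poly: "poly (of_int_poly (chebyshev_poly n)) (cos t) = cos (real n * t)"
proof (induction n rule: chebyshev_poly.induct)
  case (3 n)
  have "cos (real (Suc (Suc n)) * t) = cos (real (Suc n) * t + t)" 
    by (simp add: algebra_simps)
  moreover have "cos (real n * t) = cos (real (Suc n) * t - t)"
    by (simp add: algebra_simps)
  ultimately have "cos (real (Suc (Suc n)) * t) = 2 * cos t * cos (real (Suc n) * t) - cos (real n * t)"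
    by (simp add: cos_add cos_diff)
  moreover have "poly (of_int_poly (chebyshev_poly (Suc (Suc n)))) (cos t) =
     2 * cos t * poly (of_int_poly (chebyshev_poly (Suc n))) (cos t) - poly (of_int_poly (chebyshev_poly n)) (cos t)"
    by (simp add: of_int_poly_diff map_poly_pCons map_poly_smult  del: mult_pCons_left add: of_int_poly_mult)
  ultimately show ?case using 3 by simp
qed (auto simp: map_poly_pCons)

lemma poly_of_int_poly_of_int [simp]: "poly (of_int_poly p) (of_int k) = of_int (poly p k)"
  by (induction p) (auto simp: map_poly_pCons)

lemma poly_eq_sum_coeff:
  fixes p :: "'a :: comm_ring_1 poly"
  assumes "Polynomial.degree p \<le> n"
  shows "poly p x = (\<Sum>i\<le>n. coeff p i * x ^ i)"
proof -
  have "(\<Sum>i\<le>n. coeff p i * x ^ i) = (\<Sum>i\<le>Polynomial.degree p. coeff p i * x ^ i)"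
    using assms by (intro sum.mono_neutral_right) (auto simp: coeff_eq_0)
  then show ?thesis by (simp add: poly_altdef)
qed

context
  fixes n m :: nat and \<alpha> x :: real and \<zeta> :: complex
  assumes n: "n \<ge> 3" and cop: "coprime m n"
  defines "\<alpha> \<equiv> 2 * pi * real m / real n"
  defines "\<zeta> \<equiv> cis \<alpha>"
  defines "x \<equiv> cos \<alpha>"
begin

lemma primitive_root_power_eq_1_iff: "\<zeta> ^ a = 1 \<longleftrightarrow> n dvd a"
proof -
  have "\<zeta> ^ a = 1 \<longleftrightarrow> cis (real a * \<alpha>) = 1" by (simp add: \<zeta>_def Complex.DeMoivre)
  also have "\<dots> \<longleftrightarrow> cos (real a * \<alpha>) = 1"
    by (auto simp: complex_eq_iff cos_one_sin_zero)
  also have "\<dots> \<longleftrightarrow> (\<exists>k::int. real a * \<alpha> = of_int k * (2 * pi))"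
    by (simp add: cos_one_2pi_int mult.assoc)
  also have "\<dots> \<longleftrightarrow> (\<exists>k::int. int (m * a) = k * int n)"
  proof -
    have "real a * \<alpha> = of_int k * (2 * pi) \<longleftrightarrow> int (m * a) = k * int n" for k :: int
    proof -
      have "real a * \<alpha> = of_int k * (2 * pi) \<longleftrightarrow> 2 * pi * real (m * a) = 2 * pi * (of_int k * real n)"
        using n by (simp add: \<alpha>_def divide_eq_eq algebra_simps)
      also have "\<dots> \<longleftrightarrow> real (m * a) = of_int k * real n" by (subst mult_cancel_left) simp
      also have "\<dots> \<longleftrightarrow> of_int (int (m * a)) = (of_int (k * int n) :: real)" by simp
      finally show ?thesis by (simp only: of_int_eq_iff)
    qed
    then show ?thesis by blast
  qed
  also have "\<dots> \<longleftrightarrow> int n dvd int (m * a)" by (metis dvd_def mult.commute)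
  also have "\<dots> \<longleftrightarrow> n dvd a" using cop by (simp add: int_dvd_int_iff coprime_commute coprime_dvd_mult_right_iff)
  finally show ?thesis .
qed

text \<open>Since x = (z^2 + 1) / (2 z) for the root of unity z, an equation of degree e for
  \<open>x\<close> becomes, with denominators cleared, an equation of degree at most 2 e for
  z.\<close>

lemma cos_rational_angle_degree_lower:
  assumes q: "q \<noteq> 0" "\<And>i. coeff q i \<in> \<rat>" "poly q x = 0"
  shows "totient n \<le> 2 * Polynomial.degree q"
proof -
  obtain c q' where c: "c \<noteq> 0" "Polynomial.smult (of_int c) q = of_int_poly q'"
    using clear_denominators[OF q(2)] by blast
  define e where "e = Polynomial.degree q"
  have "q' \<noteq> 0" using c q(1) by (metis map_poly_0 of_int_eq_0_iff smult_eq_0_iff)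
  have de: "Polynomial.degree q' = e"
    using arg_cong[OF c(2), of Polynomial.degree] c(1) by (simp add: e_def degree_map_poly)
  have q'x: "poly (of_int_poly q') x = 0" using q(3) by (simp flip: c(2))
  \<comment> \<open>This is (2 X)^e q'((X^2 + 1) / (2 X)) written without fractions.\<close>
  define g where "g = (\<Sum>i\<le>e. Polynomial.smult (coeff q' i * 2 ^ (e - i)) (monom 1 (e - i) * [:1, 0, 1:] ^ i))"
  have dg: "Polynomial.degree g \<le> 2 * e" unfolding g_def
  proof (intro degree_sum_le)
    fix i assume i: "i \<in> {..e}"
    have "Polynomial.degree ([:1, 0, 1::int:] ^ i) \<le> 2 * i"
      using degree_power_le[of "[:1, 0, 1::int:]" i] by simp
    then have "Polynomial.degree (monom 1 (e - i) * [:1, 0, 1::int:] ^ i) \<le> 2 * e"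
      using degree_mult_le[of "monom 1 (e - i)" "[:1, 0, 1::int:] ^ i"] degree_monom_le[of "1::int" "e - i"] i
      by auto
    then show "Polynomial.degree (Polynomial.smult (coeff q' i * 2 ^ (e - i)) (monom 1 (e - i) * [:1, 0, 1::int:] ^ i)) \<le> 2 * e"
      using degree_smult_le order_trans by blast
  qed simp
  \<comment> \<open>At 0 only the summand \<open>i = e\<close> survives, and its value is the
    leading coefficient of \<open>q'\<close>.\<close>
  have g0: "g \<noteq> 0"
  proof -
    have "poly g 0 = (\<Sum>i\<le>e. if i = e then coeff q' e else 0)"
      unfolding g_def poly_sum by (intro sum.cong) (auto simp: poly_monom power_0_left)
    then have "poly g 0 \<noteq> 0" using \<open>q' \<noteq> 0\<close> de by auto
    then show ?thesis by auto
  qed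
  have z0: "\<zeta> \<noteq> 0" by (simp add: \<zeta>_def)
  have zx: "\<zeta> ^ 2 + 1 = 2 * \<zeta> * of_real x"
    using sin_squared_eq[of \<alpha>] by (simp add: \<zeta>_def x_def complex_eq_iff power2_eq_square)
  have "poly (of_int_poly g) \<zeta> = (2 * \<zeta>) ^ e * of_real (poly (of_int_poly q') x)"
  proof -
    have "poly (of_int_poly g) \<zeta> = (\<Sum>i\<le>e. of_int (coeff q' i) * 2 ^ (e - i) * (\<zeta> ^ (e - i) * (\<zeta> ^ 2 + 1) ^ i))"
    proof -
      have p: "poly (of_int_poly (p ^ i)) z = (poly (of_int_poly p) z :: complex) ^ i" for p z i
        by (induction i) (simp_all add: of_int_poly_mult)
      have s: "poly (of_int_poly (sum u A)) z = (\<Sum>i\<in>A. poly (of_int_poly (u i)) z :: complex)" if "finite A" for u z A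
        using that by induction (simp_all add: of_int_poly_add)
      show ?thesis unfolding g_def
        by (simp add: s map_poly_smult of_int_poly_mult p map_poly_monom poly_monom map_poly_pCons power2_eq_square add.commute mult.assoc)
    qed
    also have "\<dots> = (\<Sum>i\<le>e. (2 * \<zeta>) ^ e * (of_int (coeff q' i) * of_real x ^ i))"
    proof (intro sum.cong refl)
      fix i assume "i \<in> {..e}"
      then have "(2 * \<zeta>) ^ e = (2 * \<zeta>) ^ (e - i) * (2 * \<zeta>) ^ i"
        by (metis atMost_iff le_add_diff_inverse2 power_add)
      then show "of_int (coeff q' i) * 2 ^ (e - i) * (\<zeta> ^ (e - i) * (\<zeta> ^ 2 + 1) ^ i) = (2 * \<zeta>) ^ e * (of_int (coeff q' i) * of_real x ^ i)"
        unfolding zx by (simp add: power_mult_distrib)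
    qed
    also have "\<dots> = (2 * \<zeta>) ^ e * of_real (poly (of_int_poly q') x)"
      by (subst poly_eq_sum_coeff[of _ e]) (simp_all add: de degree_map_poly coeff_map_poly sum_distrib_left)
    finally show ?thesis .
  qed
  then have gz: "poly (of_int_poly g) \<zeta> = 0" using q'x by simp
  have "\<zeta> ^ n = 1" by (simp add: primitive_root_power_eq_1_iff)
  then obtain f where f: "min_int_poly \<zeta> f" using root_of_unity_has_min_int_poly n by fastforce
  have "Polynomial.degree f = totient n"
    using min_int_poly_degree_root_of_unity[OF f _ primitive_root_power_eq_1_iff] n by simp
  moreover have "f dvd g" using gz min_int_polyD(2)[OF f] by blast
  ultimately show ?thesis using dvd_imp_degree_le[OF _ g0] dg e_def by fastforce
qed

text \<open>The equation f(z) = 0 has degree 2 d. Divided by z^d, its real part is a linear relation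
  between cosines of multiples up to d of the angle, and Chebyshev polynomials make it an equation
  of degree d for \<open>x\<close>.\<close>

lemma cos_rational_angle_degree_upper:
  "\<exists>p. p \<noteq> 0 \<and> (\<forall>i. coeff p i \<in> \<rat>) \<and> poly p x = 0 \<and> Polynomial.degree p = totient n div 2"
proof -
  have zn: "\<zeta> ^ n = 1" by (simp add: primitive_root_power_eq_1_iff)
  then obtain f where f: "min_int_poly \<zeta> f" using root_of_unity_has_min_int_poly n by fastforce
  define d where "d = totient n div 2"
  have ev: "even (totient n)" using n by (intro totient_even) simp
  have tot: "totient n > 0" using n by simp
  have d0: "d > 0" and td: "totient n = 2 * d" using ev tot by (auto simp: d_def elim!: evenE intro!: gr0I)
  have df: "Polynomial.degree f = 2 * d"
    using min_int_poly_degree_root_of_unity[OF f _ primitive_root_power_eq_1_iff] n td by simp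
  have lc: "Polynomial.lead_coeff f = 1" and f0: "f \<noteq> 0" using f by (auto dest: min_int_polyD)
  let ?f = "of_int_poly f :: real poly"
  \<comment> \<open>Otherwise X - 1 splits off, and the cofactor, of smaller degree, still vanishes
    at the root of unity, which is not 1.\<close>
  have f1: "poly f 1 \<noteq> 0"
  proof
    assume "poly f 1 = 0"
    then obtain g where g: "f = [:-1, 1:] * g" by (metis poly_eq_0_iff_dvd dvdE)
    have "\<zeta> \<noteq> 1" using primitive_root_power_eq_1_iff[of 1] n by auto
    moreover have "poly (of_int_poly f) \<zeta> = 0" using min_int_polyD(2)[OF f, of f] by simp
    ultimately have "poly (of_int_poly g) \<zeta> = 0"
      unfolding g of_int_poly_mult by (simp add: map_poly_pCons)
    then have "f dvd g" using min_int_polyD(2)[OF f] by blast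
    moreover have "g \<noteq> 0" using g f0 by auto
    ultimately have "Polynomial.degree f \<le> Polynomial.degree g" by (rule dvd_imp_degree_le)
    moreover have "Polynomial.degree f = 1 + Polynomial.degree g"
      unfolding g using \<open>g \<noteq> 0\<close> by (subst degree_mult_eq) auto
    ultimately show False by simp
  qed
  \<comment> \<open>This keeps the top coefficient of \<open>p\<close> below from vanishing. If it
    failed, the intermediate value theorem would give a root r \<ge> 0 of \<open>f\<close>; as an
    n-th root of unity it would be 1, against \<open>f1\<close>.\<close>
  have pos: "coeff f 0 > 0"
  proof (rule ccontr)
    assume neg: "\<not> coeff f 0 > 0"
    have "poly ?f 0 \<le> 0" using neg by (simp add: poly_0_coeff_0 coeff_map_poly)
    moreover have "Polynomial.lead_coeff ?f > 0" using lc by (simp add: degree_map_poly coeff_map_poly)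
    then obtain N where N: "\<And>x. x \<ge> N \<Longrightarrow> poly ?f x > 0"
      using poly_pinfty_gt_lc[of ?f] by (metis less_le_trans)
    ultimately obtain r where r: "r \<ge> 0" "poly ?f r = 0"
      using IVT'[of "poly ?f" 0 0 "max N 0"] N[of "max N 0"] less_imp_le[OF N[of "max N 0"]]
        continuous_on_poly[OF continuous_on_id, of "{0..max N 0}" ?f] by auto
    have "poly (of_int_poly (monom 1 n + [:-1:])) \<zeta> = 0"
      using zn by (simp add: of_int_poly_add map_poly_monom poly_monom map_poly_pCons)
    then obtain h where h: "monom 1 n + [:-1:] = f * h" using min_int_polyD(2)[OF f] by (meson dvdE)
    have "poly (of_int_poly (monom 1 n + [:-1:])) r = 0"
      unfolding h of_int_poly_mult using r by simp
    then have "r ^ n = 1" by (simp add: of_int_poly_add map_poly_monom poly_monom map_poly_pCons)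
    then have "r = 1" using r(1) n by (metis power_eq_iff_eq_base power_one zero_le_one gr0I not_numeral_le_zero)
    then show False using r(2) f1 poly_of_int_poly_of_int[of f 1, where ?'a = real] by simp
  qed
  define p where "p = (\<Sum>j\<le>2*d. Polynomial.smult (coeff f j) (chebyshev_poly (nat \<bar>int j - int d\<bar>)))"
  have dp: "Polynomial.degree p \<le> d" unfolding p_def
  proof (intro degree_sum_le)
    fix j assume "j \<in> {..2*d}"
    then have "nat \<bar>int j - int d\<bar> \<le> d" unfolding atMost_iff by linarith
    then show "Polynomial.degree (Polynomial.smult (coeff f j) (chebyshev_poly (nat \<bar>int j - int d\<bar>))) \<le> d"
      by (intro order_trans[OF degree_smult_le] order_trans[OF degree_chebyshev_poly])
  qed simp
  \<comment> \<open>Only \<open>j = 0\<close> and \<open>j = 2 * d\<close> reach degree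
    \<open>d\<close>; together they contribute \<open>coeff f 0 + 1\<close> times a positive
    number.\<close>
  have cp: "coeff p d > 0"
  proof -
    have "coeff p d = (\<Sum>j\<in>{0,2*d}. coeff f j * coeff (chebyshev_poly (nat \<bar>int j - int d\<bar>)) d)"
      unfolding p_def coeff_sum coeff_smult
    proof (intro sum.mono_neutral_right)
      show "\<forall>j\<in>{..2*d} - {0,2*d}. coeff f j * coeff (chebyshev_poly (nat \<bar>int j - int d\<bar>)) d = 0"
      proof
        fix j assume "j \<in> {..2*d} - {0,2*d}"
        then have "j \<le> 2 * d" "j \<noteq> 0" "j \<noteq> 2 * d" by simp_all
        then have "nat \<bar>int j - int d\<bar> < d" by linarith
        then have "coeff (chebyshev_poly (nat \<bar>int j - int d\<bar>)) d = 0"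
          using degree_chebyshev_poly[of "nat \<bar>int j - int d\<bar>"] by (intro coeff_eq_0) simp
        then show "coeff f j * coeff (chebyshev_poly (nat \<bar>int j - int d\<bar>)) d = 0" by simp
      qed
    qed auto
    also have "\<dots> = (coeff f 0 + 1) * coeff (chebyshev_poly d) d"
      using d0 lc df by (simp add: algebra_simps)
    finally show ?thesis using pos coeff_chebyshev_poly[of d] by simp
  qed
  have "poly (of_int_poly p) x = 0"
  proof -
    have "poly (of_int_poly p) x = (\<Sum>j\<le>2*d. of_int (coeff f j) * cos ((real j - real d) * \<alpha>))"
    proof -
      have s: "poly (of_int_poly (sum u A)) z = (\<Sum>i\<in>A. poly (of_int_poly (u i)) z :: real)" if "finite A" for u z A
        using that by induction (simp_all add: of_int_poly_add)
      have c: "cos (\<bar>real j - real d\<bar> * \<alpha>) = cos ((real j - real d) * \<alpha>)" for j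
        by (cases "real j - real d \<ge> 0") (metis abs_of_nonneg, metis abs_of_neg cos_minus mult_minus_left not_le)
      show ?thesis unfolding p_def x_def
        by (simp add: s map_poly_smult poly_chebyshev_poly c)
    qed
    moreover have "(\<Sum>j\<le>2*d. of_int (coeff f j) * cis ((real j - real d) * \<alpha>)) = 0"
    proof -
      have "(\<Sum>j\<le>2*d. of_int (coeff f j) * \<zeta> ^ j) = poly (of_int_poly f) \<zeta>"
        by (subst poly_eq_sum_coeff[of _ "2*d"]) (simp_all add: df degree_map_poly coeff_map_poly)
      then have "(\<Sum>j\<le>2*d. of_int (coeff f j) * \<zeta> ^ j) * cis (- real d * \<alpha>) = 0"
        using min_int_polyD(2)[OF f, of f] by simp
      then show ?thesis
        by (simp add: sum_distrib_right \<zeta>_def Complex.DeMoivre mult.assoc cis_mult left_diff_distrib)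
    qed
    from arg_cong[OF this, of Re]
    have "(\<Sum>j\<le>2*d. of_int (coeff f j) * cos ((real j - real d) * \<alpha>)) = 0" by simp
    ultimately show ?thesis by simp
  qed
  moreover have "Polynomial.degree (of_int_poly p :: real poly) = d"
    using dp cp by (simp add: degree_map_poly) (metis le_antisym le_degree less_irrefl)
  moreover have "of_int_poly p \<noteq> (0 :: real poly)" using cp by (auto simp: map_poly_eq_0_iff)
  moreover have "coeff (of_int_poly p :: real poly) i \<in> \<rat>" for i by (simp add: coeff_map_poly)
  ultimately show ?thesis unfolding d_def by blast
qed

end

section \<open>Subfields of the reals\<close>

abbreviation real_ring :: "real ring" where "real_ring \<equiv> ring_of_type_algebra"

lemma real_ring_field: "Ring.field real_ring"
  by (rule field_from_type_algebra)

interpretation real_field: domain real_ring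
  using real_ring_field by (rule Ring.field.axioms)

lemma real_ring_simps [simp]:
  "carrier real_ring = UNIV" "x \<otimes>\<^bsub>real_ring\<^esub> y = x * y" "x \<oplus>\<^bsub>real_ring\<^esub> y = x + y"
  "\<one>\<^bsub>real_ring\<^esub> = 1" "\<zero>\<^bsub>real_ring\<^esub> = 0"
  by (simp_all add: ring_of_type_algebra_def)

lemma real_ring_a_inv [simp]: "\<ominus>\<^bsub>real_ring\<^esub> x = - x"
  using real_field.minus_equality[of "-x" x] by simp

lemma real_ring_m_inv [simp]: "x \<noteq> 0 \<Longrightarrow> inv\<^bsub>real_ring\<^esub> x = inverse x"
  using real_field.comm_inv_char[of x "inverse x"] by simp

lemma real_ring_pow [simp]: "x [^]\<^bsub>real_ring\<^esub> (n :: nat) = x ^ n"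
  by (induction n) (simp_all add: mult.commute)

lemma subfield_realI:
  assumes "1 \<in> K" "\<And>x. x \<in> K \<Longrightarrow> - x \<in> K" "\<And>x y. x \<in> K \<Longrightarrow> y \<in> K \<Longrightarrow> x + y \<in> K"
    "\<And>x y. x \<in> K \<Longrightarrow> y \<in> K \<Longrightarrow> x * y \<in> K" "\<And>x. x \<in> K \<Longrightarrow> x \<noteq> 0 \<Longrightarrow> inverse x \<in> K"
  shows "subfield K real_ring"
  using assms by (intro field.subfieldI'[OF real_ring_field] real_field.subringI) auto

lemma subfield_realD:
  assumes "subfield K real_ring"
  shows "0 \<in> K" "1 \<in> K" "x \<in> K \<Longrightarrow> - x \<in> K" "x \<in> K \<Longrightarrow> y \<in> K \<Longrightarrow> x + y \<in> K"
    "x \<in> K \<Longrightarrow> y \<in> K \<Longrightarrow> x - y \<in> K"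
    "x \<in> K \<Longrightarrow> y \<in> K \<Longrightarrow> x * y \<in> K" "x \<in> K \<Longrightarrow> inverse x \<in> K"
proof -
  note s = subringE[OF subfieldE(1)[OF assms]]
  show "0 \<in> K" "1 \<in> K" "x \<in> K \<Longrightarrow> - x \<in> K" "x \<in> K \<Longrightarrow> y \<in> K \<Longrightarrow> x + y \<in> K"
    "x \<in> K \<Longrightarrow> y \<in> K \<Longrightarrow> x * y \<in> K"
    using s by auto
  then show "x \<in> K \<Longrightarrow> y \<in> K \<Longrightarrow> x - y \<in> K"
    using s(5)[of y] s(7)[of x "-y"] by simp
  show "x \<in> K \<Longrightarrow> inverse x \<in> K"
    using real_field.subfield_m_inv(1)[OF assms, of x] s(2) by (cases "x = 0") auto
qed

lemma subfield_real_divide: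
  "subfield K real_ring \<Longrightarrow> x \<in> K \<Longrightarrow> y \<in> K \<Longrightarrow> x / y \<in> K"
  using subfield_realD(6,7) by (simp add: divide_inverse)

lemma Rats_subfield: "subfield \<rat> real_ring"
  by (rule subfield_realI) auto

lemma Rats_subset_subfield:
  assumes "subfield K real_ring" shows "\<rat> \<subseteq> K"
proof -
  note K = subfield_realD[OF assms]
  have nat: "real n \<in> K" for n by (induction n) (auto intro: K)
  have "of_int i \<in> K" for i by (cases i) (use nat K(3) in \<open>auto simp del: of_nat_Suc\<close>)
  then show ?thesis by (auto elim!: Rats_cases' intro: subfield_real_divide[OF assms])
qed

lemma subfield_Rats_subspace:
  assumes "subfield K real_ring"
  shows "subalgebra \<rat> K real_ring"
proof -
  have "subgroup K (add_monoid real_ring)"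
    using subfieldE(1)[OF assms] subring.axioms(1) by blast
  then show ?thesis using Rats_subset_subfield[OF assms] subfield_realD(6)[OF assms]
    by (auto simp: subalgebra_def subalgebra_axioms_def)
qed

section \<open>Degrees over the rationals and the tower law\<close>

lemma degree_over_rat_eq:
  assumes "real_field.dimension n \<rat> K"
  shows "degree_over_rat K = enat n"
proof -
  have "(THE n. real_field.dimension n \<rat> K) = n"
    using assms real_field.dimension_is_inj[OF Rats_subfield] by (intro the_equality) auto
  then show ?thesis using assms by (auto simp: degree_over_rat_def)
qed

lemma degree_over_rat_cases:
  obtains "degree_over_rat K = \<infinity>" | n where "real_field.dimension n \<rat> K" "degree_over_rat K = enat n"
  using degree_over_rat_eq by (metis degree_over_rat_def)

text \<open>List polynomials of the algebra library start with the leading coefficient, the lists of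
  \<open>Poly\<close> with the constant term; hence \<open>rev\<close>.\<close>

lemma real_ring_eval: "real_field.eval l x = poly (Poly (rev l)) x"
proof (induction l)
  case (Cons a l)
  have "poly (Poly (rev l @ [a])) x = poly (Poly (rev l)) x + x ^ length l * a"
    by (simp add: Poly_append poly_monom)
  then show ?case using Cons by simp
qed simp

text \<open>The dimension is the degree of \<open>Irr\<close>. It is at most \<open>d\<close>
  because \<open>Irr\<close> divides the coefficient list of \<open>p\<close>, and at least
  \<open>d\<close> because \<open>Irr\<close>, read as an ordinary polynomial, is subject to
  \<open>min\<close>.\<close>

lemma dimension_simple_extension_Rats:
  assumes p: "p \<noteq> 0" "\<And>i. coeff p i \<in> \<rat>" "poly p x = 0" "Polynomial.degree p = d"
    and min: "\<And>q. q \<noteq> 0 \<Longrightarrow> (\<And>i. coeff q i \<in> \<rat>) \<Longrightarrow> poly q x = 0 \<Longrightarrow> d \<le> Polynomial.degree q"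
  shows "subfield (real_field.simple_extension \<rat> x) real_ring"
    "real_field.dimension d \<rat> (real_field.simple_extension \<rat> x)"
proof -
  define l where "l = rev (coeffs p)"
  have set_l: "set l \<subseteq> \<rat>" using p(2) by (auto simp: l_def coeffs_def)
  have l0: "l \<noteq> []" using p(1) by (simp add: l_def)
  have "hd l \<noteq> 0" using p(1) by (simp add: l_def hd_rev last_coeffs_eq_coeff_degree)
  then have l: "l \<in> carrier (univ_poly real_ring \<rat>)"
    using set_l by (simp add: univ_poly_def polynomial_def)
  have el: "real_field.eval l x = 0" using p(3) by (simp add: real_ring_eval l_def)
  have alg: "\<not> real_field.transcendental \<rat> x"
    using real_field.algebraicI[of l \<rat> x] l l0 el by (simp add: over_def)
  then have alg': "(real_field.algebraic over \<rat>) x" by (simp add: over_def)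
  show "subfield (real_field.simple_extension \<rat> x) real_ring"
    using real_field.simple_extension_is_subfield[OF Rats_subfield, of x] alg' by simp
  define g where "g = real_field.Irr \<rat> x"
  have g: "g \<in> carrier (univ_poly real_ring \<rat>)" "Polynomials.lead_coeff g = 1" "real_field.eval g x = 0"
    using real_field.IrrE[OF Rats_subfield _ alg'] by (auto simp: g_def)
  have dim: "real_field.dimension (Polynomials.degree g) \<rat> (real_field.simple_extension \<rat> x)"
    unfolding g_def by (rule real_field.dimension_simple_extension[OF Rats_subfield _ alg']) simp
  have "Polynomials.degree g \<le> Polynomials.degree l"
  proof (rule real_field.pdivides_imp_degree_le[OF subfieldE(1)[OF Rats_subfield] g(1) l l0])
    show "g pdivides\<^bsub>real_ring\<^esub> l"
      unfolding g_def using real_field.Irr_minimal[OF Rats_subfield _ alg' l] el by simp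
  qed
  then have "Polynomials.degree g \<le> d" using p(1,4) by (simp add: l_def length_coeffs)
  moreover have "d \<le> Polynomials.degree g"
  proof -
    have ne: "g \<noteq> []" using real_field.IrrE(2)[OF Rats_subfield _ alg'] 
      by (auto simp: g_def ring_irreducible_def univ_poly_def)
    have set_g: "set g \<subseteq> \<rat>" using g(1) by (auto simp: univ_poly_def polynomial_def)
    let ?q = "Poly (rev g)"
    have c: "coeff ?q i = nth_default 0 (rev g) i" for i by (simp add: coeff_Poly_eq)
    have lead: "coeff ?q (length g - 1) = 1"
      using g(2) ne by (simp add: c nth_default_def rev_nth hd_conv_nth)
    have "?q \<noteq> 0" using lead by (metis coeff_0 zero_neq_one)
    moreover have "coeff ?q i \<in> \<rat>" for i
      using set_g by (auto simp: c nth_default_def rev_nth subset_iff)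
    moreover have "poly ?q x = 0" using g(3) by (simp add: real_ring_eval)
    ultimately have "d \<le> Polynomial.degree ?q" by (rule min)
    also have "\<dots> \<le> length g - 1"
      by (rule degree_le) (auto simp: c nth_default_def)
    finally show ?thesis .
  qed
  ultimately show "real_field.dimension d \<rat> (real_field.simple_extension \<rat> x)" using dim by simp
qed

text \<open>The tower law requires \<open>K\<close> to have finite dimension over \<open>F\<close>;
  it does, because a rational basis of \<open>K\<close> still spans \<open>K\<close> over the larger
  field.\<close>

lemma dimension_dvd_of_subfield:
  assumes F: "subfield F real_ring" "real_field.dimension d \<rat> F"
    and K: "subfield K real_ring" "real_field.dimension n \<rat> K" and FK: "F \<subseteq> K"
  shows "d dvd n"
proof -
  obtain Us where Us: "set Us \<subseteq> carrier real_ring" "real_field.independent \<rat> Us" "length Us = n" "real_field.Span \<rat> Us = K"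
    using real_field.exists_base[OF Rats_subfield K(2)] by blast
  have UK: "set Us \<subseteq> K" using real_field.Span_base_incl[OF Rats_subfield Us(1)] Us(4) by simp
  have "real_field.Span F Us = K"
  proof
    have c1: "subalgebra F K real_ring"
    proof -
      have "subgroup K (add_monoid real_ring)"
        using subfieldE(1)[OF K(1)] subring.axioms(1) by blast
      then show ?thesis using FK subfield_realD(6)[OF K(1)]
        by (auto simp: subalgebra_def subalgebra_axioms_def)
    qed
    show "real_field.Span F Us \<subseteq> K"
      by (rule real_field.subalgebra_Span_incl[OF F(1) c1 UK])
    have "K = {real_field.combine Ks Us | Ks. set Ks \<subseteq> \<rat>}"
      using real_field.Span_eq_combine_set[OF Rats_subfield Us(1)] Us(4) by simp
    also have "\<dots> \<subseteq> {real_field.combine Ks Us | Ks. set Ks \<subseteq> F}"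
      using Rats_subset_subfield[OF F(1)] by blast
    also have "\<dots> = real_field.Span F Us"
      using real_field.Span_eq_combine_set[OF F(1) Us(1)] by simp
    finally show "K \<subseteq> real_field.Span F Us" .
  qed
  then have "real_field.finite_dimension F K"
    using real_field.Span_finite_dimension[OF F(1) Us(1)] by simp
  then obtain m where "real_field.dimension m F K" by (rule real_field.finite_dimensionE')
  from real_field.telescopic_base[OF Rats_subfield F(1) F(2) this]
  have "real_field.dimension (d * m) \<rat> K" .
  then have "n = d * m" using real_field.dimension_is_inj[OF Rats_subfield K(2)] by blast
  then show ?thesis by simp
qed

lemma cos_rational_angle_extension:
  assumes n: "n \<ge> 3" and m: "coprime m n"
  defines "F \<equiv> real_field.simple_extension \<rat> (cos (2 * pi * real m / real n))"
  shows "subfield F real_ring" "real_field.dimension (totient n div 2) \<rat> F"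
    "cos (2 * pi * real m / real n) \<in> F"
proof -
  let ?x = "cos (2 * pi * real m / real n)"
  obtain p where p: "p \<noteq> 0" "\<And>i. coeff p i \<in> \<rat>" "poly p ?x = 0" "Polynomial.degree p = totient n div 2"
    using cos_rational_angle_degree_upper[OF n m] by blast
  have low: "totient n div 2 \<le> Polynomial.degree q"
    if "q \<noteq> 0" "\<And>i. coeff q i \<in> \<rat>" "poly q ?x = 0" for q
    using cos_rational_angle_degree_lower[OF n m that] by simp
  show "subfield F real_ring" "real_field.dimension (totient n div 2) \<rat> F"
    unfolding F_def by (rule dimension_simple_extension_Rats[OF p low]; assumption)+
  show "?x \<in> F"
    unfolding F_def by (rule real_field.simple_extension_mem[OF subfieldE(1)[OF Rats_subfield]]) simp
qed

lemma dimension_subfield_pos: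
  assumes "subfield K real_ring" "real_field.dimension n \<rat> K"
  shows "n > 0"
proof (rule ccontr)
  assume "\<not> n > 0"
  then have "real_field.dimension 0 \<rat> K" using assms(2) by simp
  then have "K = {0}" using real_field.dimension_zero[OF Rats_subfield] by fastforce
  then show False using subfield_realD(2)[OF assms(1)] by simp
qed

lemma degree_over_rat_cos_subfield:
  assumes n: "n \<ge> 3" and m: "coprime m n" and K: "subfield K real_ring" "cos (2 * pi * real m / real n) \<in> K"
  obtains "degree_over_rat K = \<infinity>" | e where "e > 0" "degree_over_rat K = enat (e * (totient n div 2))"
proof (cases K rule: degree_over_rat_cases)
  case (2 D)
  note F = cos_rational_angle_extension[OF n m]
  have "real_field.simple_extension \<rat> (cos (2 * pi * real m / real n)) \<subseteq> K"
    by (rule real_field.simple_extension_subring_incl[OF subfieldE(1)[OF K(1)] Rats_subset_subfield[OF K(1)] K(2)])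
  then have "totient n div 2 dvd D" using dimension_dvd_of_subfield F K(1) 2(1) by blast
  then obtain e where e: "D = totient n div 2 * e" by (elim dvdE)
  have "D > 0" by (rule dimension_subfield_pos[OF K(1) 2(1)])
  then have "e > 0" "degree_over_rat K = enat (e * (totient n div 2))"
    using 2(2) e by (simp_all add: mult.commute)
  then show thesis by (rule that(2))
qed (rule that(1))

lemma degree_over_rat_mono:
  assumes F: "subfield F real_ring" "real_field.dimension d \<rat> F" and K: "subfield K real_ring" "K \<subseteq> F"
  shows "degree_over_rat K \<le> enat d"
proof -
  have "real_field.finite_dimension \<rat> K"
    by (rule real_field.subalbegra_incl_imp_finite_dimension[OF Rats_subfield real_field.finite_dimensionI[OF F(2)] subfield_Rats_subspace[OF K(1)] K(2)])
  then obtain m where m: "real_field.dimension m \<rat> K" by (rule real_field.finite_dimensionE')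
  have "d > 0" by (rule dimension_subfield_pos[OF F])
  moreover have "m dvd d" by (rule dimension_dvd_of_subfield[OF K(1) m F K(2)])
  ultimately show ?thesis using degree_over_rat_eq[OF m] dvd_imp_le by auto
qed

section \<open>Face lattices and bipyramid graphs\<close>

lemma polytope_face_two_vertices:
  fixes P :: "(real^3) set"
  assumes "polytope P" "F face_of P" "{x. x extreme_point_of F} = {a, b}"
  shows "F = closed_segment a b"
proof -
  have "polytope F" by (rule face_of_polytope_polytope[OF assms(1,2)])
  then have "F = convex hull {x. x extreme_point_of F}"
    by (intro Krein_Milman_Minkowski) (simp_all add: polytope_imp_compact polytope_imp_convex)
  then show ?thesis unfolding assms(3) segment_convex_hull .
qed

text \<open>Describes vertices by the order of the face lattice alone, so that lattice isomorphisms
  respect them. A nonempty face has an extreme point, and its singleton is again a face.\<close>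

lemma face_atom_iff_vertex:
  fixes P :: "(real^3) set"
  assumes "polytope P" "F \<in> faces P"
  shows "(\<exists>x. F = {x}) \<longleftrightarrow> F \<noteq> {} \<and> (\<forall>G\<in>faces P. G \<subseteq> F \<longrightarrow> G = {} \<or> G = F)"
proof
  assume "F \<noteq> {} \<and> (\<forall>G\<in>faces P. G \<subseteq> F \<longrightarrow> G = {} \<or> G = F)"
  then have F: "F \<noteq> {}" "\<And>G. G face_of P \<Longrightarrow> G \<subseteq> F \<Longrightarrow> G = {} \<or> G = F" by (auto simp: faces_def)
  have FP: "F face_of P" using assms by (simp add: faces_def)
  have "polytope F" using assms(1) FP by (rule face_of_polytope_polytope)
  then obtain x where x: "x extreme_point_of F"
    using extreme_point_exists_convex F(1) polytope_imp_compact polytope_imp_convex by blast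
  then have "{x} face_of F" by (simp add: face_of_singleton)
  then have "{x} face_of P" using FP face_of_trans by blast
  then show "\<exists>x. F = {x}" using F(2) x extreme_point_of_def by blast
qed auto

lemma comb_equiv_sym:
  assumes "comb_equiv P Q" shows "comb_equiv Q P"
proof -
  from assms obtain f where f1: "bij_betw f (faces P) (faces Q)"
    and f2: "\<forall>F\<in>faces P. \<forall>G\<in>faces P. F \<subseteq> G \<longleftrightarrow> f F \<subseteq> f G" unfolding comb_equiv_def by (elim exE conjE)
  note f = f1 f2[rule_format]
  let ?g = "inv_into (faces P) f"
  have g: "bij_betw ?g (faces Q) (faces P)" using f(1) by (rule bij_betw_inv_into)
  have "F \<subseteq> G \<longleftrightarrow> ?g F \<subseteq> ?g G" if "F \<in> faces Q" "G \<in> faces Q" for F G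
  proof -
    have "?g F \<in> faces P" "?g G \<in> faces P" using bij_betwE[OF g] that by blast+
    from f(2)[OF this] show ?thesis
      unfolding bij_betw_inv_into_right[OF f(1) that(1)] bij_betw_inv_into_right[OF f(1) that(2)] by (rule sym)
  qed
  then show ?thesis using g unfolding comb_equiv_def by (intro exI[of _ ?g] conjI ballI)
qed

lemma comb_equiv_trans:
  assumes "comb_equiv P Q" "comb_equiv Q R" shows "comb_equiv P R"
proof -
  from assms(1) obtain f where f: "bij_betw f (faces P) (faces Q)"
    "\<forall>F\<in>faces P. \<forall>G\<in>faces P. F \<subseteq> G \<longleftrightarrow> f F \<subseteq> f G" unfolding comb_equiv_def by (elim exE conjE)
  from assms(2) obtain g where g: "bij_betw g (faces Q) (faces R)"
    "\<forall>F\<in>faces Q. \<forall>G\<in>faces Q. F \<subseteq> G \<longleftrightarrow> g F \<subseteq> g G" unfolding comb_equiv_def by (elim exE conjE)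
  have "bij_betw (g \<circ> f) (faces P) (faces R)" using f(1) g(1) by (rule bij_betw_trans)
  moreover have "F \<subseteq> G \<longleftrightarrow> (g \<circ> f) F \<subseteq> (g \<circ> f) G" if "F \<in> faces P" "G \<in> faces P" for F G
    using f(2) g(2) bij_betwE[OF f(1)] that by (metis comp_apply)
  ultimately show ?thesis unfolding comb_equiv_def by (intro exI[of _ "g \<circ> f"] conjI ballI)
qed

lemma comb_equiv_refl: "comb_equiv P P"
  unfolding comb_equiv_def by (rule exI[of _ id]) auto

text \<open>A lattice isomorphism preserves the bottom and the atoms, which yields a bijection of
  vertices. A polytope is the hull of its vertices, so a face with two given vertices is the segment
  between them, on either side.\<close>

lemma comb_equiv_vertex_bij:
  fixes P Q :: "(real^3) set"
  assumes P: "polytope P" and Q: "polytope Q" and PQ: "comb_equiv P Q"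
  obtains g where "bij_betw g {x. x extreme_point_of P} {x. x extreme_point_of Q}"
    "\<And>a b. a extreme_point_of P \<Longrightarrow> b extreme_point_of P \<Longrightarrow>
       closed_segment a b face_of P \<longleftrightarrow> closed_segment (g a) (g b) face_of Q"
proof -
  from PQ obtain f where f1: "bij_betw f (faces P) (faces Q)"
    and f2: "\<forall>F\<in>faces P. \<forall>G\<in>faces P. F \<subseteq> G \<longleftrightarrow> f F \<subseteq> f G" unfolding comb_equiv_def by (elim exE conjE)
  note f = f1 f2[rule_format]
  have fF: "f F \<in> faces Q" if "F \<in> faces P" for F using f(1) that by (rule bij_betw_apply)
  have surj: "\<exists>F\<in>faces P. f F = G" if "G \<in> faces Q" for G using f(1) that unfolding bij_betw_def by (metis imageE)
  have inj: "f F = f G \<longleftrightarrow> F = G" if "F \<in> faces P" "G \<in> faces P" for F G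
    using f(1) that unfolding bij_betw_def by (metis inj_on_eq_iff)
  have e: "{} \<in> faces R" for R by (simp add: faces_def)
  have f0: "f {} = {}"
  proof -
    obtain F where F: "F \<in> faces P" "f F = {}" using surj[OF e] by blast
    then have "f {} \<subseteq> f F" using f(2) e by blast
    then show ?thesis using F by simp
  qed
  have atom: "(\<exists>x. F = {x}) \<longleftrightarrow> (\<exists>y. f F = {y})" if F: "F \<in> faces P" for F
  proof -
    have Q_atom: "(\<exists>y. f F = {y}) \<longleftrightarrow> f F \<noteq> {} \<and> (\<forall>G\<in>faces Q. G \<subseteq> f F \<longrightarrow> G = {} \<or> G = f F)"
      using face_atom_iff_vertex[OF Q fF[OF F]] .
    have "(\<forall>G\<in>faces Q. G \<subseteq> f F \<longrightarrow> G = {} \<or> G = f F) \<longleftrightarrow>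
        (\<forall>G\<in>faces P. f G \<subseteq> f F \<longrightarrow> f G = {} \<or> f G = f F)"
      unfolding bij_betw_imp_surj_on[OF f1, symmetric] by simp
    also have "\<dots> \<longleftrightarrow> (\<forall>G\<in>faces P. G \<subseteq> F \<longrightarrow> G = {} \<or> G = F)"
    proof (rule ball_cong[OF refl])
      fix G assume G: "G \<in> faces P"
      show "(f G \<subseteq> f F \<longrightarrow> f G = {} \<or> f G = f F) \<longleftrightarrow> (G \<subseteq> F \<longrightarrow> G = {} \<or> G = F)"
        using f(2)[OF G F] inj[OF G F] inj[OF G e] unfolding f0 by argo
    qed
    finally have "(\<exists>y. f F = {y}) \<longleftrightarrow> F \<noteq> {} \<and> (\<forall>G\<in>faces P. G \<subseteq> F \<longrightarrow> G = {} \<or> G = F)"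
      using Q_atom inj[OF F e] unfolding f0 by argo
    then show ?thesis using face_atom_iff_vertex[OF P F] by argo
  qed
  have vf: "x extreme_point_of R \<longleftrightarrow> {x} \<in> faces R" for x :: "real^3" and R by (simp add: faces_def face_of_singleton)
  define g where "g x = the_elem (f {x})" for x
  have g: "f {x} = {g x}" if "x extreme_point_of P" for x
  proof -
    have "\<exists>y. f {x} = {y}" using atom[of "{x}"] that unfolding vf by blast
    then show ?thesis unfolding g_def by (elim exE) simp
  qed
  have gext: "g x extreme_point_of Q" if "x extreme_point_of P" for x
    using g[OF that] fF[of "{x}"] that by (simp add: vf)
  have ginj: "inj_on g {x. x extreme_point_of P}"
  proof (rule inj_onI)
    fix x y assume "x \<in> {x. x extreme_point_of P}" "y \<in> {x. x extreme_point_of P}" and eq: "g x = g y"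
    then have xy: "x extreme_point_of P" "y extreme_point_of P" by auto
    have "f {x} = f {y}" using g[OF xy(1)] g[OF xy(2)] eq by simp
    then show "x = y" using inj[of "{x}" "{y}"] xy unfolding vf by simp
  qed
  have gsurj: "\<exists>x. x extreme_point_of P \<and> g x = y" if y: "y extreme_point_of Q" for y
  proof -
    obtain F where F: "F \<in> faces P" "f F = {y}" using surj y vf by blast
    then obtain x where x: "F = {x}" using atom[OF F(1)] by blast
    then have "x extreme_point_of P" using F(1) by (simp add: vf)
    moreover have "g x = y" using g[OF calculation] F(2) x by simp
    ultimately show ?thesis by blast
  qed
  have mem: "x \<in> F \<longleftrightarrow> g x \<in> f F" if "x extreme_point_of P" "F \<in> faces P" for x F
    using f(2)[of "{x}" F] that g[OF that(1)] by (simp add: vf)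
  \<comment> \<open>That a vertex lies in a face is an inclusion of faces, so \<open>f\<close>
    transports the vertex set of every face.\<close>
  have fext: "{y. y extreme_point_of f F} = g ` {x. x extreme_point_of F}" if F: "F \<in> faces P" for F
  proof -
    have 1: "F face_of P" "f F face_of Q" using F fF[OF F] by (auto simp: faces_def)
    show ?thesis
    proof (intro equalityI subsetI)
      fix y assume "y \<in> {y. y extreme_point_of f F}"
      then have y: "y extreme_point_of Q" "y \<in> f F" using extreme_point_of_face[OF 1(2)] by auto
      then obtain x where "x extreme_point_of P" "g x = y" using gsurj by blast
      then show "y \<in> g ` {x. x extreme_point_of F}" 
        using mem[OF _ F] y(2) extreme_point_of_face[OF 1(1)] by blast
    next
      fix y assume "y \<in> g ` {x. x extreme_point_of F}"
      then show "y \<in> {y. y extreme_point_of f F}"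
        using mem[OF _ F] extreme_point_of_face[OF 1(1)] extreme_point_of_face[OF 1(2)] gext by auto
    qed
  qed
  have seg: "{x. x extreme_point_of closed_segment a b} = {a, b}" for a b :: "real^3"
    by (auto simp: extreme_point_of_segment)
  show thesis
  proof
    show "bij_betw g {x. x extreme_point_of P} {x. x extreme_point_of Q}"
    proof (rule bij_betw_imageI[OF ginj])
      show "g ` {x. x extreme_point_of P} = {x. x extreme_point_of Q}"
      proof (intro equalityI subsetI)
        fix y assume "y \<in> {x. x extreme_point_of Q}"
        then show "y \<in> g ` {x. x extreme_point_of P}" using gsurj[of y] by (metis image_eqI mem_Collect_eq)
      qed (use gext in \<open>metis imageE mem_Collect_eq\<close>)
    qed
    fix a b assume ab: "a extreme_point_of P" "b extreme_point_of P"
    show "closed_segment a b face_of P \<longleftrightarrow> closed_segment (g a) (g b) face_of Q"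
    proof
      assume "closed_segment a b face_of P"
      then have F: "closed_segment a b \<in> faces P" by (simp add: faces_def)
      have "f (closed_segment a b) face_of Q" using fF[OF F] by (simp add: faces_def)
      moreover have "f (closed_segment a b) = closed_segment (g a) (g b)"
        using fext[OF F] by (intro polytope_face_two_vertices[OF Q calculation]) (simp add: seg)
      ultimately show "closed_segment (g a) (g b) face_of Q" by simp
    next
      assume "closed_segment (g a) (g b) face_of Q"
      then obtain F where F: "F \<in> faces P" "f F = closed_segment (g a) (g b)" 
        using surj by (auto simp: faces_def)
      have FP: "F face_of P" using F(1) by (simp add: faces_def)
      have "g ` {x. x extreme_point_of F} = g ` {a, b}" using fext[OF F(1)] F(2) seg[of "g a" "g b"] by simp
      moreover have "{x. x extreme_point_of F} \<subseteq> {x. x extreme_point_of P}"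
        using extreme_point_of_face[OF FP] by blast
      ultimately have "{x. x extreme_point_of F} = {a, b}"
        using ab ginj by (metis (mono_tags, lifting) empty_subsetI inj_on_image_eq_iff insert_subset mem_Collect_eq)
      then have "F = closed_segment a b" by (rule polytope_face_two_vertices[OF P FP])
      then show "closed_segment a b face_of P" using FP by simp
    qed
  qed
qed

text \<open>Keeps only the edge graph of the face lattice. The equator is a periodic sequence over
  all naturals, which avoids wrap-around cases. Non-edges are recorded because the barycenter
  averages over all edges; the range from 2 to \<open>k - 2\<close> omits the offsets 1 and
  \<open>k - 1\<close> of neighbours.\<close>

definition bipyramid_graph :: "nat \<Rightarrow> (real^3) set \<Rightarrow> real^3 \<Rightarrow> real^3 \<Rightarrow> (nat \<Rightarrow> real^3) \<Rightarrow> bool" where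
  "bipyramid_graph k Q n s v \<longleftrightarrow>
     polytope Q \<and> (\<forall>i. v (i + k) = v i) \<and> inj_on v {..<k} \<and> n \<noteq> s \<and> n \<notin> range v \<and> s \<notin> range v \<and>
     {x. x extreme_point_of Q} = insert n (insert s (range v)) \<and>
     (\<forall>i. closed_segment n (v i) face_of Q) \<and> (\<forall>i. closed_segment s (v i) face_of Q) \<and>
     (\<forall>i. closed_segment (v i) (v (Suc i)) face_of Q) \<and> \<not> closed_segment n s face_of Q \<and>
     (\<forall>i d. 2 \<le> d \<longrightarrow> d + 2 \<le> k \<longrightarrow> \<not> closed_segment (v i) (v (i + d)) face_of Q)"

lemma bipyramid_graph_transfer:
  assumes G: "bipyramid_graph k P n s v" and Q: "polytope Q" "comb_equiv P Q"
  shows "\<exists>n s v. bipyramid_graph k Q n s v"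
proof -
  have P: "polytope P" using G by (simp add: bipyramid_graph_def)
  obtain g where g: "bij_betw g {x. x extreme_point_of P} {x. x extreme_point_of Q}"
    "\<And>a b. a extreme_point_of P \<Longrightarrow> b extreme_point_of P \<Longrightarrow>
       closed_segment a b face_of P \<longleftrightarrow> closed_segment (g a) (g b) face_of Q"
    using comb_equiv_vertex_bij[OF P Q] by blast
  have inj: "inj_on g (insert n (insert s (range v)))" and im: "g ` insert n (insert s (range v)) = {x. x extreme_point_of Q}"
    using g(1) G by (auto simp: bipyramid_graph_def bij_betw_def)
  have ext: "n extreme_point_of P" "s extreme_point_of P" "v i extreme_point_of P" for i
    using G by (auto simp: bipyramid_graph_def)
  have "inj_on (g \<circ> v) {..<k}"
    using G by (intro comp_inj_on inj_on_subset[OF inj]) (auto simp: bipyramid_graph_def)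
  moreover have "g n \<noteq> g s" "g n \<notin> range (g \<circ> v)" "g s \<notin> range (g \<circ> v)"
    using G inj by (auto simp: bipyramid_graph_def inj_on_def)
  moreover have "insert (g n) (insert (g s) (range (g \<circ> v))) = {x. x extreme_point_of Q}"
    using im by auto
  ultimately have "bipyramid_graph k Q (g n) (g s) (g \<circ> v)"
    using G Q(1) g(2)[OF ext(1) ext(3)] g(2)[OF ext(2) ext(3)] g(2)[OF ext(3) ext(3)] g(2)[OF ext(1,2)]
    by (simp add: bipyramid_graph_def)
  then show ?thesis by blast
qed

lemma edge_of_polytope_iff:
  fixes Q :: "(real^3) set"
  assumes Q: "polytope Q"
  shows "e edge_of Q \<longleftrightarrow> (\<exists>a b. a extreme_point_of Q \<and> b extreme_point_of Q \<and> a \<noteq> b \<and> e = closed_segment a b \<and> e face_of Q)"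
proof
  assume e: "e edge_of Q"
  then have F: "e face_of Q" "aff_dim e = 1" by (auto simp: edge_of_def)
  have e: "polytope e" using Q F(1) by (rule face_of_polytope_polytope)
  have "collinear e" using F(2) by (simp add: collinear_aff_dim)
  moreover have "e \<noteq> {}" using F(2) by (metis aff_dim_empty_eq not_one_less_zero one_neq_neg_one)
  ultimately obtain a b where ab: "e = closed_segment a b"
    using compact_convex_collinear_segment[OF _ polytope_imp_compact[OF e] polytope_imp_convex[OF e]] by blast
  have "a \<noteq> b" using F(2) unfolding ab by (metis aff_dim_sing closed_segment_idem zero_neq_one)
  moreover have "a extreme_point_of e" "b extreme_point_of e" by (simp_all add: ab extreme_point_of_segment)
  then have "a extreme_point_of Q" "b extreme_point_of Q" using extreme_point_of_face[OF F(1)] by auto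
  ultimately show "\<exists>a b. a extreme_point_of Q \<and> b extreme_point_of Q \<and> a \<noteq> b \<and> e = closed_segment a b \<and> e face_of Q"
    using ab F(1) by blast
next
  assume "\<exists>a b. a extreme_point_of Q \<and> b extreme_point_of Q \<and> a \<noteq> b \<and> e = closed_segment a b \<and> e face_of Q"
  then obtain a b where ab: "a \<noteq> b" "e = closed_segment a b" "e face_of Q" by blast
  then have "aff_dim e = 1" unfolding ab(2) segment_convex_hull aff_dim_convex_hull by (simp only: aff_dim_2) simp
  then show "e edge_of Q" using ab by (simp add: edge_of_def)
qed

section \<open>Periodic sequences and the edge set of a bipyramid\<close>

lemma sum_periodic_shift:
  fixes h :: "nat \<Rightarrow> 'b :: comm_monoid_add"
  assumes k0: "k > 0" and per: "\<And>i. h (i + k) = h i"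
  shows "(\<Sum>i<k. h (Suc i)) = (\<Sum>i<k. h i)"
proof -
  obtain m where m: "k = Suc m" using k0 by (cases k) auto
  have "(\<Sum>i<k. h (Suc i)) = (\<Sum>i<m. h (Suc i)) + h (0 + k)" by (simp add: m)
  also have "\<dots> = h 0 + (\<Sum>i<m. h (Suc i))" using per[of 0] by (simp add: add.commute)
  also have "\<dots> = (\<Sum>i<k. h i)" by (simp only: m sum.lessThan_Suc_shift)
  finally show ?thesis .
qed

context
  fixes k :: nat and v :: "nat \<Rightarrow> 'a"
  assumes per: "\<And>i. v (i + k) = v i" and k0: "k > 0"
begin

lemma periodic_mod: "v (i mod k) = v i"
proof -
  have "v (i + k * m) = v i" for i m
    by (induction m) (simp_all add: per flip: add.assoc add: add.left_commute[of k] add.commute[of k])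
  from this[of "i mod k" "i div k"] show ?thesis by simp
qed

lemma periodic_range: "range v = v ` {..<k}"
  using periodic_mod k0 by (metis (no_types, lifting) image_subset_iff lessThan_iff mod_less_divisor rangeI subset_antisym subset_UNIV image_mono image_eqI subsetI rangeE)

lemma periodic_offset:
  obtains d where "d \<in> {1..k}" "v i = v (j + d)"
proof -
  \<comment> \<open>Offset 0 is represented by \<open>k\<close>, so that \<open>d\<close> lies
    between 1 and \<open>k\<close>.\<close>
  define d where "d = (if (i + k - j mod k) mod k = 0 then k else (i + k - j mod k) mod k)"
  have d: "d mod k = (i + k - j mod k) mod k" "d \<in> {1..k}"
    using k0 by (auto simp: d_def less_imp_le)
  have jk: "j mod k \<le> k" using k0 by (simp add: less_imp_le)
  have "(j + d) mod k = (j mod k + (i + k - j mod k)) mod k"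
    using d(1) by (metis mod_add_eq mod_mod_trivial)
  also have "\<dots> = i mod k" using jk by simp
  finally have "v i = v (j + d)" by (metis periodic_mod)
  then show thesis using that d by blast
qed

lemma periodic_eq_iff:
  assumes "inj_on v {..<k}"
  shows "v i = v j \<longleftrightarrow> i mod k = j mod k"
  using assms periodic_mod k0 by (metis inj_on_eq_iff lessThan_iff mod_less_divisor)

end

text \<open>Turns sums over the set of edges into sums over indices. With \<open>k \<ge> 3\<close>
  the three families are injectively indexed and disjoint, so no edge is counted twice.\<close>

lemma bipyramid_edges:
  assumes G: "bipyramid_graph k Q n s v" and k: "k \<ge> 3"
  shows "{e. e edge_of Q} = (\<lambda>i. closed_segment n (v i)) ` {..<k} \<union> (\<lambda>i. closed_segment s (v i)) ` {..<k}
      \<union> (\<lambda>i. closed_segment (v i) (v (Suc i))) ` {..<k}" (is "?L = ?R")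
    and "finite {e. e edge_of Q}" "card {e. e edge_of Q} = 3 * k"
    and "(\<Sum>e\<in>{e. e edge_of Q}. (h e :: 'b :: comm_monoid_add)) =
      (\<Sum>i<k. h (closed_segment n (v i)) + h (closed_segment s (v i)) + h (closed_segment (v i) (v (Suc i))))"
proof -
  have per: "v (i + k) = v i" for i using G by (simp add: bipyramid_graph_def)
  have k0: "k > 0" using k by simp
  have Q: "polytope Q" using G by (simp add: bipyramid_graph_def)
  have inj: "inj_on v {..<k}" using G by (simp add: bipyramid_graph_def)
  note veq = periodic_eq_iff[of v, OF per k0 inj]
  have adj: "v i \<noteq> v (Suc i)" for i 
    using k by (auto simp: veq mod_Suc split: if_splits)
  have ns: "n \<noteq> s" "n \<noteq> v i" "s \<noteq> v i" "v i \<noteq> n" "v i \<noteq> s" for i using G by (auto simp: bipyramid_graph_def)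
  have ext: "x extreme_point_of Q \<longleftrightarrow> x = n \<or> x = s \<or> (\<exists>i. x = v i)" for x
    using G unfolding bipyramid_graph_def by blast
  have fc: "closed_segment n (v i) face_of Q" "closed_segment s (v i) face_of Q" "closed_segment (v i) (v (Suc i)) face_of Q"
     "\<not> closed_segment n s face_of Q" "2 \<le> d \<Longrightarrow> d + 2 \<le> k \<Longrightarrow> \<not> closed_segment (v i) (v (i + d)) face_of Q" for i d
    using G by (auto simp: bipyramid_graph_def)
  have red: "closed_segment n (v i) \<in> ?R" "closed_segment s (v i) \<in> ?R" "closed_segment (v i) (v (Suc i)) \<in> ?R" for i
  proof -
    have m: "i mod k < k" "v (i mod k) = v i" "v (Suc (i mod k)) = v (Suc i)"
      using k0 periodic_mod[of v, OF per k0] by (simp_all add: veq mod_Suc_eq)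
    show "closed_segment n (v i) \<in> ?R" "closed_segment s (v i) \<in> ?R" "closed_segment (v i) (v (Suc i)) \<in> ?R"
      by (intro UnI1[OF UnI1] UnI1[OF UnI2] UnI2 image_eqI[of _ _ "i mod k"]; use m in simp)+
  qed
  show eq: "?L = ?R"
  proof (intro equalityI subsetI)
    fix e assume "e \<in> ?L"
    then obtain a b where ab: "a extreme_point_of Q" "b extreme_point_of Q" "a \<noteq> b" "e = closed_segment a b" "e face_of Q"
      using edge_of_polytope_iff[OF Q] by auto
    have vv: "closed_segment (v i) (v j) \<in> ?R" if "v i \<noteq> v j" "closed_segment (v i) (v j) face_of Q" for i j
    proof -
      obtain d where d: "d \<in> {1..k}" "v j = v (i + d)" using periodic_offset[of v, OF per k0] by blast
      have "d \<noteq> k" using d that(1) per by auto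
      moreover have "\<not> (2 \<le> d \<and> d + 2 \<le> k)" using fc(5) that(2) d by auto
      \<comment> \<open>Offset \<open>k\<close> is the vertex itself and the offsets in between are
        recorded non-edges, so only the two neighbours remain.\<close>
      ultimately have "d = 1 \<or> Suc d = k" using d(1) by auto
      then show ?thesis
      proof
        assume "d = 1" then show ?thesis using d(2) red(3)[of i] by simp
      next
        assume "Suc d = k"
        then have "v (Suc (i + d)) = v i" using per[of i] by (metis add_Suc_right)
        then show ?thesis using d(2) red(3)[of "i + d"] by (simp add: closed_segment_commute)
      qed
    qed
    show "e \<in> ?R"
    proof -
      from ab(1,2) consider "{a, b} = {n, s}" | i where "{a, b} = {n, v i}" | i where "{a, b} = {s, v i}"
        | i j where "a = v i" "b = v j" using ab(3) unfolding ext by blast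
      then show ?thesis
      proof cases
        case 1
        then have "e = closed_segment n s" using ab(4) by (simp add: closed_segment_eq)
        then show ?thesis using fc(4) ab(5) by simp
      next
        case (2 i)
        then have "e = closed_segment n (v i)" using ab(4) by (simp add: closed_segment_eq)
        then show ?thesis using red(1) by simp
      next
        case (3 i)
        then have "e = closed_segment s (v i)" using ab(4) by (simp add: closed_segment_eq)
        then show ?thesis using red(2) by simp
      next
        case (4 i j)
        then show ?thesis using vv[of i j] ab(3,4,5) by simp
      qed
    qed
  next
    fix e assume "e \<in> ?R"
    then consider i where "e = closed_segment n (v i)" | i where "e = closed_segment s (v i)" 
      | i where "e = closed_segment (v i) (v (Suc i))" by blast
    then show "e \<in> ?L"
    proof cases
      case (1 i)
      then show ?thesis unfolding mem_Collect_eq edge_of_polytope_iff[OF Q]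
        by (intro exI[of _ n] exI[of _ "v i"]) (use fc(1)[of i] ns(2)[of i] ext in auto)
    next
      case (2 i)
      then show ?thesis unfolding mem_Collect_eq edge_of_polytope_iff[OF Q]
        by (intro exI[of _ s] exI[of _ "v i"]) (use fc(2)[of i] ns(3)[of i] ext in auto)
    next
      case (3 i)
      then show ?thesis unfolding mem_Collect_eq edge_of_polytope_iff[OF Q]
        by (intro exI[of _ "v i"] exI[of _ "v (Suc i)"]) (use fc(3)[of i] adj[of i] ext in auto)
    qed
  qed
  let ?A = "(\<lambda>i. closed_segment n (v i)) ` {..<k}" and ?B = "(\<lambda>i. closed_segment s (v i)) ` {..<k}"
    and ?C = "(\<lambda>i. closed_segment (v i) (v (Suc i))) ` {..<k}"
  have vi: "v i = v j \<longleftrightarrow> i = j" if "i < k" "j < k" for i j using that by (simp add: veq)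
  have ia: "inj_on (\<lambda>i. closed_segment n (v i)) {..<k}" "inj_on (\<lambda>i. closed_segment s (v i)) {..<k}"
    by (auto simp: inj_on_def closed_segment_eq doubleton_eq_iff vi ns)
  have ic: "inj_on (\<lambda>i. closed_segment (v i) (v (Suc i))) {..<k}"
  proof (rule inj_onI)
    fix i j assume ij: "i \<in> {..<k}" "j \<in> {..<k}" "closed_segment (v i) (v (Suc i)) = closed_segment (v j) (v (Suc j))"
    show "i = j"
    proof (rule ccontr)
      assume "i \<noteq> j"
      \<comment> \<open>Distinct indices can share an edge only with its ends exchanged, which would
        make \<open>i + 2\<close> congruent to \<open>i\<close> modulo \<open>k\<close>.\<close>
      then have "v i = v (Suc j)" "v (Suc i) = v j"
        using ij by (auto simp: closed_segment_eq doubleton_eq_iff vi)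
      then show False using ij k \<open>i \<noteq> j\<close> by (auto simp: veq mod_Suc split: if_splits)
    qed
  qed
  have disj: "?A \<inter> ?B = {}" "(?A \<union> ?B) \<inter> ?C = {}"
    using ns by (auto simp: closed_segment_eq doubleton_eq_iff)
  show "finite {e. e edge_of Q}" unfolding eq by simp
  show "card {e. e edge_of Q} = 3 * k" unfolding eq
    using disj ia ic by (simp add: card_Un_disjoint card_image)
  show "(\<Sum>e\<in>{e. e edge_of Q}. h e) =
      (\<Sum>i<k. h (closed_segment n (v i)) + h (closed_segment s (v i)) + h (closed_segment (v i) (v (Suc i))))"
    unfolding eq using disj ia ic
    by (simp add: sum.union_disjoint sum.reindex sum.distrib)
qed

section \<open>The standard bipyramid\<close>

lemma face_of_convex_hull_support:
  fixes A :: "'a :: euclidean_space set"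
  assumes "finite A" "\<And>x. x \<in> A \<Longrightarrow> c \<bullet> x \<le> \<beta>"
  shows "convex hull {x \<in> A. c \<bullet> x = \<beta>} face_of convex hull A"
proof -
  let ?F = "convex hull A \<inter> {x. c \<bullet> x = \<beta>}"
  have "convex hull A \<subseteq> {x. c \<bullet> x \<le> \<beta>}"
    using assms(2) by (intro hull_minimal) (auto simp: convex_halfspace_le)
  then have F: "?F face_of convex hull A"
    by (intro face_of_Int_supporting_hyperplane_le) auto
  then obtain S where S: "S \<subseteq> A" "?F = convex hull S"
    using face_of_convex_hull_subset[OF finite_imp_compact[OF assms(1)]] by blast
  have "S \<subseteq> {x \<in> A. c \<bullet> x = \<beta>}" using S hull_subset[of S convex] by blast
  then have "?F \<subseteq> convex hull {x \<in> A. c \<bullet> x = \<beta>}" unfolding S(2) by (rule hull_mono)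
  moreover have "convex hull {x \<in> A. c \<bullet> x = \<beta>} \<subseteq> ?F"
  proof (rule hull_minimal)
    show "convex ?F" using F face_of_imp_convex by blast
  qed (auto intro: hull_inc)
  ultimately have "convex hull {x \<in> A. c \<bullet> x = \<beta>} = ?F" by (rule subset_antisym[rotated])
  then show ?thesis using F by (simp only:)
qed

text \<open>Faces of a polytope are exposed. This serves to refute edges: a supposed edge yields a
  functional that is strictly smaller at all other vertices.\<close>

lemma face_segment_support:
  fixes P :: "(real^3) set"
  assumes P: "polytope P" and F: "closed_segment a b face_of P"
  shows "\<exists>c \<beta>. c \<bullet> a = \<beta> \<and> c \<bullet> b = \<beta> \<and>
    (\<forall>x. x extreme_point_of P \<longrightarrow> x \<noteq> a \<longrightarrow> x \<noteq> b \<longrightarrow> c \<bullet> x < \<beta>)"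
proof -
  have "closed_segment a b exposed_face_of P"
    using P F by (simp add: exposed_face_of_polyhedron polytope_imp_polyhedron)
  then obtain c \<beta> where c: "P \<subseteq> {x. c \<bullet> x \<le> \<beta>}" "closed_segment a b = P \<inter> {x. c \<bullet> x = \<beta>}"
    unfolding exposed_face_of_def by blast
  have "a \<in> closed_segment a b" "b \<in> closed_segment a b" by simp_all
  then have "c \<bullet> a = \<beta>" "c \<bullet> b = \<beta>" unfolding c(2) by simp_all
  moreover have "c \<bullet> x < \<beta>" if x: "x extreme_point_of P" "x \<noteq> a" "x \<noteq> b" for x
  proof -
    have xP: "x \<in> P" using x(1) by (simp add: extreme_point_of_def)
    have "x \<notin> closed_segment a b"
      using extreme_point_of_face[OF F, of x] x by (auto simp: extreme_point_of_segment)
    then have "c \<bullet> x \<noteq> \<beta>" using c(2) xP by blast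
    moreover have "c \<bullet> x \<le> \<beta>" using c(1) xP by blast
    ultimately show ?thesis by simp
  qed
  ultimately show ?thesis by blast
qed

definition gon_vertex :: "nat \<Rightarrow> nat \<Rightarrow> real^3" where
  "gon_vertex k j = vector [cos (2 * pi * real j / real k), sin (2 * pi * real j / real k), 0]"

abbreviation north :: "real^3" where "north \<equiv> vector [0, 0, 1]"
abbreviation south :: "real^3" where "south \<equiv> vector [0, 0, -1]"

lemma inner_vector_3: "vector [a, b, c] \<bullet> (vector [x, y, z] :: real^3) = a * x + b * y + c * z"
  by (simp add: inner_vec_def sum_3)

lemma cos_le_cos_outside:
  assumes "0 \<le> a" "a \<le> t" "t \<le> 2 * pi - a"
  shows "cos t \<le> cos a" "a < t \<Longrightarrow> t < 2 * pi - a \<Longrightarrow> cos t < cos a"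
proof -
  have e: "cos t = cos (2 * pi - t)" by (simp add: cos_diff)
  show "cos t \<le> cos a"
  proof (cases "t \<le> pi")
    case True then show ?thesis using assms by (intro cos_monotone_0_pi_le) auto
  next
    case False then show ?thesis unfolding e using assms by (intro cos_monotone_0_pi_le) auto
  qed
  assume t: "a < t" "t < 2 * pi - a"
  show "cos t < cos a"
  proof (cases "t \<le> pi")
    case True then show ?thesis using assms t by (intro cos_monotone_0_pi) auto
  next
    case False then show ?thesis unfolding e using assms t by (intro cos_monotone_0_pi) auto
  qed
qed

context
  fixes k :: nat
  assumes k: "k \<ge> 3"
begin

lemma gon_vertex_periodic: "gon_vertex k (i + k) = gon_vertex k i"
proof -
  have "2 * pi * real (i + k) / real k = 2 * pi * real i / real k + 2 * pi"
    using k by (simp add: field_simps)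
  then show ?thesis by (simp only: gon_vertex_def sin_periodic cos_periodic)
qed

lemma standard_bipyramid_hull:
  "standard_bipyramid k = convex hull (insert north (insert south (range (gon_vertex k))))"
proof -
  have "range (gon_vertex k) = gon_vertex k ` {..<k}"
    using periodic_range[of "gon_vertex k", OF gon_vertex_periodic] k by simp
  then have "{vector [cos (2 * pi * real j / real k), sin (2 * pi * real j / real k), 0] | j. j < k} = range (gon_vertex k)"
    by (auto simp: gon_vertex_def)
  then show ?thesis by (simp add: standard_bipyramid_def Un_commute insert_commute)
qed

lemma finite_bipyramid_vertices: "finite (insert north (insert south (range (gon_vertex k))))"
  using periodic_range[of "gon_vertex k", OF gon_vertex_periodic] k by simp

lemma gon_angle_less: "d < k \<Longrightarrow> 0 < d \<Longrightarrow> cos (2 * pi * real d / real k) < 1"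
  using cos_le_cos_outside(2)[of 0 "2 * pi * real d / real k"] k by (simp add: field_simps)

lemma gon_vertex_inner: "gon_vertex k j \<bullet> gon_vertex k (j + d) = cos (2 * pi * real d / real k)"
proof -
  have "2 * pi * real d / real k = 2 * pi * real (j + d) / real k - 2 * pi * real j / real k"
    by (simp add: distrib_left add_divide_distrib)
  then show ?thesis by (simp only: gon_vertex_def inner_vector_3 cos_diff) simp
qed

lemma gon_vertex_inj: "inj_on (gon_vertex k) {..<k}"
proof -
  have "False" if "i < j" "j < k" "gon_vertex k i = gon_vertex k j" for i j
  proof -
    have "i + (j - i) = j" using that by simp
    then have "cos (2 * pi * real (j - i) / real k) = cos (2 * pi * real 0 / real k)"
      using gon_vertex_inner[of i "j - i"] gon_vertex_inner[of i 0] that(3) by (metis add_0_right)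
    moreover have "j - i < k" "0 < j - i" using that by auto
    ultimately show False using gon_angle_less[of "j - i"] by (simp only:) simp
  qed
  then show ?thesis by (metis inj_onI lessThan_iff linorder_neqE_nat)
qed

lemma gon_vertex_recurrence:
  "gon_vertex k (Suc (Suc i)) + gon_vertex k i = (2 * cos (2 * pi / real k)) *\<^sub>R gon_vertex k (Suc i)"
proof -
  define t a where "t = 2 * pi / real k" and "a = 2 * pi * real (Suc i) / real k"
  have e: "2 * pi * real (Suc (Suc i)) / real k = a + t" "2 * pi * real i / real k = a - t"
    by (simp_all add: t_def a_def distrib_left add_divide_distrib)
  show ?thesis unfolding gon_vertex_def e t_def[symmetric] a_def[symmetric]
    by (simp add: vec_eq_iff forall_3 cos_add cos_diff sin_add sin_diff)
qed

text \<open>Writes the neighbour of one end of a chord through both ends. When the chord spans less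
  than half the circle and is not a side, the two weights are positive with sum above the left-hand
  factor: the neighbour lies beyond the chord, so the chord is no edge.\<close>

lemma gon_vertex_chord:
  "sin (2 * pi * real (Suc d) / real k) *\<^sub>R gon_vertex k (Suc i) =
   sin (2 * pi * real d / real k) *\<^sub>R gon_vertex k i + sin (2 * pi / real k) *\<^sub>R gon_vertex k (i + Suc d)"
proof -
  define t a b where "t = 2 * pi / real k" and "a = 2 * pi * real i / real k" and "b = 2 * pi * real d / real k"
  have e: "2 * pi * real (Suc d) / real k = b + t" "2 * pi * real (Suc i) / real k = a + t"
    "2 * pi * real (i + Suc d) / real k = (a + b) + t"
    by (simp_all add: t_def a_def b_def distrib_left add_divide_distrib)
  have "sin (b + t) * cos (a + t) - (sin b * cos a + sin t * cos ((a + b) + t))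
      = sin b * cos a * ((sin t)\<^sup>2 + (cos t)\<^sup>2 - 1)"
    unfolding cos_add sin_add by (simp add: algebra_simps power2_eq_square del: sin_cos_squared_add sin_cos_squared_add2 sin_cos_squared_add3)
  then have 1: "sin (b + t) * cos (a + t) = sin b * cos a + sin t * cos ((a + b) + t)" by simp
  have "sin (b + t) * sin (a + t) - (sin b * sin a + sin t * sin ((a + b) + t))
      = sin b * sin a * ((sin t)\<^sup>2 + (cos t)\<^sup>2 - 1)"
    unfolding cos_add sin_add by (simp add: algebra_simps power2_eq_square del: sin_cos_squared_add sin_cos_squared_add2 sin_cos_squared_add3)
  then have 2: "sin (b + t) * sin (a + t) = sin b * sin a + sin t * sin ((a + b) + t)" by simp
  show ?thesis unfolding gon_vertex_def e t_def[symmetric] a_def[symmetric] b_def[symmetric]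
    using 1 2 by (simp add: vec_eq_iff forall_3)
qed

lemma polytope_standard_bipyramid: "polytope (standard_bipyramid k)"
  unfolding standard_bipyramid_hull using finite_bipyramid_vertices polytope_def by blast

lemma standard_bipyramid_face:
  assumes "\<And>x. x \<in> insert north (insert south (range (gon_vertex k))) \<Longrightarrow> c \<bullet> x \<le> \<beta>"
    and "{x \<in> insert north (insert south (range (gon_vertex k))). c \<bullet> x = \<beta>} = {a, b}"
  shows "closed_segment a b face_of standard_bipyramid k"
  using face_of_convex_hull_support[OF finite_bipyramid_vertices assms(1)]
  unfolding standard_bipyramid_hull assms(2) segment_convex_hull .

lemma gon_vertex_offset:
  obtains d where "d \<in> {1..k}" "gon_vertex k i = gon_vertex k (j + d)"
  using periodic_offset[of "gon_vertex k", OF gon_vertex_periodic] k by (metis gr0I not_numeral_le_zero)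

lemma standard_apex_edge:
  assumes z: "z = 1 \<or> z = -1"
  shows "closed_segment (vector [0, 0, z]) (gon_vertex k j) face_of standard_bipyramid k"
proof (rule standard_bipyramid_face)
  define \<phi> where "\<phi> = 2 * pi * real j / real k"
  \<comment> \<open>The functional is 1 at the chosen apex and at vertex \<open>j\<close>, -1 at the
    other apex, and on the equator the cosine of the angular distance to vertex
    \<open>j\<close>.\<close>
  let ?c = "vector [cos \<phi>, sin \<phi>, z] :: real^3"
  have c: "?c \<bullet> gon_vertex k (j + d) = cos (2 * pi * real d / real k)" for d
    using gon_vertex_inner[of j d] by (simp add: gon_vertex_def \<phi>_def inner_vector_3)
  have cv: "?c \<bullet> gon_vertex k i \<le> 1" "?c \<bullet> gon_vertex k i = 1 \<Longrightarrow> gon_vertex k i = gon_vertex k j" for i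
  proof -
    obtain d where d: "d \<in> {1..k}" "gon_vertex k i = gon_vertex k (j + d)" by (rule gon_vertex_offset)
    show "?c \<bullet> gon_vertex k i \<le> 1" using c[of d] d by simp
    assume "?c \<bullet> gon_vertex k i = 1"
    then have "d = k" using c[of d] d gon_angle_less[of d] by force
    then show "gon_vertex k i = gon_vertex k j" using d(2) gon_vertex_periodic by simp
  qed
  have c0: "?c \<bullet> gon_vertex k j = 1" using c[of 0] by simp
  have cN: "?c \<bullet> north = z" "?c \<bullet> south = - z" by (simp_all add: inner_vector_3)
  show "?c \<bullet> x \<le> 1" if "x \<in> insert north (insert south (range (gon_vertex k)))" for x
    using that cv(1) cN z by auto
  show "{x \<in> insert north (insert south (range (gon_vertex k))). ?c \<bullet> x = 1} = {vector [0, 0, z], gon_vertex k j}"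
  proof (intro equalityI subsetI)
    fix x assume "x \<in> {x \<in> insert north (insert south (range (gon_vertex k))). ?c \<bullet> x = 1}"
    then have x: "?c \<bullet> x = 1" and "x = north \<or> x = south \<or> (\<exists>i. x = gon_vertex k i)" by blast+
    then consider "x = north" | "x = south" | i where "x = gon_vertex k i" by blast
    then show "x \<in> {vector [0, 0, z], gon_vertex k j}"
    proof cases
      case 1 then show ?thesis using x cN(1) by simp
    next
      case 2 then show ?thesis using x cN(2) by simp
    next
      case (3 i) then show ?thesis using cv(2)[of i] x by simp
    qed
  next
    fix x assume "x \<in> {vector [0, 0, z], gon_vertex k j}"
    then consider "x = vector [0, 0, z]" | "x = gon_vertex k j" by blast
    then show "x \<in> {x \<in> insert north (insert south (range (gon_vertex k))). ?c \<bullet> x = 1}"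
    proof cases
      case 1 then show ?thesis using z cN by fastforce
    qed (use c0 in simp)
  qed
qed

lemma standard_base_edge:
  "closed_segment (gon_vertex k j) (gon_vertex k (Suc j)) face_of standard_bipyramid k"
proof (rule standard_bipyramid_face)
  \<comment> \<open>Direction of the midpoint of the side; the bound \<open>\<beta>\<close> is the
    inradius of the k-gon. It is positive, so the apices, with value 0, stay strictly below
    it.\<close>
  define \<phi> where "\<phi> = 2 * pi * real j / real k + pi / real k"
  define \<beta> where "\<beta> = cos (pi / real k)"
  let ?c = "vector [cos \<phi>, sin \<phi>, 0] :: real^3"
  have "0 < pi / real k" using k by simp
  moreover have "pi / real k < pi / 2" using k by (intro divide_strict_left_mono) simp_all
  ultimately
  have b0: "\<beta> > 0" unfolding \<beta>_def by (rule cos_gt_zero)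
  have c: "?c \<bullet> gon_vertex k (j + d) = cos (2 * pi * real d / real k - pi / real k)" for d
  proof -
    have "2 * pi * real d / real k - pi / real k = 2 * pi * real (j + d) / real k - \<phi>"
      by (simp add: \<phi>_def distrib_left add_divide_distrib)
    then show ?thesis by (simp only: gon_vertex_def inner_vector_3 cos_diff) simp
  qed
  have cv: "?c \<bullet> gon_vertex k i \<le> \<beta>" "?c \<bullet> gon_vertex k i = \<beta> \<Longrightarrow> gon_vertex k i = gon_vertex k j \<or> gon_vertex k i = gon_vertex k (Suc j)" for i
  proof -
    obtain d where d: "d \<in> {1..k}" "gon_vertex k i = gon_vertex k (j + d)" by (rule gon_vertex_offset)
    define t where "t = 2 * pi * real d / real k - pi / real k"
    have t: "0 \<le> pi / real k" "pi / real k \<le> t" "t \<le> 2 * pi - pi / real k"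
    proof -
      have "2 * pi * 1 / real k \<le> 2 * pi * real d / real k" "2 * pi * real d / real k \<le> 2 * pi * real k / real k"
        using d(1) by (intro divide_right_mono mult_left_mono; simp)+
      then show "0 \<le> pi / real k" "pi / real k \<le> t" "t \<le> 2 * pi - pi / real k"
        using k by (simp_all add: t_def)
    qed
    show "?c \<bullet> gon_vertex k i \<le> \<beta>" unfolding d(2) c t_def[symmetric] \<beta>_def by (rule cos_le_cos_outside(1)[OF t])
    assume eq: "?c \<bullet> gon_vertex k i = \<beta>"
    have "\<not> (pi / real k < t \<and> t < 2 * pi - pi / real k)"
      using cos_le_cos_outside(2)[OF t] eq unfolding d(2) c t_def[symmetric] \<beta>_def by auto
    moreover have "pi / real k < t" if "d > 1"
    proof -
      have "pi * 1 < pi * (real d)" using that by (intro mult_strict_left_mono) auto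
      then have "pi / real k < pi * real d / real k" using k by (intro divide_strict_right_mono) auto
      then show ?thesis by (simp add: t_def)
    qed
    moreover have "t < 2 * pi - pi / real k" if "d < k"
    proof -
      have "2 * pi * real d < 2 * pi * real k" using that by (intro mult_strict_left_mono) auto
      then have "2 * pi * real d / real k < 2 * pi" using k by (simp add: divide_less_eq)
      then show ?thesis by (simp add: t_def)
    qed
    ultimately have "d = 1 \<or> d = k" using d(1) by force
    then show "gon_vertex k i = gon_vertex k j \<or> gon_vertex k i = gon_vertex k (Suc j)"
      using d(2) gon_vertex_periodic by auto
  qed
  have c0: "?c \<bullet> gon_vertex k j = \<beta>" using c[of 0] by (simp add: \<beta>_def)
  have c1: "?c \<bullet> gon_vertex k (Suc j) = \<beta>" using c[of 1] by (simp add: \<beta>_def)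
  have cN: "?c \<bullet> north = 0" "?c \<bullet> south = 0" by (simp_all add: inner_vector_3)
  show "?c \<bullet> x \<le> \<beta>" if "x \<in> insert north (insert south (range (gon_vertex k)))" for x
    using that cv(1) cN b0 by auto
  show "{x \<in> insert north (insert south (range (gon_vertex k))). ?c \<bullet> x = \<beta>} = {gon_vertex k j, gon_vertex k (Suc j)}"
  proof (intro equalityI subsetI)
    fix x assume "x \<in> {x \<in> insert north (insert south (range (gon_vertex k))). ?c \<bullet> x = \<beta>}"
    then have x: "?c \<bullet> x = \<beta>" and "x = north \<or> x = south \<or> (\<exists>i. x = gon_vertex k i)" by blast+
    then consider "x = north" | "x = south" | i where "x = gon_vertex k i" by blast
    then show "x \<in> {gon_vertex k j, gon_vertex k (Suc j)}"
    proof cases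
      case 1 then show ?thesis using x cN(1) b0 by simp
    next
      case 2 then show ?thesis using x cN(2) b0 by simp
    next
      case (3 i) then show ?thesis using cv(2)[of i] x by simp
    qed
  next
    fix x assume "x \<in> {gon_vertex k j, gon_vertex k (Suc j)}"
    then show "x \<in> {x \<in> insert north (insert south (range (gon_vertex k))). ?c \<bullet> x = \<beta>}"
      using c0 c1 by blast
  qed
qed

lemma standard_bipyramid_graph: "bipyramid_graph k (standard_bipyramid k) north south (gon_vertex k)"
proof -
  let ?A = "insert north (insert south (range (gon_vertex k)))" and ?P = "standard_bipyramid k"
  have nsd: "north \<noteq> south" "north \<notin> range (gon_vertex k)" "south \<notin> range (gon_vertex k)"
    by (auto simp: vec_eq_iff forall_3 gon_vertex_def)
  have nsd': "gon_vertex k i \<noteq> north" "gon_vertex k i \<noteq> south" for i using nsd(2,3) by (metis rangeI)+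
  note eN = standard_apex_edge[of 1, simplified] and eS = standard_apex_edge[of "-1", simplified]
  have extN: "north extreme_point_of ?P"
    using extreme_point_of_face[OF eN[of 0], of north] by (simp add: extreme_point_of_segment)
  have extS: "south extreme_point_of ?P"
    using extreme_point_of_face[OF eS[of 0], of south] by (simp add: extreme_point_of_segment)
  have extV: "gon_vertex k j extreme_point_of ?P" for j
    using extreme_point_of_face[OF eN[of j], of "gon_vertex k j"] by (simp add: extreme_point_of_segment)
  have ext: "{x. x extreme_point_of ?P} = ?A"
  proof
    show "{x. x extreme_point_of ?P} \<subseteq> ?A"
      unfolding standard_bipyramid_hull using extreme_point_of_convex_hull by blast
  qed (use extN extS extV in auto)
  have rec: "c \<bullet> gon_vertex k (Suc (Suc i)) + c \<bullet> gon_vertex k i = 2 * cos (2 * pi / real k) * (c \<bullet> gon_vertex k (Suc i))" for c i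
    using arg_cong[OF gon_vertex_recurrence[of i], of "inner c"] by (simp add: inner_right_distrib)
  have th: "0 < 2 * pi / real k" "2 * pi / real k < pi" using k by (auto simp: divide_less_eq)
  have cth: "cos (2 * pi / real k) < 1" using gon_angle_less[of 1] k by simp
  \<comment> \<open>Since \<open>south = - north\<close>, a supporting functional would vanish on
    the axis and be negative on the equator, but its sum over the equator is 0 by the
    recurrence.\<close>
  have nNS: "\<not> closed_segment north south face_of ?P"
  proof
    assume F: "closed_segment north south face_of ?P"
    obtain c \<beta> where c: "c \<bullet> north = \<beta>" "c \<bullet> south = \<beta>"
      "\<And>x. x extreme_point_of ?P \<Longrightarrow> x \<noteq> north \<Longrightarrow> x \<noteq> south \<Longrightarrow> c \<bullet> x < \<beta>"
      using face_segment_support[OF polytope_standard_bipyramid F] by (elim exE conjE) (rule that; blast)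
    have "south = - north" by (simp add: vec_eq_iff forall_3)
    then have "\<beta> = 0" using c(1,2) by (simp add: inner_minus_right)
    then have neg: "c \<bullet> gon_vertex k i < 0" for i 
      using c(3)[OF extV[of i]] nsd' \<open>\<beta> = 0\<close> by metis
    define s where "s = (\<Sum>i<k. c \<bullet> gon_vertex k i)"
    have s1: "(\<Sum>i<k. c \<bullet> gon_vertex k (Suc i)) = s"
      unfolding s_def by (rule sum_periodic_shift) (use k gon_vertex_periodic in auto)
    have s2: "(\<Sum>i<k. c \<bullet> gon_vertex k (Suc (Suc i))) = s"
      unfolding s1[symmetric] 
      by (rule sum_periodic_shift[where k = k and h = "\<lambda>i. c \<bullet> gon_vertex k (Suc i)"]) (use k gon_vertex_periodic in \<open>auto simp flip: add_Suc\<close>)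
    have "s + s = 2 * cos (2 * pi / real k) * s"
    proof -
      have "(\<Sum>i<k. c \<bullet> gon_vertex k (Suc (Suc i))) + s = (\<Sum>i<k. 2 * cos (2 * pi / real k) * (c \<bullet> gon_vertex k (Suc i)))"
        unfolding s_def by (simp only: sum.distrib[symmetric] rec)
      then show ?thesis unfolding s2 by (simp only: sum_distrib_left[symmetric] s1)
    qed
    then have "s = 0" using cth by (simp add: algebra_simps)
    moreover have "s < 0" 
    proof -
      have "(\<Sum>i<k. c \<bullet> gon_vertex k i) < (\<Sum>i<k. 0)"
      proof (rule sum_strict_mono)
        have "0 \<in> {..<k}" using k by simp
        then show "{..<k} \<noteq> {}" by blast
      qed (use neg in simp_all)
      then show ?thesis by (simp add: s_def)
    qed
    ultimately show False by simp
  qed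
  \<comment> \<open>The apices are opposite and both lie below \<open>\<beta>\<close>, so
    \<open>\<beta>\<close> is positive. A chord below half the circle contradicts
    \<open>gon_vertex_chord\<close>, a longer one is read from its other end, and a diameter has
    opposite ends.\<close>
  have nVV: "\<not> closed_segment (gon_vertex k i) (gon_vertex k (i + d)) face_of ?P" if d: "2 \<le> d" "d + 2 \<le> k" for i d
  proof
    assume F: "closed_segment (gon_vertex k i) (gon_vertex k (i + d)) face_of ?P"
    obtain c \<beta> where c: "c \<bullet> gon_vertex k i = \<beta>" "c \<bullet> gon_vertex k (i + d) = \<beta>"
      "\<And>x. x extreme_point_of ?P \<Longrightarrow> x \<noteq> gon_vertex k i \<Longrightarrow> x \<noteq> gon_vertex k (i + d) \<Longrightarrow> c \<bullet> x < \<beta>"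
      using face_segment_support[OF polytope_standard_bipyramid F] by (elim exE conjE) (rule that; blast)
    have "south = - north" by (simp add: vec_eq_iff forall_3)
    then have "c \<bullet> south = - (c \<bullet> north)" by (simp only: inner_minus_right)
    then have b0: "\<beta> > 0" using c(3)[OF extN nsd'(1)[symmetric] nsd'(1)[symmetric]] c(3)[OF extS nsd'(2)[symmetric] nsd'(2)[symmetric]] by linarith
    have key: "False" if e: "2 \<le> e" "2 * e < k" and cc: "c \<bullet> gon_vertex k j = \<beta>" "c \<bullet> gon_vertex k (j + e) = \<beta>"
       "c \<bullet> gon_vertex k (Suc j) < \<beta>" for j e
    proof -
      obtain e' where e': "e = Suc e'" using e by (cases e) auto
      define s where "s = (\<lambda>m. sin (2 * pi * real m / real k))"
      have ch: "s e * (c \<bullet> gon_vertex k (Suc j)) = (s e' + s 1) * \<beta>"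
        using arg_cong[OF gon_vertex_chord[of e' j], of "inner c"] cc
        by (simp add: s_def inner_right_distrib e' algebra_simps)
      have pos: "s m > 0" if "0 < m" "2 * m < k" for m
      proof -
        have "2 * pi * real m < pi * real k" using that by simp
        then show ?thesis unfolding s_def using that k by (intro sin_gt_zero) (auto simp: divide_less_eq)
      qed
      have "s e = s e' * cos (2 * pi / real k) + cos (2 * pi * real e' / real k) * s 1"
      proof -
        have "2 * pi * real e / real k = 2 * pi * real e' / real k + 2 * pi / real k" by (simp add: e' distrib_left add_divide_distrib)
        then show ?thesis by (simp add: s_def sin_add)
      qed
      also have "\<dots> < s e' * 1 + 1 * s 1"
        using pos[of e'] pos[of 1] cth e e'
        by (intro add_less_le_mono mult_strict_left_mono mult_right_mono) auto
      finally have "s e * \<beta> < (s e' + s 1) * \<beta>" using b0 by simp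
      moreover have "s e * (c \<bullet> gon_vertex k (Suc j)) < s e * \<beta>" using pos[of e] e cc(3) by simp
      ultimately show False using ch by simp
    qed
    have ne: "gon_vertex k (Suc i) \<noteq> gon_vertex k i" "gon_vertex k (Suc i) \<noteq> gon_vertex k (i + d)"
      "gon_vertex k (Suc (i + d)) \<noteq> gon_vertex k i" "gon_vertex k (Suc (i + d)) \<noteq> gon_vertex k (i + d)"
    proof -
      have shift: "gon_vertex k m \<noteq> gon_vertex k (m + e)" if "0 < e" "e < k" for m e
      proof
        assume "gon_vertex k m = gon_vertex k (m + e)"
        then have "cos (2 * pi * real e / real k) = cos (2 * pi * real 0 / real k)"
          using gon_vertex_inner[of m e] gon_vertex_inner[of m 0] by (metis add_0_right)
        then show False using gon_angle_less[of e] that by simp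
      qed
      show "gon_vertex k (Suc i) \<noteq> gon_vertex k i" "gon_vertex k (Suc (i + d)) \<noteq> gon_vertex k (i + d)"
        using shift[of 1 i] shift[of 1 "i + d"] k by auto
      show "gon_vertex k (Suc i) \<noteq> gon_vertex k (i + d)" "gon_vertex k (Suc (i + d)) \<noteq> gon_vertex k i"
        using shift[of "d - 1" "Suc i"] shift[of "d + 1" i] d by auto
    qed
    have less: "c \<bullet> gon_vertex k (Suc i) < \<beta>" "c \<bullet> gon_vertex k (Suc (i + d)) < \<beta>"
      using c(3)[OF extV] ne by blast+
    consider "2 * d < k" | "2 * (k - d) < k" | "2 * d = k" using d by linarith
    then show False
    proof cases
      case 1 then show ?thesis using key[of d i] d c(1,2) less by simp
    next
      case 2 
      have "gon_vertex k ((i + d) + (k - d)) = gon_vertex k i" using d gon_vertex_periodic[of i] by simp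
      moreover have "2 \<le> k - d" using d by linarith
      ultimately show ?thesis using key[of "k - d" "i + d"] 2 c(1,2) less by simp
    next
      case 3
      have "gon_vertex k (i + d) = - gon_vertex k i"
      proof -
        have "real k = 2 * real d" "real d > 0" using 3 d by linarith+
        then have "2 * pi * real d / real k = pi" by simp
        then have "2 * pi * real (i + d) / real k = 2 * pi * real i / real k + pi"
          by (simp only: of_nat_add distrib_left add_divide_distrib)
        then show ?thesis by (simp add: gon_vertex_def vec_eq_iff forall_3)
      qed
      then show ?thesis using c(1,2) b0 by simp
    qed
  qed
  show ?thesis unfolding bipyramid_graph_def
    using polytope_standard_bipyramid gon_vertex_periodic gon_vertex_inj nsd ext eN eS standard_base_edge nNS nVV
    by (intro conjI allI impI) auto
qed

lemma aff_dim_standard_bipyramid: "aff_dim (standard_bipyramid k) = 3"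
proof (rule ccontr)
  assume "aff_dim (standard_bipyramid k) \<noteq> 3"
  then have "aff_dim (standard_bipyramid k) < DIM(real^3)"
    using aff_dim_le_DIM[of "standard_bipyramid k"] by simp
  then obtain a b where a: "a \<noteq> 0" "standard_bipyramid k \<subseteq> {x. a \<bullet> x = b}"
    using aff_lowdim_subset_hyperplane by metis
  have "insert north (insert south (range (gon_vertex k))) \<subseteq> standard_bipyramid k"
    unfolding standard_bipyramid_hull by (rule hull_subset)
  then have *: "a \<bullet> north = b" "a \<bullet> south = b" "\<And>j. a \<bullet> gon_vertex k j = b" using a(2) by auto
  have "a $ 3 = 0" "b = 0" using *(1,2) by (simp_all add: inner_vec_def sum_3)
  moreover have "a $ 1 = 0" using *(3)[of 0] \<open>b = 0\<close> by (simp add: inner_vec_def sum_3 gon_vertex_def)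
  moreover have "sin (2 * pi / real k) > 0" using k by (intro sin_gt_zero) (auto simp: divide_less_eq)
  then have "a $ 2 = 0" using *(3)[of 1] \<open>b = 0\<close> \<open>a $ 1 = 0\<close> by (simp add: inner_vec_def sum_3 gon_vertex_def)
  ultimately have "a = 0" by (simp add: vec_eq_iff forall_3)
  then show False using a(1) by simp
qed

end

section \<open>Lorentzian geometry of tangent spheres\<close>

definition lorentz :: "(real^3) \<times> real \<Rightarrow> (real^3) \<times> real \<Rightarrow> real" where
  "lorentz x y = fst x \<bullet> fst y - snd x * snd y"

lemma lorentz_simps:
  "lorentz (x + y) z = lorentz x z + lorentz y z" "lorentz z (x + y) = lorentz z x + lorentz z y"
  "lorentz (x - y) z = lorentz x z - lorentz y z" "lorentz z (x - y) = lorentz z x - lorentz z y"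
  "lorentz (a *\<^sub>R x) z = a * lorentz x z" "lorentz z (a *\<^sub>R x) = a * lorentz z x"
  "lorentz 0 z = 0" "lorentz z 0 = 0"
  by (simp_all add: lorentz_def inner_add_left inner_add_right inner_diff_left inner_diff_right algebra_simps)

lemma lorentz_commute: "lorentz x y = lorentz y x"
  by (simp add: lorentz_def inner_commute mult.commute)

text \<open>The combination that cancels the time components is purely spatial, and its Euclidean
  square expands to 0.\<close>

lemma lorentz_lightlike_orthogonal:
  assumes "lorentz x x = 0" "lorentz y y = 0" "lorentz x y = 0"
  shows "snd y *\<^sub>R x = snd x *\<^sub>R y"
proof -
  let ?w = "snd y *\<^sub>R fst x - snd x *\<^sub>R fst y"
  have "?w \<bullet> ?w = (snd y)\<^sup>2 * (fst x \<bullet> fst x) - 2 * snd x * snd y * (fst x \<bullet> fst y) + (snd x)\<^sup>2 * (fst y \<bullet> fst y)"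
    by (simp add: inner_diff_left inner_diff_right inner_commute power2_eq_square algebra_simps)
  also have "\<dots> = 0" using assms by (simp add: lorentz_def power2_eq_square algebra_simps)
  finally have "?w = 0" by simp
  then show ?thesis by (intro prod_eqI) simp_all
qed

text \<open>The Lorentz complement of a nonzero vector in the 4-dimensional space is a hyperplane,
  so three independent vectors in it span it, even if \<open>W\<close> is light-like.\<close>

lemma lorentz_complement_span:
  fixes x1 x2 x3 W D :: "(real^3) \<times> real"
  assumes ind: "\<And>a b c. a *\<^sub>R x1 + b *\<^sub>R x2 + c *\<^sub>R x3 = 0 \<Longrightarrow> a = 0 \<and> b = 0 \<and> c = 0"
    and W: "W \<noteq> 0" "lorentz W x1 = 0" "lorentz W x2 = 0" "lorentz W x3 = 0" "lorentz W D = 0"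
  obtains a b c where "D = a *\<^sub>R x1 + b *\<^sub>R x2 + c *\<^sub>R x3"
proof -
  \<comment> \<open>Changing the sign of time turns Lorentz orthogonality to \<open>W\<close> into
    Euclidean orthogonality to \<open>J\<close>.\<close>
  define J where "J = (fst W, - snd W)"
  have J: "J \<bullet> x = lorentz W x" for x by (cases x) (simp add: J_def lorentz_def inner_prod_def)
  have J0: "J \<noteq> 0" using W(1) by (cases W) (auto simp: J_def zero_prod_def)
  have dimH: "dim {x. J \<bullet> x = 0} = 3" using dim_hyperplane[OF J0] by simp
  have nz: "x3 \<noteq> 0" using ind[of 0 0 1] by auto
  have Ysp: "x2 \<notin> span {x3}"
  proof
    assume "x2 \<in> span {x3}"
    then obtain c where "x2 = c *\<^sub>R x3" by (auto simp: span_singleton)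
    then show False using ind[of 0 1 "-c"] by simp
  qed
  have Xsp: "x1 \<notin> span {x2, x3}"
  proof
    assume "x1 \<in> span {x2, x3}"
    then obtain b c where "x1 - b *\<^sub>R x2 = c *\<^sub>R x3" by (auto simp: span_breakdown_eq span_singleton)
    then have "x1 = b *\<^sub>R x2 + c *\<^sub>R x3" by (simp add: algebra_simps)
    then show False using ind[of 1 "-b" "-c"] by simp
  qed
  have indep: "independent {x1, x2, x3}"
    using nz Ysp Xsp span_base[of _ "{x3}"] span_base[of _ "{x2, x3}"]
    by (auto simp: independent_insert)
  have "card {x1, x2, x3} = 3"
    using Xsp Ysp span_base[of x1 "{x2, x3}"] span_base[of x2 "{x3}"] by (auto simp: card_insert_if)
  then have "dim (span {x1, x2, x3}) = 3" using dim_eq_card_independent[OF indep] by simp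
  moreover have "span {x1, x2, x3} \<subseteq> {x. J \<bullet> x = 0}"
    using W J by (intro span_minimal subspace_hyperplane) auto
  ultimately have "span {x1, x2, x3} = {x. J \<bullet> x = 0}"
    using dimH by (intro subspace_dim_equal subspace_hyperplane) simp_all
  then have "D \<in> span {x1, x2, x3}" using W(5) J by auto
  then obtain a where "D - a *\<^sub>R x1 \<in> span {x2, x3}" unfolding span_breakdown_eq[of D x1] by (elim exE)
  then obtain b where "D - a *\<^sub>R x1 - b *\<^sub>R x2 \<in> span {x3}" unfolding span_breakdown_eq[of _ x2] by (elim exE)
  then obtain c where "D - a *\<^sub>R x1 - b *\<^sub>R x2 = c *\<^sub>R x3" by (auto simp: span_singleton)
  then have "a *\<^sub>R x1 + b *\<^sub>R x2 + (D - a *\<^sub>R x1 - b *\<^sub>R x2) = a *\<^sub>R x1 + b *\<^sub>R x2 + c *\<^sub>R x3"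
    by (rule arg_cong)
  moreover have "a *\<^sub>R x1 + b *\<^sub>R x2 + (D - a *\<^sub>R x1 - b *\<^sub>R x2) = D" by (rule add_diff_eq[THEN trans]) simp
  ultimately have "D = a *\<^sub>R x1 + b *\<^sub>R x2 + c *\<^sub>R x3" by (rule trans[OF sym, rotated])
  then show thesis by (rule that)
qed

text \<open>\<open>sum0\<close> is balance about the origin, \<open>inv\<close> the time component
  of balance about \<open>y\<close>, a point of the projective ball model of hyperbolic space. If
  both hold, a sum of nonnegative terms is 0, and the equality case puts every \<open>p e\<close> on
  the line of \<open>y\<close> when \<open>y\<close> is nonzero.\<close>

lemma unit_ball_balance:
  fixes p :: "'i \<Rightarrow> real^3"
  assumes "finite I" "\<And>e. e \<in> I \<Longrightarrow> norm (p e) = 1" and y: "norm y < 1"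
    and sum0: "(\<Sum>e\<in>I. p e) = 0" and inv: "(\<Sum>e\<in>I. 1 / (1 - p e \<bullet> y)) = real (card I) / (1 - (norm y)\<^sup>2)" and e: "e \<in> I"
  shows "(p e \<bullet> y)\<^sup>2 = (norm y)\<^sup>2"
proof -
  have b: "\<bar>p e \<bullet> y\<bar> \<le> norm y" if "e \<in> I" for e
    using Cauchy_Schwarz_ineq2[of "p e" y] assms(2)[OF that] by simp
  have q: "1 - p e \<bullet> y > 0" if "e \<in> I" for e using b[OF that] y by linarith
  have y1: "1 - (norm y)\<^sup>2 > 0" using y by (simp add: abs_square_less_1)
  \<comment> \<open>After multiplication by the positive \<open>1 - p e \<bullet> y\<close> this is
    the Cauchy-Schwarz defect of \<open>p e\<close> and \<open>y\<close>, hence nonnegative.\<close>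
  define g where "g e = 2 - (1 - p e \<bullet> y) - (1 - (norm y)\<^sup>2) * (1 / (1 - p e \<bullet> y))" for e
  have geq: "g e * (1 - p e \<bullet> y) = (norm y)\<^sup>2 - (p e \<bullet> y)\<^sup>2" if "e \<in> I" for e
  proof -
    have "(1 / (1 - p e \<bullet> y)) * (1 - p e \<bullet> y) = 1" using q[OF that] by simp
    then have "(1 - (norm y)\<^sup>2) * (1 / (1 - p e \<bullet> y)) * (1 - p e \<bullet> y) = 1 - (norm y)\<^sup>2" by (simp only: mult.assoc) simp
    then show ?thesis unfolding g_def left_diff_distrib by (simp add: algebra_simps power2_eq_square)
  qed
  have gpos: "g e \<ge> 0" if "e \<in> I" for e
  proof -
    have "(p e \<bullet> y)\<^sup>2 \<le> (norm y)\<^sup>2" using b[OF that] by (metis abs_le_square_iff abs_norm_cancel)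
    then have "g e * (1 - p e \<bullet> y) \<ge> 0" using geq[OF that] by simp
    then show ?thesis using q[OF that] by (simp add: zero_le_mult_iff)
  qed
  have s1: "(\<Sum>e\<in>I. p e \<bullet> y) = 0" using sum0 by (metis inner_sum_left inner_zero_left)
  have "(\<Sum>e\<in>I. g e) = (\<Sum>e\<in>I. 1 + p e \<bullet> y) - (1 - (norm y)\<^sup>2) * (\<Sum>e\<in>I. 1 / (1 - p e \<bullet> y))"
    unfolding g_def sum_distrib_left sum_subtractf[symmetric] by (intro sum.cong) simp_all
  also have "(\<Sum>e\<in>I. 1 + p e \<bullet> y) = real (card I)" unfolding sum.distrib s1 by simp
  also have "(1 - (norm y)\<^sup>2) * (\<Sum>e\<in>I. 1 / (1 - p e \<bullet> y)) = real (card I)" unfolding inv using y1 by simp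
  finally have "(\<Sum>e\<in>I. g e) = 0" by simp
  then have "g e = 0" using sum_nonneg_eq_0_iff[OF assms(1), of g] gpos e by simp
  then show ?thesis using geq[OF e] by simp
qed

text \<open>The point of the unit sphere on the ray of a light-like vector. It is applied to sums of
  the lifts of adjacent vertices, whose square is 1 - 2 + 1 = 0.\<close>

definition contact :: "(real^3) \<times> real \<Rightarrow> real^3" where
  "contact x = fst x /\<^sub>R snd x"

lemma contact_eq_imp_proportional:
  assumes "contact x = contact y" "snd x > 0" "snd y > 0"
  shows "snd y *\<^sub>R x = snd x *\<^sub>R y"
proof (rule prod_eqI)
  have "fst x = snd x *\<^sub>R contact x" "fst y = snd y *\<^sub>R contact y" using assms(2,3) by (simp_all add: contact_def)
  then show "fst (snd y *\<^sub>R x) = fst (snd x *\<^sub>R y)" using assms(1) by (simp add: mult.commute)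
qed simp

lemma norm_contact:
  assumes "lorentz x x = 0" "snd x > 0"
  shows "norm (contact x) = 1"
proof -
  have "(norm (fst x))\<^sup>2 = (snd x)\<^sup>2" unfolding power2_norm_eq_inner using assms(1) by (simp add: lorentz_def power2_eq_square)
  then have "norm (fst x) = snd x" using assms(2) by (simp add: power2_eq_iff_nonneg)
  then show ?thesis using assms(2) by (simp add: contact_def)
qed

section \<open>Lorentzian bipyramid configurations\<close>

context
  fixes k :: nat and N S :: "(real^3) \<times> real" and V :: "nat \<Rightarrow> (real^3) \<times> real" and c :: real
  assumes k0: "k > 0" and per: "\<And>i. V (i + k) = V i"
    and NN: "lorentz N N = 1" and SS: "lorentz S S = 1" and VV: "\<And>i. lorentz (V i) (V i) = 1"
    and NV: "\<And>i. lorentz N (V i) = -1" and SV: "\<And>i. lorentz S (V i) = -1"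
    and adj: "\<And>i. lorentz (V i) (V (Suc i)) = -1" and NS: "lorentz N S = - c"
    and pos: "snd N > 0" "snd S > 0" "\<And>i. snd (V i) > 0"
    and ne: "\<And>i. V (Suc (Suc i)) \<noteq> V i" "N \<noteq> S"
    and indN: "\<And>i x y z. x *\<^sub>R N + y *\<^sub>R S + z *\<^sub>R V i = 0 \<Longrightarrow> x = 0 \<and> y = 0 \<and> z = 0"
    and indV: "\<And>i x y z. x *\<^sub>R N + y *\<^sub>R V i + z *\<^sub>R V (Suc i) = 0 \<Longrightarrow> x = 0 \<and> y = 0 \<and> z = 0"
begin

lemma vertex_products: "lorentz (V i) N = -1" "lorentz (V i) S = -1" "lorentz (V (Suc i)) (V i) = -1" "lorentz S N = - c"
  "lorentz N N = 1" "lorentz S S = 1" "lorentz (V i) (V i) = 1" "lorentz N (V i) = -1" "lorentz S (V i) = -1"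
  "lorentz (V i) (V (Suc i)) = -1" "lorentz N S = - c"
  using NN SS VV NV SV adj NS lorentz_commute by metis+

text \<open>The three contact points of a triangle are distinct: proportional rays would be a
  nontrivial linear relation between the lifts of its corners, against \<open>indV\<close>.\<close>

lemma contact_rays_distinct:
  "snd (N + V (Suc i)) *\<^sub>R (N + V i) \<noteq> snd (N + V i) *\<^sub>R (N + V (Suc i))"
  "snd (V i + V (Suc i)) *\<^sub>R (N + V i) \<noteq> snd (N + V i) *\<^sub>R (V i + V (Suc i))"
  "snd (V i + V (Suc i)) *\<^sub>R (N + V (Suc i)) \<noteq> snd (N + V (Suc i)) *\<^sub>R (V i + V (Suc i))"
proof -
  have p: "snd (N + V (Suc i)) > 0" "snd (N + V i) > 0" "snd (V i + V (Suc i)) > 0"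
    using pos(1) pos(3)[of i] pos(3)[of "Suc i"] by auto
  show "snd (N + V (Suc i)) *\<^sub>R (N + V i) \<noteq> snd (N + V i) *\<^sub>R (N + V (Suc i))"
  proof
    assume "snd (N + V (Suc i)) *\<^sub>R (N + V i) = snd (N + V i) *\<^sub>R (N + V (Suc i))"
    then have "(snd (N + V (Suc i)) - snd (N + V i)) *\<^sub>R N + snd (N + V (Suc i)) *\<^sub>R V i + (- snd (N + V i)) *\<^sub>R V (Suc i) = 0"
      by (simp add: algebra_simps)
    from indV[OF this] show False using p by simp
  qed
  show "snd (V i + V (Suc i)) *\<^sub>R (N + V i) \<noteq> snd (N + V i) *\<^sub>R (V i + V (Suc i))"
  proof
    assume "snd (V i + V (Suc i)) *\<^sub>R (N + V i) = snd (N + V i) *\<^sub>R (V i + V (Suc i))"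
    then have "snd (V i + V (Suc i)) *\<^sub>R N + (snd (V i + V (Suc i)) - snd (N + V i)) *\<^sub>R V i + (- snd (N + V i)) *\<^sub>R V (Suc i) = 0"
      by (simp add: algebra_simps)
    from indV[OF this] show False using p by simp
  qed
  show "snd (V i + V (Suc i)) *\<^sub>R (N + V (Suc i)) \<noteq> snd (N + V (Suc i)) *\<^sub>R (V i + V (Suc i))"
  proof
    assume "snd (V i + V (Suc i)) *\<^sub>R (N + V (Suc i)) = snd (N + V (Suc i)) *\<^sub>R (V i + V (Suc i))"
    then have "snd (V i + V (Suc i)) *\<^sub>R N + (- snd (N + V (Suc i))) *\<^sub>R V i + (snd (V i + V (Suc i)) - snd (N + V (Suc i))) *\<^sub>R V (Suc i) = 0"
      by (simp add: algebra_simps)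
    from indV[OF this] show False using p by simp
  qed
qed

text \<open>For \<open>c = -1\<close> the vector \<open>N - S\<close> would be light-like and
  orthogonal to the light-like \<open>N + V 0\<close> and \<open>N + V 1\<close>, so it would be
  proportional to both, and these two to each other.\<close>

lemma apex_product_neq: "c \<noteq> -1"
proof
  assume c: "c = -1"
  define W where "W = N - S"
  have "lorentz W W = 0" "lorentz W (N + V 0) = 0" "lorentz W (N + V 1) = 0"
    using c by (simp_all add: W_def lorentz_simps vertex_products)
  moreover have "lorentz (N + V i) (N + V i) = 0" for i by (simp add: lorentz_simps vertex_products)
  ultimately have e: "snd (N + V 0) *\<^sub>R W = snd W *\<^sub>R (N + V 0)" "snd (N + V 1) *\<^sub>R W = snd W *\<^sub>R (N + V 1)"
    using lorentz_lightlike_orthogonal by blast+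
  have W0: "snd W \<noteq> 0"
  proof
    assume "snd W = 0"
    then have "snd (N + V 0) *\<^sub>R W = 0" using e(1) by simp
    then have "W = 0" using pos(1) pos(3)[of 0] by auto
    then show False using ne(2) by (simp add: W_def)
  qed
  have "snd W *\<^sub>R (snd (N + V 1) *\<^sub>R (N + V 0)) = snd (N + V 1) *\<^sub>R (snd (N + V 0) *\<^sub>R W)"
    unfolding e(1) by (simp add: mult.commute)
  also have "\<dots> = snd (N + V 0) *\<^sub>R (snd (N + V 1) *\<^sub>R W)" by (simp add: mult.commute)
  also have "\<dots> = snd W *\<^sub>R (snd (N + V 0) *\<^sub>R (N + V 1))" unfolding e(2) by (simp add: mult.commute)
  finally have "snd (N + V 1) *\<^sub>R (N + V 0) = snd (N + V 0) *\<^sub>R (N + V 1)"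
    using W0 by (simp only: scaleR_cancel_left) simp
  then show False using contact_rays_distinct(1)[of 0] by simp
qed

text \<open>The difference \<open>W\<close> of \<open>V (Suc (Suc i))\<close> and \<open>V i\<close>
  is orthogonal to \<open>N\<close>, \<open>S\<close> and \<open>V (Suc i)\<close>, and to the sum
  \<open>D\<close> because both vectors have square 1. So \<open>D\<close> is a combination of those
  three, and its products with them, all -2, fix the coefficients.\<close>

lemma equator_recurrence:
  "(1 + c) *\<^sub>R (V (Suc (Suc i)) + V i) = (6 - 2 * c) *\<^sub>R V (Suc i) + 4 *\<^sub>R (N + S)"
proof -
  define D where "D = V (Suc (Suc i)) + V i"
  define W where "W = V (Suc (Suc i)) - V i"
  have W: "W \<noteq> 0" "lorentz W N = 0" "lorentz W S = 0" "lorentz W (V (Suc i)) = 0" "lorentz W D = 0"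
    using ne(1)[of i] by (simp_all add: W_def D_def lorentz_simps vertex_products lorentz_commute[of "V i" "V (Suc (Suc i))"])
  obtain x y z where D: "D = x *\<^sub>R N + y *\<^sub>R S + z *\<^sub>R V (Suc i)"
    by (rule lorentz_complement_span[OF indN W])
  have "lorentz D N = x - y * c - z" "lorentz D S = - x * c + y - z" "lorentz D (V (Suc i)) = - x - y + z"
    unfolding D by (simp_all add: lorentz_simps vertex_products)
  moreover have "lorentz D N = -2" "lorentz D S = -2" "lorentz D (V (Suc i)) = -2"
    by (simp_all add: D_def lorentz_simps vertex_products)
  ultimately have e: "x - y * c - z = -2" "- x * c + y - z = -2" "- x - y + z = -2" by simp_all
  have "(x - y) * (1 + c) = 0" using e(1,2) by (simp add: algebra_simps)
  then have xy: "y = x" using apex_product_neq by auto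
  have z: "z = 2 * x - 2" using e(3) xy by simp
  have "x * (1 + c) = 4" using e(1) xy z by (simp add: algebra_simps)
  then have x: "(1 + c) * x = 4" by (simp add: mult.commute)
  then have z': "(1 + c) * z = 6 - 2 * c" unfolding z by (simp add: algebra_simps)
  have "(1 + c) *\<^sub>R D = ((1 + c) * x) *\<^sub>R N + ((1 + c) * x) *\<^sub>R S + ((1 + c) * z) *\<^sub>R V (Suc i)"
    unfolding D xy by (simp add: scaleR_add_right)
  then show ?thesis unfolding x z' D_def by (simp add: scaleR_add_right)
qed

text \<open>The recurrence is summed over one period. Positivity of the time components then gives
  \<open>c > 1\<close>, which makes \<open>N + S\<close> time-like, its square being 2 - 2
  c.\<close>

lemma equator_sum: "(c - 1) *\<^sub>R (\<Sum>i<k. V i) = real k *\<^sub>R (N + S)" and apex_product_gt: "c > 1"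
proof -
  let ?s = "\<Sum>i<k. V i"
  have s1: "(\<Sum>i<k. V (Suc i)) = ?s" by (rule sum_periodic_shift[where k = k and h = V, OF k0 per])
  have s2: "(\<Sum>i<k. V (Suc (Suc i))) = (\<Sum>i<k. V (Suc i))"
    by (rule sum_periodic_shift[where k = k and h = "\<lambda>i. V (Suc i)", OF k0]) (simp add: per flip: add_Suc)
  have "(\<Sum>i<k. (1 + c) *\<^sub>R (V (Suc (Suc i)) + V i)) = (\<Sum>i<k. (6 - 2 * c) *\<^sub>R V (Suc i) + 4 *\<^sub>R (N + S))"
    by (rule sum.cong[OF refl]) (rule equator_recurrence)
  then have "(1 + c) *\<^sub>R (?s + ?s) = (6 - 2 * c) *\<^sub>R ?s + real k *\<^sub>R (4 *\<^sub>R (N + S))"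
    by (simp only: sum.distrib scaleR_sum_right[symmetric] s1 s2 sum_constant_scaleR card_lessThan scaleR_add_right)
      (simp add: scaleR_sum_right[symmetric] mult.commute)
  moreover have "4 *\<^sub>R ((c - 1) *\<^sub>R ?s) = (1 + c) *\<^sub>R (?s + ?s) - (6 - 2 * c) *\<^sub>R ?s"
  proof -
    have "(1 + c) *\<^sub>R (?s + ?s) = (2 * (1 + c)) *\<^sub>R ?s" by (metis scaleR_2 scaleR_scaleR mult.commute)
    then have "(1 + c) *\<^sub>R (?s + ?s) - (6 - 2 * c) *\<^sub>R ?s = (2 * (1 + c) - (6 - 2 * c)) *\<^sub>R ?s"
      by (simp only: scaleR_diff_left)
    moreover have "2 * (1 + c) - (6 - 2 * c) = 4 * (c - 1)" by simp
    ultimately show ?thesis by (simp only: scaleR_scaleR)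
  qed
  ultimately have "4 *\<^sub>R ((c - 1) *\<^sub>R ?s) = real k *\<^sub>R (4 *\<^sub>R (N + S))"
    by (simp only: add_diff_cancel_left')
  also have "\<dots> = 4 *\<^sub>R (real k *\<^sub>R (N + S))" by (simp only: scaleR_scaleR mult.commute)
  finally have "4 *\<^sub>R ((c - 1) *\<^sub>R ?s) = 4 *\<^sub>R (real k *\<^sub>R (N + S))" .
  then show sum: "(c - 1) *\<^sub>R ?s = real k *\<^sub>R (N + S)" by (simp only: scaleR_cancel_left) simp
  have "(c - 1) * snd ?s = real k * snd (N + S)" using arg_cong[OF sum, of snd] by simp
  moreover have "real k * snd (N + S) > 0" using k0 pos by simp
  moreover have "snd ?s > 0" unfolding snd_sum using k0 pos by (intro sum_pos) auto
  ultimately show "c > 1" by (metis diff_gt_0_iff_gt zero_less_mult_pos2)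
qed


text \<open>If the centre were not the origin, \<open>unit_ball_balance\<close> would place all
  contact points on one line through the origin. That line meets the sphere in two points, but a
  triangle has three contact points.\<close>

lemma apex_sum_spatial_zero:
  assumes k2: "k \<ge> 2"
    and bary: "(\<Sum>i<k. contact (N + V i) + contact (S + V i) + contact (V i + V (Suc i))) = 0"
  shows "fst (N + S) = 0"
proof (rule ccontr)
  assume nz: "fst (N + S) \<noteq> 0"
  define T where "T = N + S"
  define \<tau> where "\<tau> = snd T"
  \<comment> \<open>The centre as a point of the projective ball model; that it lies inside the ball
    expresses that \<open>T\<close> is time-like.\<close>
  define y where "y = fst T /\<^sub>R \<tau>"
  have t0: "\<tau> > 0" using pos by (simp add: \<tau>_def T_def)
  have y0: "y \<noteq> 0" using nz t0 by (simp add: y_def T_def)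
  have TT: "lorentz T T = 2 - 2 * c" by (simp add: T_def lorentz_simps vertex_products)
  then have fT: "(norm (fst T))\<^sup>2 = \<tau>\<^sup>2 - 2 * (c - 1)"
    unfolding power2_norm_eq_inner by (simp add: lorentz_def \<tau>_def power2_eq_square algebra_simps)
  have ny2: "(norm y)\<^sup>2 = (norm (fst T))\<^sup>2 / \<tau>\<^sup>2" using t0 by (simp add: y_def power_divide power_mult_distrib field_simps)
  have c1: "c - 1 > 0" using apex_product_gt by simp
  have ny: "1 - (norm y)\<^sup>2 = 2 * (c - 1) / \<tau>\<^sup>2" unfolding ny2 fT using t0 by (simp add: diff_divide_distrib)
  moreover have "2 * (c - 1) / \<tau>\<^sup>2 > 0" using c1 t0 by simp
  ultimately have "(norm y)\<^sup>2 < 1" by simp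
  then have y1: "norm y < 1" by (simp add: abs_square_less_1)
  \<comment> \<open>The second index is the kind of edge: 0 at \<open>N\<close>, 1 at
    \<open>S\<close>, 2 on the equator.\<close>
  define x where "x e = (if snd e = 0 then N + V (fst e) else if snd e = 1 then S + V (fst e) else V (fst e) + V (Suc (fst e)))"
    for e :: "nat \<times> nat"
  have x_simps: "x (i, 0) = N + V i" "x (i, 1) = S + V i" "x (i, 2) = V i + V (Suc i)" for i by (simp_all add: x_def)
  have light: "lorentz (x e) (x e) = 0" for e by (simp add: x_def lorentz_simps vertex_products)
  have xpos: "snd (x e) > 0" for e using pos(1,2) pos(3)[of "fst e"] pos(3)[of "Suc (fst e)"] by (simp add: x_def)
  have xT: "lorentz (x (i, 0)) T = - (1 + c)" "lorentz (x (i, 1)) T = - (1 + c)" "lorentz (x (i, 2)) T = -4" for i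
    unfolding x_simps T_def by (simp_all add: lorentz_simps vertex_products)
  define I where "I = {..<k} \<times> {0, 1, 2::nat}"
  have fI: "finite I" and cI: "card I = 3 * k" by (simp_all add: I_def card_cartesian_product)
  have sumI: "(\<Sum>e\<in>I. h e) = (\<Sum>i<k. h (i, 0) + h (i, 1) + h (i, 2))" for h :: "nat \<times> nat \<Rightarrow> 'z :: comm_monoid_add"
    by (simp add: I_def sum.cartesian_product' add.assoc)
  have q: "1 / (1 - contact (x e) \<bullet> y) = \<tau> * snd (x e) / (- lorentz (x e) T)" for e
  proof -
    have "1 - contact (x e) \<bullet> y = - lorentz (x e) T / (snd (x e) * \<tau>)"
      using xpos[of e] t0 by (simp add: contact_def y_def lorentz_def \<tau>_def field_simps)
    then show ?thesis by (simp add: mult.commute)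
  qed
  have all: "(contact (x e) \<bullet> y)\<^sup>2 = (norm y)\<^sup>2" if "e \<in> I" for e
  proof (rule unit_ball_balance[OF fI _ y1 _ _ that])
    show "norm (contact (x e)) = 1" for e by (rule norm_contact[OF light xpos])
    show "(\<Sum>e\<in>I. contact (x e)) = 0" unfolding sumI x_simps by (rule bary)
    \<comment> \<open>The remaining goal is the balance about \<open>y\<close>. By \<open>q\<close>
      every summand is linear in time components, and \<open>equator_sum\<close> gives their total
      over the equator.\<close>
    define \<sigma> where "\<sigma> = snd (\<Sum>i<k. V i)"
    have \<sigma>: "\<sigma> = real k * \<tau> / (c - 1)"
    proof -
      have "(c - 1) * \<sigma> = real k * \<tau>" using arg_cong[OF equator_sum, of snd] by (simp add: \<sigma>_def \<tau>_def T_def)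
      then show ?thesis using c1 by (simp add: field_simps)
    qed
    have tau: "snd N + snd S = \<tau>" by (simp add: \<tau>_def T_def)
    have s: "(\<Sum>i<k. snd (V i)) = \<sigma>" by (simp add: \<sigma>_def snd_sum)
    moreover have "(\<Sum>i<k. snd (V (Suc i))) = (\<Sum>i<k. snd (V i))"
      by (rule sum_periodic_shift[where k = k and h = "\<lambda>i. snd (V i)", OF k0]) (simp add: per)
    ultimately have s': "(\<Sum>i<k. snd (V (Suc i))) = \<sigma>" by simp
    have "(\<Sum>e\<in>I. 1 / (1 - contact (x e) \<bullet> y)) =
        (\<Sum>i<k. \<tau> / (1 + c) * (snd N + snd S) + (2 * \<tau> / (1 + c) + \<tau> / 4) * snd (V i) + \<tau> / 4 * snd (V (Suc i)))"
      unfolding q sumI unfolding xT minus_minus unfolding x_simps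
      by (intro sum.cong refl) (simp add: add_divide_distrib distrib_left distrib_right)
    also have "\<dots> = \<tau> / (1 + c) * (real k * \<tau>) + (2 * \<tau> / (1 + c) + \<tau> / 4) * \<sigma> + \<tau> / 4 * \<sigma>"
      unfolding sum.distrib sum_distrib_left[symmetric] s s' tau by simp
    also have "\<dots> = real k * \<tau>\<^sup>2 * (1 / (1 + c) + (2 / (1 + c) + 1 / 4) * (1 / (c - 1)) + 1 / 4 * (1 / (c - 1)))"
      unfolding \<sigma> by (simp add: power2_eq_square distrib_left distrib_right mult_ac)
    \<comment> \<open>Partial fractions. The factor 3 matches the \<open>3 * k\<close> edges, and 2
      (c - 1) the value of 1 - |y|^2 times the square of \<open>\<tau>\<close>.\<close>
    also have "1 / (1 + c) + (2 / (1 + c) + 1 / 4) * (1 / (c - 1)) + 1 / 4 * (1 / (c - 1)) = 3 / (2 * (c - 1))"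
    proof -
      define u w where "u = 1 / (1 + c)" and "w = 1 / (c - 1)"
      have uw: "u * (1 + c) = 1" "w * (c - 1) = 1" using c1 by (simp_all add: u_def w_def)
      have "w = w * (u * (1 + c))" unfolding uw by simp
      also have "\<dots> = u * (w * (c - 1)) + 2 * u * w" by (simp add: algebra_simps)
      finally have "w = u + 2 * u * w" unfolding uw by simp
      then have "u + (2 * u + 1 / 4) * w + 1 / 4 * w = 3 / 2 * w" by (simp add: distrib_right)
      then show ?thesis by (simp add: u_def w_def)
    qed
    also have "real k * \<tau>\<^sup>2 * (3 / (2 * (c - 1))) = real (card I) / (1 - (norm y)\<^sup>2)"
      unfolding ny cI by simp
    finally show "(\<Sum>e\<in>I. 1 / (1 - contact (x e) \<bullet> y)) = real (card I) / (1 - (norm y)\<^sup>2)" .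
  qed
  have pm: "contact (x e) = y /\<^sub>R norm y \<or> contact (x e) = - (y /\<^sub>R norm y)" if "e \<in> I" for e
  proof -
    have n1: "norm (contact (x e)) = 1" by (rule norm_contact[OF light xpos])
    have "\<bar>contact (x e) \<bullet> y\<bar> = \<bar>norm y\<bar>"
      using all[OF that] unfolding power2_eq_iff abs_eq_iff .
    then have "\<bar>contact (x e) \<bullet> y\<bar> = norm (contact (x e)) * norm y" using n1 by simp
    from iffD1[OF norm_cauchy_schwarz_abs_eq this]
    have "y = norm y *\<^sub>R contact (x e) \<or> y = norm y *\<^sub>R (- contact (x e))" by (simp add: n1)
    then have "y /\<^sub>R norm y = contact (x e) \<or> y /\<^sub>R norm y = - contact (x e)"
    proof
      assume "y = norm y *\<^sub>R contact (x e)"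
      then have "y /\<^sub>R norm y = (norm y *\<^sub>R contact (x e)) /\<^sub>R norm y" by (rule arg_cong)
      also have "\<dots> = contact (x e)" using y0 by simp
      finally show ?thesis by (rule disjI1)
    next
      assume "y = norm y *\<^sub>R (- contact (x e))"
      then have "y /\<^sub>R norm y = (norm y *\<^sub>R (- contact (x e))) /\<^sub>R norm y" by (rule arg_cong)
      also have "\<dots> = - contact (x e)" using y0 by simp
      finally show ?thesis by (rule disjI2)
    qed
    then show ?thesis by (elim disjE) simp_all
  qed
  \<comment> \<open>The edges of the triangle \<open>N\<close>, \<open>V 0\<close>,
    \<open>V 1\<close>; by \<open>pm\<close> their three contact points take only two
    values.\<close>
  have "(0, 0) \<in> I" "(1, 0) \<in> I" "(0, 2) \<in> I" using k2 by (auto simp: I_def)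
  then have "contact (x (0, 0)) = contact (x (1, 0)) \<or> contact (x (0, 0)) = contact (x (0, 2)) \<or> contact (x (1, 0)) = contact (x (0, 2))"
    using pm by metis
  moreover note contact_eq_imp_proportional[OF _ xpos[of "(0, 0)"] xpos[of "(1, 0)"]]
    contact_eq_imp_proportional[OF _ xpos[of "(0, 0)"] xpos[of "(0, 2)"]]
    contact_eq_imp_proportional[OF _ xpos[of "(1, 0)"] xpos[of "(0, 2)"]]
  ultimately show False
    using contact_rays_distinct[of 0] unfolding x_simps One_nat_def by blast
qed

end

section \<open>Tangent segments\<close>

lemma mem_closed_segment_direction:
  "x \<in> closed_segment a b \<longleftrightarrow> (\<exists>u. 0 \<le> u \<and> u \<le> 1 \<and> x = a + u *\<^sub>R (b - a))"
  unfolding in_segment by (simp add: algebra_simps)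

lemma affine_hull_segment_iff:
  fixes a b :: "'a :: real_vector"
  shows "x \<in> affine hull (closed_segment a b) \<longleftrightarrow> (\<exists>u. x = a + u *\<^sub>R (b - a))"
proof -
  have "affine hull (closed_segment a b) = affine hull {a, b}"
    by (simp only: segment_convex_hull affine_hull_convex_hull)
  also have "x \<in> \<dots> \<longleftrightarrow> (\<exists>u. x = a + u *\<^sub>R (b - a))"
  proof
    assume "x \<in> affine hull {a, b}"
    then obtain u v where uv: "x = u *\<^sub>R a + v *\<^sub>R b" "u + v = 1" unfolding affine_hull_2 by blast
    then have u: "u = 1 - v" by simp
    have "x = a + v *\<^sub>R (b - a)" unfolding uv(1) u by (simp add: algebra_simps)
    then show "\<exists>u. x = a + u *\<^sub>R (b - a)" ..
  next
    assume "\<exists>u. x = a + u *\<^sub>R (b - a)"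
    then obtain u where "x = a + u *\<^sub>R (b - a)" ..
    then have "x = (1 - u) *\<^sub>R a + u *\<^sub>R b" by (simp add: algebra_simps)
    moreover have "(1 - u) + u = 1" by simp
    ultimately show "x \<in> affine hull {a, b}" unfolding affine_hull_2 by blast
  qed
  finally show ?thesis .
qed

definition tangent_length :: "real^3 \<Rightarrow> real" where
  "tangent_length a = sqrt (a \<bullet> a - 1)"

text \<open>The contact point is the foot of the perpendicular from the origin. Hence the tangent
  lengths are the distances of the ends from it, and it divides the segment in their ratio.\<close>

lemma tangent_segment:
  assumes ab: "a \<noteq> b" and t: "tangent_at (closed_segment a b) x"
  shows "a \<bullet> a \<ge> 1" "a \<bullet> b = 1 - tangent_length a * tangent_length b"
    "(tangent_length a + tangent_length b) *\<^sub>R x = tangent_length b *\<^sub>R a + tangent_length a *\<^sub>R b"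
    "norm x = 1" "tangent_length a = 0 \<Longrightarrow> x = a"
proof -
  define w where "w = b - a"
  have w0: "w \<bullet> w > 0" using ab by (simp add: w_def)
  have xseg: "x \<in> closed_segment a b" and xs: "affine hull (closed_segment a b) \<inter> sphere 0 1 = {x}"
    using t by (simp_all add: tangent_at_def)
  obtain u where u: "0 \<le> u" "u \<le> 1" "x = a + u *\<^sub>R w"
    using xseg unfolding mem_closed_segment_direction w_def by blast
  show n1: "norm x = 1" using xs by auto
  then have xx: "x \<bullet> x = 1" by (simp add: dot_square_norm)
  \<comment> \<open>The second intersection of the line with the sphere; it must coincide with
    \<open>x\<close>, which makes \<open>x\<close> orthogonal to the line.\<close>
  define y where "y = x - (2 * (x \<bullet> w) / (w \<bullet> w)) *\<^sub>R w"
  have "y = a + (u - 2 * (x \<bullet> w) / (w \<bullet> w)) *\<^sub>R (b - a)"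
    by (simp add: y_def u(3) w_def scaleR_left_diff_distrib)
  then have "y \<in> affine hull (closed_segment a b)" unfolding affine_hull_segment_iff by blast
  moreover have "y \<bullet> y = 1"
  proof -
    have "y \<bullet> y = x \<bullet> x - 2 * (2 * (x \<bullet> w) / (w \<bullet> w)) * (x \<bullet> w) + (2 * (x \<bullet> w) / (w \<bullet> w)) * (2 * (x \<bullet> w) / (w \<bullet> w)) * (w \<bullet> w)"
      unfolding y_def inner_diff_left inner_diff_right by (simp add: inner_commute)
    then show ?thesis using w0 xx by simp
  qed
  then have "y \<in> sphere 0 1" by (simp add: norm_eq_1)
  ultimately have "y = x" using xs by blast
  then have xw: "x \<bullet> w = 0" using w0 by (simp add: y_def)
  have a: "a = x - u *\<^sub>R w" using u(3) by simp
  have b: "b = x + (1 - u) *\<^sub>R w" using a by (simp add: w_def algebra_simps)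
  have aa: "a \<bullet> a = 1 + u\<^sup>2 * (w \<bullet> w)"
    unfolding a inner_diff_left inner_diff_right using xx xw by (simp add: inner_commute power2_eq_square)
  have bb: "b \<bullet> b = 1 + (1 - u)\<^sup>2 * (w \<bullet> w)"
    unfolding b inner_add_left inner_add_right using xx xw by (simp add: inner_commute power2_eq_square)
  have ta: "tangent_length a = u * norm w"
    unfolding tangent_length_def aa using u by (simp add: real_sqrt_mult norm_eq_sqrt_inner)
  have tb: "tangent_length b = (1 - u) * norm w"
    unfolding tangent_length_def bb using u by (simp add: real_sqrt_mult norm_eq_sqrt_inner)
  show "a \<bullet> a \<ge> 1" using aa by simp
  show "a \<bullet> b = 1 - tangent_length a * tangent_length b"
  proof -
    have "a \<bullet> b = 1 - u * (1 - u) * (w \<bullet> w)"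
      unfolding a b inner_diff_left inner_add_right using xx xw by (simp add: inner_commute)
    then show ?thesis unfolding ta tb by (simp add: dot_square_norm power2_eq_square)
  qed
  show "(tangent_length a + tangent_length b) *\<^sub>R x = tangent_length b *\<^sub>R a + tangent_length a *\<^sub>R b"
  proof -
    have "(u * m + (1 - u) * m) *\<^sub>R x = ((1 - u) * m) *\<^sub>R (x - u *\<^sub>R w) + (u * m) *\<^sub>R (x + (1 - u) *\<^sub>R w)" for m
      by (simp add: algebra_simps)
    then show ?thesis unfolding ta tb a[symmetric] b[symmetric] .
  qed
  show "tangent_length a = 0 \<Longrightarrow> x = a" using ta w0 a by auto
qed

lemma contact_point_unique:
  assumes "tangent_at e x" shows "contact_point e = x"
  unfolding contact_point_def using assms by (intro the_equality) (auto simp: tangent_at_def)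

text \<open>On the line the squared norm is 1 plus a square that vanishes for a single parameter,
  the one dividing the segment in the ratio of the tangent lengths.\<close>

lemma tangent_segmentI:
  assumes t: "tangent_length a > 0" "tangent_length b > 0"
    and ab: "a \<bullet> b = 1 - tangent_length a * tangent_length b"
  shows "tangent_at (closed_segment a b)
    ((tangent_length b / (tangent_length a + tangent_length b)) *\<^sub>R a + (tangent_length a / (tangent_length a + tangent_length b)) *\<^sub>R b)"
proof -
  define p q where "p = tangent_length a" and "q = tangent_length b"
  have pq: "p > 0" "q > 0" using t by (simp_all add: p_def q_def)
  have aa: "a \<bullet> a = 1 + p\<^sup>2" using t(1) unfolding p_def tangent_length_def by simp
  have bb: "b \<bullet> b = 1 + q\<^sup>2" using t(2) unfolding q_def tangent_length_def by simp
  have ab': "a \<bullet> b = 1 - p * q" using ab by (simp add: p_def q_def)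
  define l where "l = p / (p + q)"
  have l: "0 \<le> l" "l \<le> 1" "q / (p + q) = 1 - l" using pq by (auto simp: l_def field_simps)
  define x where "x = a + l *\<^sub>R (b - a)"
  have x: "(q / (p + q)) *\<^sub>R a + (p / (p + q)) *\<^sub>R b = x"
    unfolding l(3) l_def[symmetric] x_def by (simp add: algebra_simps)
  have ww: "(b - a) \<bullet> (b - a) = (p + q)\<^sup>2"
    unfolding inner_diff_left inner_diff_right aa bb ab' inner_commute[of b a] by (simp add: power2_eq_square algebra_simps)
  have aw: "a \<bullet> (b - a) = - p * (p + q)"
    unfolding inner_diff_right aa ab' by (simp add: power2_eq_square algebra_simps)
  have norm2: "(a + u *\<^sub>R (b - a)) \<bullet> (a + u *\<^sub>R (b - a)) = 1 + (u * (p + q) - p)\<^sup>2" for u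
  proof -
    have "(a + u *\<^sub>R (b - a)) \<bullet> (a + u *\<^sub>R (b - a)) = a \<bullet> a + 2 * u * (a \<bullet> (b - a)) + u\<^sup>2 * ((b - a) \<bullet> (b - a))"
      by (simp only: inner_add_left inner_add_right inner_scaleR_left inner_scaleR_right inner_commute[of "b - a" a])
        (simp add: power2_eq_square algebra_simps)
    then show ?thesis unfolding aa aw ww by (simp add: power2_eq_square algebra_simps)
  qed
  have on: "norm (a + u *\<^sub>R (b - a)) = 1 \<longleftrightarrow> u = l" for u
  proof -
    have "norm (a + u *\<^sub>R (b - a)) = 1 \<longleftrightarrow> u * (p + q) = p" unfolding norm_eq_1 norm2 by simp
    also have "\<dots> \<longleftrightarrow> u = l" using pq by (simp add: l_def eq_divide_eq)
    finally show ?thesis .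
  qed
  have "x \<in> closed_segment a b" unfolding mem_closed_segment_direction x_def using l by blast
  moreover have "affine hull (closed_segment a b) \<inter> sphere 0 1 = {x}"
  proof (intro equalityI subsetI)
    fix z assume z: "z \<in> affine hull (closed_segment a b) \<inter> sphere 0 1"
    then obtain u where "z = a + u *\<^sub>R (b - a)" using affine_hull_segment_iff by blast
    then show "z \<in> {x}" using z on[of u] by (simp add: x_def)
  next
    fix z assume "z \<in> {x}"
    then show "z \<in> affine hull (closed_segment a b) \<inter> sphere 0 1"
      using on[of l] affine_hull_segment_iff[of x a b] by (auto simp: x_def)
  qed
  ultimately show ?thesis using x by (simp add: tangent_at_def p_def q_def)
qed

lemma vertex_not_in_segment_face:
  fixes Q :: "(real^3) set"
  assumes "u extreme_point_of Q" "closed_segment v w face_of Q" "u \<noteq> v" "u \<noteq> w"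
  shows "u \<notin> closed_segment v w"
  using extreme_point_of_face[OF assms(2), of u] assms by (auto simp: extreme_point_of_segment)

lemma extreme_points_not_collinear:
  fixes Q :: "(real^3) set"
  assumes "u extreme_point_of Q" "v extreme_point_of Q" "w extreme_point_of Q" "u \<noteq> v" "u \<noteq> w" "v \<noteq> w"
  shows "\<not> collinear {u, v, w}"
proof
  assume "collinear {u, v, w}"
  then consider "between (v, w) u" | "between (w, u) v" | "between (u, v) w"
    unfolding collinear_between_cases by blast
  moreover have *: "False" if "between (y, z) x" "x extreme_point_of Q" "y extreme_point_of Q" "z extreme_point_of Q" "x \<noteq> y" "x \<noteq> z" for x y z
  proof -
    have "y \<in> Q" "z \<in> Q" using that by (simp_all add: extreme_point_of_def)
    then have "x \<notin> open_segment y z" using that(2) by (simp add: extreme_point_of_def)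
    moreover have "x \<in> closed_segment y z" using that(1) by (simp add: between_mem_segment)
    ultimately show False using that(5,6) by (simp add: open_segment_def)
  qed
  ultimately show False using assms *[of v w u] *[of w u v] *[of u v w] by cases auto
qed

text \<open>The second component of a linear relation says that its coefficients, rescaled by
  \<open>r\<close>, \<open>s\<close>, \<open>t\<close>, sum to 0, so the relation is an affine
  dependence of three points.\<close>

lemma lifted_independent:
  fixes u v w :: "real^3"
  assumes nc: "\<not> collinear {u, v, w}" and r: "r \<noteq> 0" "s \<noteq> 0" "t \<noteq> 0"
    and z: "x *\<^sub>R (r *\<^sub>R u, r) + y *\<^sub>R (s *\<^sub>R v, s) + z *\<^sub>R (t *\<^sub>R w, t :: real) = 0"
  shows "x = 0 \<and> y = 0 \<and> z = 0"
proof (rule ccontr)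
  assume xyz: "\<not> (x = 0 \<and> y = 0 \<and> z = 0)"
  define a b c where "a = x * r" and "b = y * s" and "c = z * t"
  have nz: "\<not> (a = 0 \<and> b = 0 \<and> c = 0)" using xyz r by (simp add: a_def b_def c_def)
  have e: "a *\<^sub>R u + b *\<^sub>R v + c *\<^sub>R w = 0" "a + b + c = 0"
    using z by (simp_all add: zero_prod_def a_def b_def c_def)
  have col: "collinear {p, q, m}" if "\<alpha> \<noteq> 0" "\<alpha> *\<^sub>R p + \<beta> *\<^sub>R q + \<gamma> *\<^sub>R m = 0" "\<alpha> + \<beta> + \<gamma> = 0" for \<alpha> \<beta> \<gamma> and p q m :: "real^3"
  proof -
    have "\<alpha> *\<^sub>R p = - (\<beta> *\<^sub>R q) - \<gamma> *\<^sub>R m" using that(2) by (simp add: add_eq_0_iff2 add.assoc)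
    then have "(1 / \<alpha>) *\<^sub>R (\<alpha> *\<^sub>R p) = (1 / \<alpha>) *\<^sub>R (- (\<beta> *\<^sub>R q) - \<gamma> *\<^sub>R m)" by (rule arg_cong)
    then have "p = (- \<beta> / \<alpha>) *\<^sub>R q + (- \<gamma> / \<alpha>) *\<^sub>R m"
      using that(1) by (simp add: scaleR_diff_right)
    moreover have "- \<beta> / \<alpha> + - \<gamma> / \<alpha> = 1" using that(1,3) by (simp add: field_simps)
    ultimately have "p \<in> affine hull {q, m}" unfolding affine_hull_2 by blast
    then have "collinear {q, m, p}" by (rule affine_hull_3_imp_collinear)
    then show ?thesis by (simp add: insert_commute)
  qed
  show False using nz nc col[of a u b v c w] col[of b v a u c w] col[of c w a u b v] e
    by (auto simp: insert_commute algebra_simps)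
qed


text \<open>The recurrence makes the \<open>v i\<close> turn by a fixed angle in the plane
  orthogonal to \<open>n\<close>. Closing up after \<open>k\<close> steps gives that angle as 2 pi m
  / k, and distinctness of the vertices makes \<open>m\<close> coprime to \<open>k\<close>. The
  determinant is a function of \<open>t\<close> alone.\<close>

lemma cos_half_angle_in_field:
  fixes v :: "nat \<Rightarrow> real^3" and n :: "real^3"
  assumes k: "k > 0" and per: "\<And>i. v (i + k) = v i" and inj: "inj_on v {..<k}" and t: "t > 0"
    and vv: "\<And>i. v i \<bullet> v i = 1 + t\<^sup>2" and adj: "\<And>i. v i \<bullet> v (Suc i) = 1 - t\<^sup>2"
    and nn: "n \<bullet> n = 1 + 1 / t\<^sup>2" and nv: "\<And>i. n \<bullet> v i = 0"
    and rec: "\<And>i. (1 + t\<^sup>2) *\<^sub>R (v (Suc (Suc i)) + v i) = (2 * (1 - t\<^sup>2)) *\<^sub>R v (Suc i)"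
  shows "\<exists>m. coprime m k \<and> \<bar>cross3 (v 0) (v 1) \<bullet> n\<bar> = 2 / cos (pi * real m / real k) \<and> cos (pi * real m / real k) \<noteq> 0"
proof -
  \<comment> \<open>The angle between consecutive \<open>v i\<close>: its cosine is (1 - t^2) / (1 +
    t^2), and its half has cosine 1 / sqrt (1 + t^2).\<close>
  define \<theta> where "\<theta> = 2 * arctan t"
  have th: "0 < \<theta>" "\<theta> < pi" using t arctan_ubound[of t] by (auto simp: \<theta>_def)
  have c: "cos (\<theta> / 2) = 1 / sqrt (1 + t\<^sup>2)" by (simp add: \<theta>_def cos_arctan)
  have p: "1 + t\<^sup>2 > 0" by (simp add: add_pos_nonneg)
  have "cos \<theta> = 2 * (cos (\<theta> / 2))\<^sup>2 - 1" using cos_double_cos[of "\<theta> / 2"] by simp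
  moreover have "(1 + t\<^sup>2) * (cos (\<theta> / 2))\<^sup>2 = 1" using p unfolding c by (simp add: power_divide)
  ultimately have ct: "(1 + t\<^sup>2) * cos \<theta> = 1 - t\<^sup>2" by (simp add: right_diff_distrib)
  have v0: "v 0 \<bullet> v i = (1 + t\<^sup>2) * cos (real i * \<theta>)" for i
  proof (induction i rule: less_induct)
    case (less i)
    show ?case
    proof (cases "i < 2")
      case True
      then have "i = 0 \<or> i = 1" by auto
      then show ?thesis using vv[of 0] adj[of 0] ct by auto
    next
      case False
      then obtain j where j: "i = Suc (Suc j)" by (metis add_2_eq_Suc le_Suc_ex not_less)
      have "(1 + t\<^sup>2) * (v 0 \<bullet> v i + v 0 \<bullet> v j) = 2 * ((1 + t\<^sup>2) * cos \<theta>) * (v 0 \<bullet> v (Suc j))"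
        using arg_cong[OF rec[of j], of "inner (v 0)"] ct by (simp add: j inner_add_right)
      then have "(1 + t\<^sup>2) * (v 0 \<bullet> v i + v 0 \<bullet> v j) = (1 + t\<^sup>2) * (2 * cos \<theta> * (v 0 \<bullet> v (Suc j)))"
        by (simp only: mult_ac)
      then have "v 0 \<bullet> v i + v 0 \<bullet> v j = 2 * cos \<theta> * (v 0 \<bullet> v (Suc j))"
        using p by (simp only: mult_cancel_left) simp
      then have "v 0 \<bullet> v i = (1 + t\<^sup>2) * (2 * cos \<theta> * cos (real (Suc j) * \<theta>) - cos (real j * \<theta>))"
        using less.IH[of j] less.IH[of "Suc j"] j by (simp add: algebra_simps)
      moreover have "2 * cos \<theta> * cos (real (Suc j) * \<theta>) - cos (real j * \<theta>) = cos (real i * \<theta>)"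
      proof -
        have e: "real i * \<theta> = real (Suc j) * \<theta> + \<theta>" "real j * \<theta> = real (Suc j) * \<theta> - \<theta>"
          by (simp_all add: j distrib_right)
        show ?thesis unfolding e cos_add cos_diff by simp
      qed
      ultimately show ?thesis by simp
    qed
  qed
  have eq0: "v i = v 0" if "cos (real i * \<theta>) = 1" for i
  proof -
    have "v 0 \<bullet> v i = 1 + t\<^sup>2" using v0[of i] that by simp
    then have "(v i - v 0) \<bullet> (v i - v 0) = 0"
      unfolding inner_diff_left inner_diff_right vv inner_commute[of "v i" "v 0"] by simp
    then show ?thesis by simp
  qed
  have "v 0 \<bullet> v k = 1 + t\<^sup>2" using per[of 0] vv[of 0] by simp
  then have "(1 + t\<^sup>2) * cos (real k * \<theta>) = (1 + t\<^sup>2) * 1" using v0[of k] by simp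
  then have "cos (real k * \<theta>) = 1" using p by (simp only: mult_cancel_left) simp
  then obtain m' :: int where m': "real k * \<theta> = of_int m' * 2 * pi" unfolding cos_one_2pi_int by blast
  have "real k * \<theta> > 0" using k th by simp
  then have "m' > 0" unfolding m' by (simp add: zero_less_mult_iff)
  then obtain m where m: "m' = int m" "m > 0" by (metis zero_less_imp_eq_int)
  have theta_eq: "\<theta> = 2 * (pi * real m / real k)" 
  proof -
    have "\<theta> = (real k * \<theta>) / real k" using k by simp
    then show ?thesis unfolding m' m(1) by simp
  qed
  \<comment> \<open>With a common factor the sequence would return to \<open>v 0\<close> after
    \<open>k div gcd m k\<close> steps, against injectivity.\<close>
  have "coprime m k"
  proof (rule ccontr)
    assume "\<not> coprime m k"
    then have g: "gcd m k > 1" using k by (metis coprime_iff_gcd_eq_1 gcd_pos_nat less_one linorder_neqE_nat not_less_iff_gr_or_eq)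
    define d where "d = k div gcd m k"
    have d: "0 < d" "d < k" using g k by (auto simp: d_def div_greater_zero_iff)
    have "d * m = k * (m div gcd m k)" unfolding d_def by (metis div_mult_swap gcd_dvd1 gcd_dvd2 mult.commute)
    then have "real d * real m = real k * real (m div gcd m k)" by (metis of_nat_mult)
    then have "real d * \<theta> = real (m div gcd m k) * (2 * pi)" using k by (simp add: theta_eq field_simps)
    then have "cos (real d * \<theta>) = 1" using cos_2npi[of "m div gcd m k"] by (simp add: mult_ac)
    then have "v d = v 0" by (rule eq0)
    then show False using inj_onD[OF inj, of d 0] d k by simp
  qed
  \<comment> \<open>\<open>w\<close> is parallel to \<open>n\<close>, both being orthogonal to
    \<open>v 0\<close> and \<open>v 1\<close>, so the square of \<open>w \<bullet> n\<close> is the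
    product of their squares.\<close>
  define w where "w = cross3 (v 0) (v 1)"
  have wn: "cross3 n w = 0" unfolding w_def Lagrange using nv by simp
  have "(w \<bullet> n)\<^sup>2 = (norm n * norm w)\<^sup>2"
    using norm_cross_dot[of n w] wn by (simp add: inner_commute)
  also have "\<dots> = (n \<bullet> n) * (w \<bullet> w)" by (simp add: power_mult_distrib dot_square_norm)
  also have "w \<bullet> w = (1 + t\<^sup>2)\<^sup>2 - (1 - t\<^sup>2)\<^sup>2"
  proof -
    have "(norm w)\<^sup>2 + (v 0 \<bullet> v 1)\<^sup>2 = (norm (v 0) * norm (v 1))\<^sup>2" unfolding w_def by (rule norm_cross_dot)
    then have "w \<bullet> w + (v 0 \<bullet> v 1)\<^sup>2 = (v 0 \<bullet> v 0) * (v 1 \<bullet> v 1)" by (simp add: power_mult_distrib dot_square_norm)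
    then show ?thesis using vv adj[of 0] by (simp add: power2_eq_square)
  qed
  also have "(n \<bullet> n) * ((1 + t\<^sup>2)\<^sup>2 - (1 - t\<^sup>2)\<^sup>2) = 4 * (1 + t\<^sup>2)"
  proof -
    have "(1 + t\<^sup>2)\<^sup>2 - (1 - t\<^sup>2)\<^sup>2 = 4 * t\<^sup>2" by (simp add: power2_eq_square algebra_simps)
    then show ?thesis unfolding nn using t by (simp add: distrib_right)
  qed
  finally have "(w \<bullet> n)\<^sup>2 = 4 * (1 + t\<^sup>2)" .
  moreover have "(2 * sqrt (1 + t\<^sup>2))\<^sup>2 = 4 * (1 + t\<^sup>2)"
    unfolding power_mult_distrib real_sqrt_pow2[OF less_imp_le[OF p]] by simp
  ultimately have "\<bar>w \<bullet> n\<bar>\<^sup>2 = (2 * sqrt (1 + t\<^sup>2))\<^sup>2" by (simp only: power2_abs)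
  then have "\<bar>w \<bullet> n\<bar> = 2 * sqrt (1 + t\<^sup>2)" by (rule power2_eq_imp_eq) (use p in simp_all)
  moreover have cm: "cos (pi * real m / real k) = 1 / sqrt (1 + t\<^sup>2)" using c by (simp add: theta_eq)
  ultimately have "\<bar>w \<bullet> n\<bar> = 2 / cos (pi * real m / real k)" by simp
  moreover have "cos (pi * real m / real k) \<noteq> 0" using p by (simp add: cm)
  ultimately show ?thesis using \<open>coprime m k\<close> unfolding w_def by blast
qed

section \<open>Springborn realizations of bipyramids\<close>

lemma coordinate_field_subfield: "subfield (coordinate_field Q) real_ring"
  unfolding coordinate_field_def by (rule field.generate_field_is_subfield[OF real_ring_field]) simp

lemma coordinate_in_field: "v extreme_point_of Q \<Longrightarrow> v $ i \<in> coordinate_field Q"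
  unfolding coordinate_field_def by (rule generate_field.incl) blast

text \<open>A vertex \<open>u\<close> on the sphere would have \<open>v\<close> and \<open>w\<close>
  in its tangent plane. The contact point of the edge from \<open>v\<close> to \<open>w\<close>
  would then lie in that plane and on the sphere, so it would be \<open>u\<close>, which is not on
  that edge.\<close>

lemma tangent_length_pos:
  fixes Q :: "(real^3) set"
  assumes ext: "u extreme_point_of Q" and ne: "u \<noteq> v" "u \<noteq> w" "v \<noteq> w"
    and face: "closed_segment v w face_of Q"
    and t: "tangent_at (closed_segment u v) x" "tangent_at (closed_segment u w) y" "tangent_at (closed_segment v w) z"
  shows "tangent_length u > 0"
proof -
  have uu: "u \<bullet> u \<ge> 1" by (rule tangent_segment(1)[OF ne(1) t(1)])
  have "tangent_length u \<noteq> 0"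
  proof
    assume t0: "tangent_length u = 0"
    then have uu1: "u \<bullet> u = 1" by (simp add: tangent_length_def)
    have "u \<bullet> v = 1" "u \<bullet> w = 1"
      using tangent_segment(2)[OF ne(1) t(1)] tangent_segment(2)[OF ne(2) t(2)] t0 by simp_all
    moreover have zseg: "z \<in> closed_segment v w" using t(3) by (simp add: tangent_at_def)
    ultimately have uz: "u \<bullet> z = 1"
      unfolding mem_closed_segment_direction by (auto simp: inner_add_right inner_diff_right)
    have "z \<bullet> z = 1" using tangent_segment(4)[OF ne(3) t(3)] by (simp add: dot_square_norm)
    then have "(z - u) \<bullet> (z - u) = 0"
      unfolding inner_diff_left inner_diff_right inner_commute[of z u] using uu1 uz by simp
    then have "z = u" by simp
    then show False using vertex_not_in_segment_face[OF ext face ne(1,2)] zseg by simp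
  qed
  then show ?thesis using uu by (simp add: tangent_length_def less_le)
qed

definition tangent_lift :: "real^3 \<Rightarrow> (real^3) \<times> real" where
  "tangent_lift a = ((1 / tangent_length a) *\<^sub>R a, 1 / tangent_length a)"

lemma lorentz_tangent_lift_self:
  assumes "tangent_length a > 0" shows "lorentz (tangent_lift a) (tangent_lift a) = 1"
proof -
  have "a \<bullet> a = 1 + (tangent_length a)\<^sup>2" using assms by (simp add: tangent_length_def)
  then show ?thesis using assms by (simp add: tangent_lift_def lorentz_def power2_eq_square add_divide_distrib)
qed

lemma lorentz_tangent_lift_adjacent:
  assumes "tangent_length a > 0" "tangent_length b > 0" "a \<bullet> b = 1 - tangent_length a * tangent_length b"
  shows "lorentz (tangent_lift a) (tangent_lift b) = -1"
  using assms by (simp add: tangent_lift_def lorentz_def diff_divide_distrib)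

lemma contact_tangent_lift:
  assumes p: "tangent_length a > 0" "tangent_length b > 0"
    and x: "(tangent_length a + tangent_length b) *\<^sub>R x = tangent_length b *\<^sub>R a + tangent_length a *\<^sub>R b"
  shows "contact (tangent_lift a + tangent_lift b) = x"
proof -
  define p q where "p = tangent_length a" and "q = tangent_length b"
  have pq: "p > 0" "q > 0" using p by (simp_all add: p_def q_def)
  have 1: "snd (tangent_lift a + tangent_lift b) = (p + q) / (p * q)" using pq by (simp add: tangent_lift_def p_def[symmetric] q_def[symmetric] add_frac_eq add.commute)
  have "fst (tangent_lift a + tangent_lift b) = (1 / (p * q)) *\<^sub>R (q *\<^sub>R a + p *\<^sub>R b)"
    using pq by (simp add: tangent_lift_def p_def[symmetric] q_def[symmetric] scaleR_add_right)
  also have "q *\<^sub>R a + p *\<^sub>R b = (p + q) *\<^sub>R x" using x by (simp add: p_def q_def)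
  finally have 2: "fst (tangent_lift a + tangent_lift b) = (1 / (p * q)) *\<^sub>R (p + q) *\<^sub>R x" .
  show ?thesis unfolding contact_def 1 2 using pq by simp
qed

lemma springborn_bipyramid_cos:
  assumes k: "k \<ge> 3" and G: "bipyramid_graph k Q n s v"
    and tang: "\<And>e. e edge_of Q \<Longrightarrow> \<exists>x. tangent_at e x" and bary: "edge_barycenter Q = 0"
  shows "\<exists>m. coprime m k \<and> cos (pi * real m / real k) \<in> coordinate_field Q"
proof -
  have k0: "k > 0" using k by simp
  have per: "v (i + k) = v i" and inj: "inj_on v {..<k}" and Q: "polytope Q" for i
    using G by (simp_all add: bipyramid_graph_def)
  note veq = periodic_eq_iff[of v, OF per k0 inj]
  have adj: "v i \<noteq> v (Suc i)" for i
    using k by (auto simp: veq mod_Suc split: if_splits)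
  have adj2: "v (Suc (Suc i)) \<noteq> v i" for i
  proof
    assume "v (Suc (Suc i)) = v i"
    then have "Suc (Suc i) mod k = i mod k" by (simp add: veq)
    then have "k dvd 2" by (metis mod_eq_dvd_iff_nat add_2_eq_Suc' le_add1 add_diff_cancel_left' dvd_def add_2_eq_Suc)
    then show False using k dvd_imp_le[of k 2] by simp
  qed
  have ns: "n \<noteq> s" "n \<noteq> v i" "s \<noteq> v i" for i using G by (auto simp: bipyramid_graph_def)
  have exts: "{x. x extreme_point_of Q} = insert n (insert s (range v))" using G by (simp add: bipyramid_graph_def)
  have ext: "n extreme_point_of Q" "s extreme_point_of Q" "v i extreme_point_of Q" for i
    using exts by blast+
  have fc: "closed_segment n (v i) face_of Q" "closed_segment s (v i) face_of Q" "closed_segment (v i) (v (Suc i)) face_of Q" for i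
    using G by (simp_all add: bipyramid_graph_def)
  have edge: "\<exists>x. tangent_at (closed_segment a b) x"
    if "a extreme_point_of Q" "b extreme_point_of Q" "a \<noteq> b" "closed_segment a b face_of Q" for a b
    by (rule tang) (use that edge_of_polytope_iff[OF Q] in blast)
  have tn: "\<exists>x. tangent_at (closed_segment n (v i)) x" for i by (rule edge[OF ext(1,3) ns(2) fc(1)])
  have ts: "\<exists>x. tangent_at (closed_segment s (v i)) x" for i by (rule edge[OF ext(2,3) ns(3) fc(2)])
  have tv: "\<exists>x. tangent_at (closed_segment (v i) (v (Suc i))) x" for i by (rule edge[OF ext(3,3) adj fc(3)])
  have pos_n: "tangent_length n > 0"
    using tn[of 0] tn[of 1] tv[of 0] tangent_length_pos[OF ext(1) ns(2) ns(2) adj[of 0] fc(3)[of 0]] by auto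
  have pos_s: "tangent_length s > 0"
    using ts[of 0] ts[of 1] tv[of 0] tangent_length_pos[OF ext(2) ns(3) ns(3) adj[of 0] fc(3)[of 0]] by auto
  have pos_v: "tangent_length (v i) > 0" for i
  proof -
    obtain x y z where "tangent_at (closed_segment n (v i)) x" "tangent_at (closed_segment (v i) (v (Suc i))) y"
      "tangent_at (closed_segment n (v (Suc i))) z" using tn[of i] tv[of i] tn[of "Suc i"] by blast
    then show ?thesis
      using tangent_length_pos[OF ext(3) ns(2)[symmetric] adj[of i] ns(2) fc(1)] by (simp add: closed_segment_commute)
  qed
  have dn: "n \<bullet> v i = 1 - tangent_length n * tangent_length (v i)" for i
    using tn[of i] tangent_segment(2)[OF ns(2)] by blast
  have ds: "s \<bullet> v i = 1 - tangent_length s * tangent_length (v i)" for i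
    using ts[of i] tangent_segment(2)[OF ns(3)] by blast
  have dv: "v i \<bullet> v (Suc i) = 1 - tangent_length (v i) * tangent_length (v (Suc i))" for i
    using tv[of i] tangent_segment(2)[OF adj] by blast
  have cp: "contact_point (closed_segment a b) = contact (tangent_lift a + tangent_lift b)"
    if ab: "a \<noteq> b" and t: "\<exists>x. tangent_at (closed_segment a b) x" and p: "tangent_length a > 0" "tangent_length b > 0" for a b
  proof -
    obtain x where x: "tangent_at (closed_segment a b) x" using t by blast
    show ?thesis unfolding contact_point_unique[OF x] contact_tangent_lift[OF p tangent_segment(3)[OF ab x]] by simp
  qed
  define N S V where "N = tangent_lift n" and "S = tangent_lift s" and "V = (\<lambda>i. tangent_lift (v i))"
  define c where "c = - lorentz N S"
  have ne_lift: "tangent_lift a \<noteq> tangent_lift b" if "a \<noteq> b" "tangent_length a > 0" "tangent_length b > 0" for a b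
    using that by (auto simp: tangent_lift_def)
  have i1: "x = 0 \<and> y = 0 \<and> z = 0" if "x *\<^sub>R N + y *\<^sub>R S + z *\<^sub>R V i = 0" for i x y z
    using lifted_independent[OF extreme_points_not_collinear[OF ext(1) ext(2) ext(3)[of i] ns(1) ns(2)[of i] ns(3)[of i]], of "1 / tangent_length n" "1 / tangent_length s" "1 / tangent_length (v i)" x y z]
      that pos_n pos_s pos_v[of i] by (simp add: N_def S_def V_def tangent_lift_def)
  have i2: "x = 0 \<and> y = 0 \<and> z = 0" if "x *\<^sub>R N + y *\<^sub>R V i + z *\<^sub>R V (Suc i) = 0" for i x y z
    using lifted_independent[OF extreme_points_not_collinear[OF ext(1) ext(3)[of i] ext(3)[of "Suc i"] ns(2)[of i] ns(2)[of "Suc i"] adj[of i]], of "1 / tangent_length n" "1 / tangent_length (v i)" "1 / tangent_length (v (Suc i))" x y z]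
      that pos_n pos_v[of i] pos_v[of "Suc i"] by (simp add: N_def V_def tangent_lift_def)
  have lor: "lorentz N N = 1" "lorentz S S = 1" "lorentz (V i) (V i) = 1" "lorentz N (V i) = -1" "lorentz S (V i) = -1"
    "lorentz (V i) (V (Suc i)) = -1" "lorentz N S = - c" for i
    using pos_n pos_s pos_v dn ds dv unfolding N_def S_def V_def c_def
    by (simp_all add: lorentz_tangent_lift_self lorentz_tangent_lift_adjacent)
  have spos: "snd N > 0" "snd S > 0" "snd (V i) > 0" for i
    using pos_n pos_s pos_v[of i] by (simp_all add: N_def S_def V_def tangent_lift_def)
  have Vper: "V (i + k) = V i" for i by (simp add: V_def per)
  have Vne: "V (Suc (Suc i)) \<noteq> V i" "N \<noteq> S" for i
    using ne_lift[OF adj2 pos_v pos_v] ne_lift[OF ns(1) pos_n pos_s] by (simp_all add: V_def N_def S_def)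
  note ctx = k0 Vper lor(1) lor(2) lor(3) lor(4) lor(5) lor(6) lor(7) spos(1) spos(2) spos(3) Vne(1) Vne(2) i1 i2
  have "(\<Sum>e\<in>{e. e edge_of Q}. contact_point e) = 0"
    using bary k0 bipyramid_edges(3)[OF G k] by (simp add: edge_barycenter_def)
  then have "(\<Sum>i<k. contact (N + V i) + contact (S + V i) + contact (V i + V (Suc i))) = 0"
    unfolding bipyramid_edges(4)[OF G k] cp[OF ns(2) tn pos_n pos_v] cp[OF ns(3) ts pos_s pos_v] cp[OF adj tv pos_v pos_v]
    by (simp add: N_def S_def V_def)
  then have f0: "fst (N + S) = 0"
    by (intro apex_sum_spatial_zero[of k V N S c]) (use ctx k in auto)
  have rec: "(1 + c) *\<^sub>R (V (Suc (Suc i)) + V i) = (6 - 2 * c) *\<^sub>R V (Suc i) + 4 *\<^sub>R (N + S)" for i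
    by (rule equator_recurrence[of k V N S c]) (use ctx in auto)
  define \<tau> where "\<tau> = snd (N + S)"
  have t0: "\<tau> > 0" using spos by (simp add: \<tau>_def)
  \<comment> \<open>As \<open>N + S\<close> points in the time direction, products with it read off
    time components; the known products therefore fix those of \<open>N\<close>, \<open>S\<close>
    and all \<open>V i\<close>.\<close>
  have LT: "lorentz x (N + S) = - (snd x * \<tau>)" for x using f0 by (simp add: lorentz_def \<tau>_def)
  have "1 - c = - (snd N * \<tau>)" "1 - c = - (snd S * \<tau>)"
    using LT[of N] LT[of S] lor(1,2,7) lorentz_commute[of S N] by (simp_all add: lorentz_simps)
  then have "snd N * \<tau> = snd S * \<tau>" by linarith
  then have NS: "snd N = snd S" using t0 by simp
  \<comment> \<open>\<open>t\<close> is the reciprocal of the tangent length of \<open>n\<close>. By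
    \<open>Vt\<close> it is also the tangent length of every equator vertex.\<close>
  define t where "t = snd N"
  have tau: "\<tau> = 2 * t" using NS by (simp add: \<tau>_def t_def)
  have tp: "t > 0" using spos(1) by (simp add: t_def)
  have c: "c = 1 + 2 * t\<^sup>2" using \<open>1 - c = - (snd N * \<tau>)\<close> by (simp add: tau t_def power2_eq_square)
  have Vt: "snd (V i) * t = 1" for i
    using LT[of "V i"] lor(4,5)[of i] lorentz_commute[of "V i"] by (simp add: lorentz_simps tau)
  have tl_v: "tangent_length (v i) = t" for i
    using Vt[of i] pos_v[of i] by (simp add: V_def tangent_lift_def divide_eq_eq split: if_splits)
  have tl_n: "tangent_length n = 1 / t" using pos_n by (simp add: t_def N_def tangent_lift_def)
  have self: "a \<bullet> a = 1 + (tangent_length a)\<^sup>2" if "tangent_length a > 0" for a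
    using that by (simp add: tangent_length_def)
  obtain m where m: "coprime m k" "\<bar>cross3 (v 0) (v 1) \<bullet> n\<bar> = 2 / cos (pi * real m / real k)" "cos (pi * real m / real k) \<noteq> 0"
  proof -
    have "\<exists>m. coprime m k \<and> \<bar>cross3 (v 0) (v 1) \<bullet> n\<bar> = 2 / cos (pi * real m / real k) \<and> cos (pi * real m / real k) \<noteq> 0"
    proof (rule cos_half_angle_in_field[of k v t, OF k0 per inj tp])
      show "v i \<bullet> v i = 1 + t\<^sup>2" for i using self[OF pos_v[of i]] tl_v by simp
      show "v i \<bullet> v (Suc i) = 1 - t\<^sup>2" for i using dv[of i] tl_v by (simp add: power2_eq_square)
      show "n \<bullet> n = 1 + 1 / t\<^sup>2" using self[OF pos_n] tl_n by (simp add: power_divide)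
      show "n \<bullet> v i = 0" for i using dn[of i] tl_v tl_n tp by simp
      show "(1 + t\<^sup>2) *\<^sub>R (v (Suc (Suc i)) + v i) = (2 * (1 - t\<^sup>2)) *\<^sub>R v (Suc i)" for i
      proof -
        have fV: "fst (V i) = (1 / t) *\<^sub>R v i" for i by (simp add: V_def tangent_lift_def tl_v)
        have "(1 + c) *\<^sub>R ((1 / t) *\<^sub>R v (Suc (Suc i)) + (1 / t) *\<^sub>R v i) = (6 - 2 * c) *\<^sub>R (1 / t) *\<^sub>R v (Suc i)"
          using arg_cong[OF rec[of i], of fst] f0 by (simp add: fV)
        then have "(t / 2) *\<^sub>R ((1 + c) *\<^sub>R ((1 / t) *\<^sub>R v (Suc (Suc i)) + (1 / t) *\<^sub>R v i)) = (t / 2) *\<^sub>R ((6 - 2 * c) *\<^sub>R (1 / t) *\<^sub>R v (Suc i))"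
          by (rule arg_cong)
        moreover have "(t / 2) *\<^sub>R ((1 + c) *\<^sub>R ((1 / t) *\<^sub>R v (Suc (Suc i)) + (1 / t) *\<^sub>R v i)) = ((1 + c) / 2) *\<^sub>R (v (Suc (Suc i)) + v i)"
          using tp by (simp add: scaleR_add_right[symmetric] mult.commute)
        moreover have "(t / 2) *\<^sub>R ((6 - 2 * c) *\<^sub>R (1 / t) *\<^sub>R v (Suc i)) = ((6 - 2 * c) / 2) *\<^sub>R v (Suc i)"
          using tp by simp
        moreover have "(1 + c) / 2 = 1 + t\<^sup>2" "(6 - 2 * c) / 2 = 2 * (1 - t\<^sup>2)" unfolding c by simp_all
        ultimately show ?thesis by metis
      qed
    qed
    then show thesis using that by blast
  qed
  note K = subfield_realD[OF coordinate_field_subfield[of Q]]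
  have co: "v i $ j \<in> coordinate_field Q" "n $ j \<in> coordinate_field Q" for i j
    using coordinate_in_field ext by blast+
  \<comment> \<open>The determinant is a polynomial in the coordinates, and the cosine is 2 divided
    by its absolute value.\<close>
  have "cross3 (v 0) (v 1) \<bullet> n \<in> coordinate_field Q"
    unfolding cross3_def inner_vec_def sum_3 vector_3 inner_real_def by (intro K co)
  then have "\<bar>cross3 (v 0) (v 1) \<bullet> n\<bar> \<in> coordinate_field Q" using K(3) by (auto simp: abs_if)
  then have "(1 + 1) * inverse \<bar>cross3 (v 0) (v 1) \<bullet> n\<bar> \<in> coordinate_field Q" by (intro K)
  moreover have "(1 + 1) * inverse \<bar>cross3 (v 0) (v 1) \<bullet> n\<bar> = cos (pi * real m / real k)" unfolding m(2) using m(3) by simp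
  ultimately show ?thesis using m(1) by auto
qed

section \<open>An explicit Springborn realization\<close>

lemma comb_equiv_linear_image:
  fixes f :: "real^3 \<Rightarrow> real^3"
  assumes "linear f" "inj f" shows "comb_equiv P (f ` P)"
proof -
  have "faces (f ` P) = image f ` faces P" unfolding faces_def by (rule faces_of_linear_image[OF assms])
  moreover have "inj_on (image f) (faces P)" using assms(2) by (metis inj_on_subset inj_image_eq_iff inj_onI)
  ultimately have "bij_betw (image f) (faces P) (faces (f ` P))" by (simp add: bij_betw_def)
  then show ?thesis unfolding comb_equiv_def using assms(2) by (intro exI[of _ "image f"]) (simp add: inj_image_subset_iff)
qed

lemma bipyramid_graph_linear_image:
  fixes f :: "real^3 \<Rightarrow> real^3"
  assumes f: "linear f" "inj f" and G: "bipyramid_graph k P n s v"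
  shows "bipyramid_graph k (f ` P) (f n) (f s) (f \<circ> v)"
proof -
  have face: "closed_segment (f a) (f b) face_of f ` P \<longleftrightarrow> closed_segment a b face_of P" for a b
    unfolding closed_segment_linear_image[OF f(1)] by (rule face_of_linear_image[OF f])
  have pt: "f x extreme_point_of f ` P \<longleftrightarrow> x extreme_point_of P" for x
    using face_of_linear_image[OF f, of "{x}" P] by (simp add: face_of_singleton)
  have "{x. x extreme_point_of f ` P} = f ` {x. x extreme_point_of P}"
  proof (intro equalityI subsetI)
    fix y assume y: "y \<in> {x. x extreme_point_of f ` P}"
    then obtain x where "y = f x" by (auto simp: extreme_point_of_def)
    then show "y \<in> f ` {x. x extreme_point_of P}" using y pt by blast
  next
    fix y assume "y \<in> f ` {x. x extreme_point_of P}"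
    then show "y \<in> {x. x extreme_point_of f ` P}" using pt by blast
  qed
  also have "\<dots> = insert (f n) (insert (f s) (range (f \<circ> v)))"
    using G by (simp add: bipyramid_graph_def image_comp)
  finally have ext: "{x. x extreme_point_of f ` P} = insert (f n) (insert (f s) (range (f \<circ> v)))" .
  have feq: "f a = f b \<longleftrightarrow> a = b" for a b using f(2) by (rule inj_eq)
  show ?thesis
    using G ext f unfolding bipyramid_graph_def
    by (auto simp: face feq polytope_linear_image intro!: comp_inj_on inj_on_subset[OF f(2)])
qed

text \<open>Summed over one period, the recurrence multiplies the sum by 2 cos (2 pi / k) instead of
  2.\<close>

lemma sum_gon_vertex:
  assumes k: "k \<ge> 3" shows "(\<Sum>i<k. gon_vertex k i) = 0"
proof -
  let ?v = "gon_vertex k" and ?s = "\<Sum>i<k. gon_vertex k i"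
  have k0: "k > 0" using k by simp
  have s1: "(\<Sum>i<k. ?v (Suc i)) = ?s" by (rule sum_periodic_shift[where h = ?v, OF k0 gon_vertex_periodic[OF k]])
  have s2: "(\<Sum>i<k. ?v (Suc (Suc i))) = (\<Sum>i<k. ?v (Suc i))"
    by (rule sum_periodic_shift[where h = "\<lambda>i. ?v (Suc i)", OF k0]) (simp add: gon_vertex_periodic[OF k] flip: add_Suc)
  have "(\<Sum>i<k. ?v (Suc (Suc i)) + ?v i) = (\<Sum>i<k. (2 * cos (2 * pi / real k)) *\<^sub>R ?v (Suc i))"
    by (intro sum.cong refl gon_vertex_recurrence[OF k])
  then have "?s + ?s = (2 * cos (2 * pi / real k)) *\<^sub>R ?s"
    unfolding sum.distrib s2 s1 scaleR_sum_right[symmetric] .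
  then have "2 *\<^sub>R ?s = (2 * cos (2 * pi / real k)) *\<^sub>R ?s" by (simp only: scaleR_2)
  then have "(2 - 2 * cos (2 * pi / real k)) *\<^sub>R ?s = 0" by (simp only: scaleR_diff_left) simp
  moreover have "2 - 2 * cos (2 * pi / real k) \<noteq> 0" using gon_angle_less[OF k, of 1] k by simp
  ultimately show ?thesis by (simp only: scaleR_eq_0_iff) simp
qed

text \<open>Scaling the standard bipyramid so that the equator has inradius 1 and the edges through the
  apices touch the unit sphere.\<close>

definition koebe_scaling :: "nat \<Rightarrow> real^3 \<Rightarrow> real^3" where
  "koebe_scaling k x = vector [x $ 1 / cos (pi / real k), x $ 2 / cos (pi / real k), x $ 3 / sin (pi / real k)]"

section \<open>Tangency, barycenter and coordinate field of the scaled bipyramid\<close>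

context
  fixes k :: nat
  assumes k: "k \<ge> 3"
begin

lemma scaling_pos: "cos (pi / real k) > 0" "sin (pi / real k) > 0"
proof -
  have p: "0 < pi / real k" using k by simp
  have "pi / real k < pi / 2" using k by (intro divide_strict_left_mono) simp_all
  then show "cos (pi / real k) > 0" "sin (pi / real k) > 0"
    using p by (intro cos_gt_zero sin_gt_zero2; simp)+
qed

lemma koebe_scaling_linear: "linear (koebe_scaling k)"
  by (rule linearI) (simp_all add: koebe_scaling_def vec_eq_iff forall_3 add_divide_distrib)

lemma koebe_scaling_inj: "inj (koebe_scaling k)"
proof (rule injI)
  fix x y assume "koebe_scaling k x = koebe_scaling k y"
  then show "x = y" using scaling_pos by (simp add: koebe_scaling_def vec_eq_iff forall_3)
qed

abbreviation (input) "kn \<equiv> koebe_scaling k north"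
abbreviation (input) "ks \<equiv> koebe_scaling k south"
abbreviation (input) "kv i \<equiv> koebe_scaling k (gon_vertex k i)"

lemma koebe_vertex_simps:
  "kn = vector [0, 0, 1 / sin (pi / real k)]" "ks = vector [0, 0, - 1 / sin (pi / real k)]"
  "kv i = (1 / cos (pi / real k)) *\<^sub>R gon_vertex k i"
  by (simp_all add: koebe_scaling_def gon_vertex_def vec_eq_iff forall_3)

lemma koebe_graph: "bipyramid_graph k (koebe_scaling k ` standard_bipyramid k) kn ks (\<lambda>i. kv i)"
  using bipyramid_graph_linear_image[OF koebe_scaling_linear koebe_scaling_inj standard_bipyramid_graph[OF k]]
  by (simp add: comp_def)

lemma koebe_tangent_length:
  "tangent_length kn = cos (pi / real k) / sin (pi / real k)"
  "tangent_length ks = cos (pi / real k) / sin (pi / real k)"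
  "tangent_length (kv i) = sin (pi / real k) / cos (pi / real k)"
proof -
  define c s where "c = cos (pi / real k)" and "s = sin (pi / real k)"
  have cs: "c > 0" "s > 0" "s\<^sup>2 + c\<^sup>2 = 1" using scaling_pos by (simp_all add: c_def s_def)
  have "1 / s\<^sup>2 - 1 = (c / s)\<^sup>2" "1 / c\<^sup>2 - 1 = (s / c)\<^sup>2"
  proof -
    have "1 / s\<^sup>2 - 1 = (1 - s\<^sup>2) / s\<^sup>2" "1 / c\<^sup>2 - 1 = (1 - c\<^sup>2) / c\<^sup>2" using cs(1,2) by (simp_all add: diff_divide_distrib)
    moreover have "1 - s\<^sup>2 = c\<^sup>2" "1 - c\<^sup>2 = s\<^sup>2" using cs(3) by simp_all
    ultimately show "1 / s\<^sup>2 - 1 = (c / s)\<^sup>2" "1 / c\<^sup>2 - 1 = (s / c)\<^sup>2" by (simp_all add: power_divide)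
  qed
  moreover have "kn \<bullet> kn = 1 / s\<^sup>2" "ks \<bullet> ks = 1 / s\<^sup>2"
    unfolding koebe_vertex_simps inner_vector_3 s_def by (simp_all add: power2_eq_square)
  moreover have "kv i \<bullet> kv i = 1 / c\<^sup>2"
    unfolding koebe_vertex_simps c_def using gon_vertex_inner[OF k, of i 0] by (simp add: power2_eq_square)
  ultimately show "tangent_length kn = cos (pi / real k) / sin (pi / real k)"
    "tangent_length ks = cos (pi / real k) / sin (pi / real k)"
    "tangent_length (kv i) = sin (pi / real k) / cos (pi / real k)"
    using cs(1,2) unfolding tangent_length_def c_def[symmetric] s_def[symmetric] by simp_all
qed

lemma koebe_tangent_length_pos: "tangent_length kn > 0" "tangent_length ks > 0" "tangent_length (kv i) > 0"
  unfolding koebe_tangent_length using scaling_pos by simp_all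

text \<open>The tangent lengths at apex and equator are cotangent and tangent of pi / k, with
  product 1; this matches the orthogonality of apices and equator.\<close>

lemma koebe_inner:
  "kn \<bullet> kv i = 1 - tangent_length kn * tangent_length (kv i)"
  "ks \<bullet> kv i = 1 - tangent_length ks * tangent_length (kv i)"
  "kv i \<bullet> kv (Suc i) = 1 - tangent_length (kv i) * tangent_length (kv (Suc i))"
proof -
  show "kn \<bullet> kv i = 1 - tangent_length kn * tangent_length (kv i)"
    "ks \<bullet> kv i = 1 - tangent_length ks * tangent_length (kv i)"
    unfolding koebe_tangent_length unfolding koebe_vertex_simps using scaling_pos
    by (simp_all add: gon_vertex_def inner_vector_3)
  define c s where "c = cos (pi / real k)" and "s = sin (pi / real k)"
  have cs: "c > 0" "s\<^sup>2 = 1 - c\<^sup>2" using scaling_pos by (simp_all add: c_def s_def sin_squared_eq)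
  have "cos (2 * pi * real 1 / real k) = 2 * c\<^sup>2 - 1"
    using cos_double_cos[of "pi / real k"] by (simp add: c_def)
  then have "kv i \<bullet> kv (Suc i) = (2 * c\<^sup>2 - 1) / c\<^sup>2"
    unfolding koebe_vertex_simps c_def[symmetric] using gon_vertex_inner[OF k, of i 1] by (simp add: power2_eq_square)
  also have "\<dots> = 1 - (1 - c\<^sup>2) / c\<^sup>2" using cs(1) by (simp add: diff_divide_distrib)
  also have "\<dots> = 1 - (s / c) * (s / c)" unfolding cs(2)[symmetric] by (simp add: power2_eq_square)
  finally show "kv i \<bullet> kv (Suc i) = 1 - tangent_length (kv i) * tangent_length (kv (Suc i))"
    unfolding koebe_tangent_length c_def s_def .
qed

lemmas koebe_tangent =
  tangent_segmentI[OF koebe_tangent_length_pos(1,3) koebe_inner(1)]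
  tangent_segmentI[OF koebe_tangent_length_pos(2,3) koebe_inner(2)]
  tangent_segmentI[OF koebe_tangent_length_pos(3,3) koebe_inner(3)]

lemma koebe_barycenter: "edge_barycenter (koebe_scaling k ` standard_bipyramid k) = 0"
proof -
  define a b where "a = tangent_length kn" and "b = tangent_length (kv 0)"
  have ab: "tangent_length kn = a" "tangent_length ks = a" "tangent_length (kv i) = b" for i
    by (simp_all add: a_def b_def koebe_tangent_length)
  have b0: "b > 0" using koebe_tangent_length_pos(3)[of 0] by (simp add: b_def)
  have ks: "ks = - kn" by (simp add: koebe_vertex_simps vec_eq_iff forall_3)
  have "(\<Sum>i<k. kv i) = koebe_scaling k (\<Sum>i<k. gon_vertex k i)"
    by (simp add: linear_sum[OF koebe_scaling_linear])
  then have s: "(\<Sum>i<k. kv i) = 0" unfolding sum_gon_vertex[OF k] using linear_0[OF koebe_scaling_linear] by simp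
  have s': "(\<Sum>i<k. kv (Suc i)) = 0"
    using sum_periodic_shift[of k "\<lambda>i. kv i"] k s gon_vertex_periodic[OF k] by simp
  \<comment> \<open>On the two edges from one equator vertex to the apices the apex parts of the
    contact points cancel, since \<open>ks = - kn\<close>; only multiples of equator vertices
    remain.\<close>
  have "(\<Sum>e\<in>{e. e edge_of koebe_scaling k ` standard_bipyramid k}. contact_point e)
     = (\<Sum>i<k. (a / (a + b)) *\<^sub>R kv i + (a / (a + b)) *\<^sub>R kv i + ((1 / 2) *\<^sub>R kv i + (1 / 2) *\<^sub>R kv (Suc i)))"
    unfolding bipyramid_edges(4)[OF koebe_graph k] koebe_tangent[THEN contact_point_unique] ab
    using b0 by (intro sum.cong refl) (simp add: ks)
  also have "\<dots> = 0" unfolding sum.distrib scaleR_sum_right[symmetric] s s' by simp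
  finally show ?thesis by (simp add: edge_barycenter_def)
qed

lemma koebe_springborn:
  assumes "bipyramid_over_ngon k B"
  shows "springborn_realization B (koebe_scaling k ` standard_bipyramid k)"
proof -
  let ?Q = "koebe_scaling k ` standard_bipyramid k"
  have "comb_equiv B (standard_bipyramid k)" using assms comb_equiv_sym by (simp add: bipyramid_over_ngon_def)
  then have "comb_equiv B ?Q" using comb_equiv_linear_image[OF koebe_scaling_linear koebe_scaling_inj] comb_equiv_trans by blast
  moreover have "polytope ?Q" using koebe_graph by (simp add: bipyramid_graph_def)
  moreover have "\<exists>x. tangent_at e x" if "e edge_of ?Q" for e
  proof -
    have "e \<in> {e. e edge_of ?Q}" using that by simp
    then show ?thesis unfolding bipyramid_edges(1)[OF koebe_graph k] using koebe_tangent by blast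
  qed
  ultimately show ?thesis using koebe_barycenter by (simp add: springborn_realization_def koebe_realization_def realization_def)
qed

text \<open>\<open>N\<close> is a multiple of \<open>2 * k\<close>, so all angles that occur are
  multiples of 2 pi / N, and of 4, so pi / 2 is one too. Sines thereby become cosines of such
  multiples, and Chebyshev polynomials express these through the generator.\<close>

lemma koebe_coordinate_field_subset:
  assumes F: "subfield F real_ring" and N: "N = 2 * k * g" "g > 0" "N = 4 * q" and x: "cos (2 * pi / real N) \<in> F"
  shows "coordinate_field (koebe_scaling k ` standard_bipyramid k) \<subseteq> F"
proof -
  note K = subfield_realD[OF F]
  have int: "of_int i \<in> F" for i using Rats_subset_subfield[OF F] by auto
  have N0: "real N > 0" using N(1,2) k by simp
  have poly: "poly (of_int_poly p) y \<in> F" if "y \<in> F" for p y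
    using that by (induction p) (auto simp: map_poly_pCons intro: K int)
  have cosF: "cos (2 * pi * real a / real N) \<in> F" for a
    using poly[OF x, of "chebyshev_poly a"] poly_chebyshev_poly[of a "2 * pi / real N"] by (simp add: mult_ac)
  have sinF: "sin (2 * pi * real a / real N) \<in> F" for a
  proof -
    have h: "pi / 2 = 2 * pi * real q / real N" using N(3) N0 by simp
    have "sin (2 * pi * real a / real N) = cos (2 * pi * real q / real N - 2 * pi * real a / real N)"
      unfolding h[symmetric] by (simp add: cos_diff)
    also have "2 * pi * real q / real N - 2 * pi * real a / real N = 2 * pi * (real q - real a) / real N"
      by (simp add: diff_divide_distrib right_diff_distrib)
    also have "cos \<dots> = cos (2 * pi * real (nat \<bar>int q - int a\<bar>) / real N)"
    proof (cases "q \<ge> a")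
      case False
      then have "real (nat \<bar>int q - int a\<bar>) = real a - real q" by simp
      then have "2 * pi * real (nat \<bar>int q - int a\<bar>) / real N = - (2 * pi * (real q - real a) / real N)"
        by (simp only: right_diff_distrib diff_divide_distrib minus_diff_eq)
      then show ?thesis by (simp only: cos_minus)
    qed simp
    finally show ?thesis using cosF[of "nat \<bar>int q - int a\<bar>"] by (simp only:)
  qed
  have g: "real N = 2 * real k * real g" using N(1) by simp
  have e: "2 * pi * real j / real k = 2 * pi * real (2 * g * j) / real N" "pi / real k = 2 * pi * real g / real N" for j
    unfolding g using N(2) k by simp_all
  have cd: "cos (2 * pi * real j / real k) \<in> F" "sin (2 * pi * real j / real k) \<in> F" "cos (pi / real k) \<in> F" "sin (pi / real k) \<in> F" for j
    unfolding e by (rule cosF sinF)+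
  note div = subfield_real_divide[OF F]
  have comp: "kn $ i \<in> F" "ks $ i \<in> F" "kv j $ i \<in> F" for i j
  proof -
    have "\<forall>i. kn $ i \<in> F" unfolding forall_3 koebe_vertex_simps by (simp add: K(1) div[OF K(2) cd(4)])
    then show "kn $ i \<in> F" ..
    have "\<forall>i. ks $ i \<in> F" unfolding forall_3 koebe_vertex_simps using K(3)[OF div[OF K(2) cd(4)]] by (simp add: K(1))
    then show "ks $ i \<in> F" ..
    have "\<forall>i. kv j $ i \<in> F" unfolding forall_3 koebe_scaling_def vector_3
      by (simp add: gon_vertex_def div[OF cd(1) cd(3)] div[OF cd(2) cd(3)] K(1))
    then show "kv j $ i \<in> F" ..
  qed
  have ext: "{x. x extreme_point_of koebe_scaling k ` standard_bipyramid k} = insert kn (insert ks (range (\<lambda>i. kv i)))"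
    using koebe_graph unfolding bipyramid_graph_def by (elim conjE)
  have "v $ i \<in> F" if "v extreme_point_of koebe_scaling k ` standard_bipyramid k" for v :: "real^3" and i
  proof -
    have "v \<in> insert kn (insert ks (range (\<lambda>i. kv i)))" using that unfolding ext[symmetric] by simp
    then show ?thesis by (elim insertE rangeE) (simp_all only: comp)
  qed
  then show ?thesis unfolding coordinate_field_def
    by (intro field.generate_field_min_subfield1[OF real_ring_field _ F]) auto
qed

text \<open>The least admissible \<open>N\<close> is \<open>2 * k\<close> for even \<open>k\<close>
  and \<open>4 * k\<close> for odd \<open>k\<close>. Its totient is \<open>2 * totient k\<close> in
  both cases, and the field of cos (2 pi / N) has half that degree.\<close>

lemma koebe_degree: "degree_over_rat (coordinate_field (koebe_scaling k ` standard_bipyramid k)) \<le> enat (totient k)"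
proof -
  obtain N g q where N: "N = 2 * k * g" "g > 0" "N = 4 * q" "totient N = 2 * totient k"
  proof (cases "even k")
    case True
    then obtain q where q: "k = 2 * q" by (elim evenE)
    have tot: "totient (2 * k) = 2 * totient k" using True by (simp add: totient_double)
    show thesis by (rule that[of "2 * k" 1 q]) (use q tot in linarith)+
  next
    case False
    have tot: "totient (2 * (2 * k)) = 2 * totient k" unfolding totient_double[of "2 * k"] using False by (simp add: totient_double)
    show thesis by (rule that[of "2 * (2 * k)" 2 k]) (use tot in linarith)+
  qed
  have N3: "N \<ge> 3" using N(1,2) k by (cases g) auto
  note F = cos_rational_angle_extension[OF N3, of 1, simplified]
  have "coordinate_field (koebe_scaling k ` standard_bipyramid k) \<subseteq> real_field.simple_extension \<rat> (cos (2 * pi / real N))"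
    by (rule koebe_coordinate_field_subset[OF F(1) N(1,2,3) F(3)])
  from degree_over_rat_mono[OF F(1,2) coordinate_field_subfield this] show ?thesis using N(4) by simp
qed

end

text \<open>For odd \<open>m\<close> the angle is 2 pi m / (2 k) with \<open>m\<close> coprime to
  \<open>2 * k\<close>; for even \<open>m\<close>, \<open>k\<close> is odd and the angle is 2 pi (m
  / 2) / k. Both give the same degree when \<open>k\<close> is odd.\<close>

lemma bipyramid_coordinate_degree:
  assumes k: "k \<ge> 3" and m: "coprime m k" and K: "subfield K real_ring" "cos (pi * real m / real k) \<in> K"
  shows "degree_over_rat K = \<infinity> \<or> (\<exists>e>0. degree_over_rat K = enat (e * (if even k then totient k else totient k div 2)))"
proof (cases "odd m")
  case True
  have m2: "coprime m (2 * k)" using True m by simp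
  have K2: "cos (2 * pi * real m / real (2 * k)) \<in> K" using K(2) by simp
  have tot: "totient (2 * k) div 2 = (if even k then totient k else totient k div 2)" by (simp add: totient_double)
  have k2: "2 * k \<ge> 3" using k by simp
  show ?thesis
  proof (rule degree_over_rat_cos_subfield[OF k2 m2 K(1) K2])
    fix e :: nat
    assume "e > 0" "degree_over_rat K = enat (e * (totient (2 * k) div 2))"
    then show ?thesis unfolding tot by blast
  qed (rule disjI1)
next
  case False
  have odd: "odd k"
  proof
    assume "even k"
    then have "2 dvd gcd m k" using False by simp
    then show False using m by simp
  qed
  obtain m' where m': "m = 2 * m'" using False by auto
  have c: "coprime m' k" using m unfolding m' by simp
  have "pi * real m / real k = 2 * pi * real m' / real k" unfolding m' by simp
  then have K2: "cos (2 * pi * real m' / real k) \<in> K" using K(2) by (simp only:)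
  show ?thesis
  proof (rule degree_over_rat_cos_subfield[OF k c K(1) K2])
    fix e :: nat
    assume "e > 0" "degree_over_rat K = enat (e * (totient k div 2))"
    then show ?thesis using odd by (intro disjI2 exI[of _ e]) simp
  qed (rule disjI1)
qed

lemma bipyramid_springborn_degree:
  assumes k: "k \<ge> 3" and B: "bipyramid_over_ngon k B"
  shows "odd k \<Longrightarrow> 2 * springborn_degree B = enat (totient k) \<or> springborn_degree B = enat (totient k)"
    "even k \<Longrightarrow> springborn_degree B = enat (totient k)"
proof -
  define A where "A = {degree_over_rat (coordinate_field Q) | Q. springborn_realization B Q}"
  have sd: "springborn_degree B = Inf A" by (simp add: springborn_degree_def A_def)
  have inA: "degree_over_rat (coordinate_field (koebe_scaling k ` standard_bipyramid k)) \<in> A"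
    unfolding A_def using koebe_springborn[OF k B] by blast
  have le: "springborn_degree B \<le> enat (totient k)"
    unfolding sd using Inf_lower[OF inA] koebe_degree[OF k] order_trans by blast
  \<comment> \<open>The minimum is attained, so the lower bound may be applied to one optimal
    realization.\<close>
  have "Inf A \<in> A" using inA by (metis (no_types, lifting) Inf_enat_def LeastI empty_iff)
  then obtain Q where Q: "springborn_realization B Q" "springborn_degree B = degree_over_rat (coordinate_field Q)"
    unfolding sd[symmetric] by (auto simp: A_def)
  have kr: "polytope Q" "comb_equiv B Q" "\<And>e. e edge_of Q \<Longrightarrow> \<exists>x. tangent_at e x" "edge_barycenter Q = 0"
    using Q(1) by (simp_all add: springborn_realization_def koebe_realization_def realization_def)
  have "comb_equiv (standard_bipyramid k) Q"
    using B kr(2) comb_equiv_trans by (simp add: bipyramid_over_ngon_def) blast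
  then obtain n s v where G: "bipyramid_graph k Q n s v"
    using bipyramid_graph_transfer[OF standard_bipyramid_graph[OF k] kr(1)] by blast
  obtain m where m: "coprime m k" "cos (pi * real m / real k) \<in> coordinate_field Q"
    using springborn_bipyramid_cos[OF k G kr(3,4)] by blast
  have "springborn_degree B \<noteq> \<infinity>" using le by (metis infinity_ileE)
  then obtain e where e: "e > 0" "springborn_degree B = enat (e * (if even k then totient k else totient k div 2))"
    using bipyramid_coordinate_degree[OF k m(1) coordinate_field_subfield m(2)] Q(2) by auto
  have tp: "totient k > 0" using k by simp
  {
    assume "odd k"
    have "even (totient k)" using k by (intro totient_even) simp
    then obtain d where d: "totient k = 2 * d" by (elim evenE)
    have "e * d \<le> 2 * d" using le e(2) \<open>odd k\<close> d by simp
    \<comment> \<open>The degree is a multiple of half the totient and at most the totient.\<close>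
    then have "e = 1 \<or> e = 2" using tp d e(1) by auto
    then show "2 * springborn_degree B = enat (totient k) \<or> springborn_degree B = enat (totient k)"
      using e(2) \<open>odd k\<close> d by (auto simp: numeral_eq_enat)
  next
    assume "even k"
    then have "e * totient k \<le> 1 * totient k" using le e(2) by simp
    then have "e = 1" using tp e(1) by (simp only: mult_le_cancel2) simp
    then show "springborn_degree B = enat (totient k)" using e(2) \<open>even k\<close> by simp
  }
qed

theorem theorem17:
  shows "(\<forall>k\<ge>4. \<forall>B. bipyramid_over_ngon k B \<longrightarrow>
            (odd k \<longrightarrow> 2 * springborn_degree B = enat (totient k) \<or>
                       springborn_degree B = enat (totient k)) \<and>
            (even k \<longrightarrow> springborn_degree B = enat (totient k))) \<and>
         (\<forall>N::nat. \<exists>P. three_polytope P \<and> enat N < springborn_degree P \<and> springborn_degree P < \<infinity>)"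
proof (intro conjI allI impI)
  fix k B assume k: "4 \<le> k" and B: "bipyramid_over_ngon k B"
  have k3: "3 \<le> k" using k by simp
  show "odd k \<Longrightarrow> 2 * springborn_degree B = enat (totient k) \<or> springborn_degree B = enat (totient k)"
    by (rule bipyramid_springborn_degree(1)[OF k3 B])
  show "even k \<Longrightarrow> springborn_degree B = enat (totient k)"
    by (rule bipyramid_springborn_degree(2)[OF k3 B])
next
  fix N :: nat
  \<comment> \<open>For an odd prime the degree is \<open>p - 1\<close> or half of it, and
    \<open>p > 2 * N + 3\<close> puts even the half above \<open>N\<close>.\<close>
  obtain p :: nat where p: "prime p" "p > 2 * N + 3" using bigger_prime by blast
  let ?P = "standard_bipyramid p"
  have p3: "p \<ge> 3" using p(2) by simp
  then have odd: "odd p" using prime_odd_nat[OF p(1)] by simp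
  have three: "three_polytope ?P"
    using polytope_standard_bipyramid[OF p3] aff_dim_standard_bipyramid[OF p3] by (simp add: three_polytope_def)
  then have "bipyramid_over_ngon p ?P" using comb_equiv_refl by (simp add: bipyramid_over_ngon_def)
  then have "2 * springborn_degree ?P = enat (p - 1) \<or> springborn_degree ?P = enat (p - 1)"
    using bipyramid_springborn_degree(1)[OF p3 _ odd] totient_prime[OF p(1)] by simp
  then obtain d where "springborn_degree ?P = enat d" "2 * d = p - 1 \<or> d = p - 1"
  proof
    assume two: "2 * springborn_degree ?P = enat (p - 1)"
    then obtain d where d: "springborn_degree ?P = enat d"
      by (cases "springborn_degree ?P") (simp_all add: numeral_eq_enat)
    then have "2 * d = p - 1" using two by (simp add: numeral_eq_enat)
    then show thesis using that d by blast
  next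
    assume "springborn_degree ?P = enat (p - 1)"
    then show thesis using that by blast
  qed
  moreover from this(2) have "N < d" using p(2) by linarith
  ultimately have "enat N < springborn_degree ?P" "springborn_degree ?P < \<infinity>" by simp_all
  with three have "three_polytope ?P \<and> enat N < springborn_degree ?P \<and> springborn_degree ?P < \<infinity>"
    by (rule conjI[OF _ conjI])
  then show "\<exists>P. three_polytope P \<and> enat N < springborn_degree P \<and> springborn_degree P < \<infinity>" ..
qed

end
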